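(* Let $E$ be a graph and $R$ a commutative ring with unit. Let $M$ be the free $R$-module with basis $\{\xi_\tau^n : n\in\mathbb{Z},\ \tau\in\mathfrak{T}_E\}$, where $\mathfrak{T}_E$ is the set of essentially aperiodic trails in $E$. Then there exist a $\mathbb{Z}$-graded $R$-algebra (with involution) $\mathcal{E}\subseteq \mathrm{End}_R(M)$ and a unique Cuntz-Krieger $E$-system $\Sigma=(S_\alpha)_{\alpha\in \mathrm{Path}(E)}\subset\mathcal{E}$ such that, for every $\alpha\in\mathrm{Path}(E)$, the map $S_\alpha: M\to M$ is given by $$S_\alpha(\xi_\tau^n)=\begin{cases}\xi_{\alpha\tau}^{\,l(\alpha)+n} & \text{if } r(\alpha)=s(\tau),\\ 0 & \text{otherwise,}\end{cases}\qquad \tau\in\mathfrak{T}_E,\ n\in\mathbb{Z}.$$ Moreover, the associated representation $\Pi_{\rm ap}:L_R(E)\to\mathcal{E}$ (the $R$-algebra homomorphism with $\Pi_{\rm ap}(\alpha\beta^* )=S_\alpha S_\beta^*$ for all paths $\alpha,\beta$ with $r(\alpha)=r(\beta)$) is injective.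
   Context: A graph $E=(E^0,E^1,r,s)$ consists of arbitrary sets $E^0$ (vertices), $E^1$ (edges) and maps $r,s:E^1\to E^0$. A sink is a vertex $v$ with $s^{-1}(v)=\emptyset$; $v$ is regular if $s^{-1}(v)$ is finite and nonempty. A path is a vertex (length $0$, with $s(v)=r(v)=v$) or a finite sequence $\mu=e_1\cdots e_n$ of edges with $r(e_i)=s(e_{i+1})$; $l(\mu)=n$ is its length, $s(\mu)=s(e_1)$, $r(\mu)=r(e_n)$; $\mathrm{Path}(E)$ is the set of all paths. A path of positive length is closed if $r(e_n)=s(e_1)$, and a closed path is a cycle if $s(e_i)\ne s(e_j)$ for $i\ne j$. An exit for $\mu=e_1\cdots e_n$ is an edge $e$ with $s(e)=s(e_i)$ and $e\neq e_i$ for some $i$. A trail is either a finite path (possibly of length zero) whose range is a sink, or an infinite sequence $e_1e_2\cdots$ of edges with $r(e_n)=s(e_{n+1})$ for all $n$. Its source $s(\tau)$ is its starting vertex; if $r(\alpha)=s(\tau)$ then $\alpha\tau$ denotes the concatenated trail. An infinite trail $e_1e_2\cdots$ is periodic if there are $j,k\ge 1$ with $e_{n+k}=e_n$ for all $n\ge j$; choosing $j,k$ with $j+k$ minimal (this choice is unique), its period is the closed path $e_j\cdots e_{j+k-1}$. A trail is essentially aperiodic if it is finite, or periodic with period a closed path (necessarily a cycle) without exits, or infinite and not periodic. The Leavitt path algebra $L_R(E)$ is the universal $R$-algebra generated by pairwise orthogonal idempotents $\{v:v\in E^0\}$ and elements $\{e,e^*:e\in E^1\}$ subject to: $s(e)e=e=er(e)$;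 $r(e)e^*=e^*=e^*s(e)$; $e^*e=r(e)$ and $e^*f=0$ for $e\ne f$; and $v=\sum_{s(e)=v}ee^*$ for every regular vertex $v$. For $\mu=e_1\cdots e_n$, $\mu^*=e_n^*\cdots e_1^*$ (and $v^*=v$). $L_R(E)$ is spanned over $R$ by the elements $\alpha\beta^*$ with $\alpha,\beta\in \mathrm{Path}(E)$, $r(\alpha)=r(\beta)$. For an $R$-algebra $\mathcal{A}$ with involution $*$, a Cuntz-Krieger $E$-system in $\mathcal{A}$ is a family $(S_\mu)_{\mu\in E^0\cup E^1}\subset\mathcal{A}$ such that: $S_vS_v=S_v$ and $S_vS_w=0$ for vertices $v\neq w$; $S_v^*=S_v$ for $v\in E^0$; $S_{s(e)}S_e=S_e=S_eS_{r(e)}$ for $e\in E^1$; $S_e^*S_e=S_{r(e)}$ and $S_e^*S_f=0$ for edges $e\neq f$; and $S_v=\sum_{s(e)=v}S_eS_e^*$ for every regular $v$. It is extended to all paths by $S_{\mu\nu}=S_\mu S_\nu$ when $r(\mu)=s(\nu)$. *)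

theory Defs
  imports
    "HOL-Library.Omega_Words_Fun"
    "Graph_Theory.Arc_Walk"
    "HOL-Algebra.Module"
begin

section \<open>Algebras over a commutative ring\<close>

text \<open>
  The locale \<open>algebra\<close> of HOL-Algebra describes commutative unital algebras. Leavitt path algebras
  are not commutative, and have a unit only if the graph has finitely many vertices. So the
  algebras below are associative with no condition on the field \<open>one\<close> of the record.
\<close>

locale assoc_algebra = module R A for R and A (structure) +
  assumes mult_closed [simp, intro]:
      "\<lbrakk>x \<in> carrier A; y \<in> carrier A\<rbrakk> \<Longrightarrow> x \<otimes>\<^bsub>A\<^esub> y \<in> carrier A"
    and mult_assoc:
      "\<lbrakk>x \<in> carrier A; y \<in> carrier A; z \<in> carrier A\<rbrakk>
        \<Longrightarrow> (x \<otimes>\<^bsub>A\<^esub> y) \<otimes>\<^bsub>A\<^esub> z = x \<otimes>\<^bsub>A\<^esub> (y \<otimes>\<^bsub>A\<^esub> z)"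
    and distrib_right:
      "\<lbrakk>x \<in> carrier A; y \<in> carrier A; z \<in> carrier A\<rbrakk>
        \<Longrightarrow> (x \<oplus>\<^bsub>A\<^esub> y) \<otimes>\<^bsub>A\<^esub> z = x \<otimes>\<^bsub>A\<^esub> z \<oplus>\<^bsub>A\<^esub> y \<otimes>\<^bsub>A\<^esub> z"
    and distrib_left:
      "\<lbrakk>x \<in> carrier A; y \<in> carrier A; z \<in> carrier A\<rbrakk>
        \<Longrightarrow> x \<otimes>\<^bsub>A\<^esub> (y \<oplus>\<^bsub>A\<^esub> z) = x \<otimes>\<^bsub>A\<^esub> y \<oplus>\<^bsub>A\<^esub> x \<otimes>\<^bsub>A\<^esub> z"
    and smult_mult_left:
      "\<lbrakk>a \<in> carrier R; x \<in> carrier A; y \<in> carrier A\<rbrakk>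
        \<Longrightarrow> (a \<odot>\<^bsub>A\<^esub> x) \<otimes>\<^bsub>A\<^esub> y = a \<odot>\<^bsub>A\<^esub> (x \<otimes>\<^bsub>A\<^esub> y)"
    and smult_mult_right:
      "\<lbrakk>a \<in> carrier R; x \<in> carrier A; y \<in> carrier A\<rbrakk>
        \<Longrightarrow> x \<otimes>\<^bsub>A\<^esub> (a \<odot>\<^bsub>A\<^esub> y) = a \<odot>\<^bsub>A\<^esub> (x \<otimes>\<^bsub>A\<^esub> y)"

definition subalgebra ::
    "('r, 'm) ring_scheme \<Rightarrow> ('r, 'a) module \<Rightarrow> ('r, 'a) module \<Rightarrow> bool" where
  "subalgebra R A B \<longleftrightarrow>
     assoc_algebra R A \<and> carrier A \<subseteq> carrier B \<and> A = B\<lparr>carrier := carrier A\<rparr>"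

definition alg_hom ::
    "('r, 'm) ring_scheme \<Rightarrow> ('r, 'a) module \<Rightarrow> ('r, 'b) module \<Rightarrow> ('a \<Rightarrow> 'b) set" where
  "alg_hom R A B = {h \<in> carrier A \<rightarrow> carrier B.
     (\<forall>x\<in>carrier A. \<forall>y\<in>carrier A. h (x \<oplus>\<^bsub>A\<^esub> y) = h x \<oplus>\<^bsub>B\<^esub> h y) \<and>
     (\<forall>x\<in>carrier A. \<forall>y\<in>carrier A. h (x \<otimes>\<^bsub>A\<^esub> y) = h x \<otimes>\<^bsub>B\<^esub> h y) \<and>
     (\<forall>a\<in>carrier R. \<forall>x\<in>carrier A. h (a \<odot>\<^bsub>A\<^esub> x) = a \<odot>\<^bsub>B\<^esub> h x)}"

definition involution_on ::
    "('r, 'm) ring_scheme \<Rightarrow> ('r, 'a) module \<Rightarrow> ('a \<Rightarrow> 'a) \<Rightarrow> bool" where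
  "involution_on R A star \<longleftrightarrow>
     (\<forall>x\<in>carrier A. star x \<in> carrier A \<and> star (star x) = x) \<and>
     (\<forall>x\<in>carrier A. \<forall>y\<in>carrier A. star (x \<oplus>\<^bsub>A\<^esub> y) = star x \<oplus>\<^bsub>A\<^esub> star y) \<and>
     (\<forall>x\<in>carrier A. \<forall>y\<in>carrier A. star (x \<otimes>\<^bsub>A\<^esub> y) = star y \<otimes>\<^bsub>A\<^esub> star x) \<and>
     (\<forall>a\<in>carrier R. \<forall>x\<in>carrier A. star (a \<odot>\<^bsub>A\<^esub> x) = a \<odot>\<^bsub>A\<^esub> star x)"

definition int_grading ::
    "('r, 'm) ring_scheme \<Rightarrow> ('r, 'a) module \<Rightarrow> (int \<Rightarrow> 'a set) \<Rightarrow> bool" where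
  "int_grading R A gr \<longleftrightarrow>
     (\<forall>k. submodule (gr k) R A) \<and>
     (\<forall>x\<in>carrier A. \<exists>!c. (\<forall>k. c k \<in> gr k) \<and> finite {k. c k \<noteq> \<zero>\<^bsub>A\<^esub>} \<and>
                          x = (\<Oplus>\<^bsub>A\<^esub>k\<in>{k. c k \<noteq> \<zero>\<^bsub>A\<^esub>}. c k)) \<and>
     (\<forall>j k. \<forall>x\<in>gr j. \<forall>y\<in>gr k. x \<otimes>\<^bsub>A\<^esub> y \<in> gr (j + k))"

text \<open>
  The ring fields \<open>mult\<close> and \<open>one\<close> of a module record play no role for the free module.
\<close>

definition free_module :: "('r, 'm) ring_scheme \<Rightarrow> 'i set \<Rightarrow> ('r, 'i \<Rightarrow> 'r) module" where
  "free_module R I =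
     \<lparr>carrier = {f. (\<forall>i\<in>I. f i \<in> carrier R) \<and> (\<forall>i. i \<notin> I \<longrightarrow> f i = \<zero>\<^bsub>R\<^esub>) \<and>
                    finite {i. f i \<noteq> \<zero>\<^bsub>R\<^esub>}},
      mult = undefined, one = undefined,
      zero = (\<lambda>i. \<zero>\<^bsub>R\<^esub>), add = (\<lambda>f g i. f i \<oplus>\<^bsub>R\<^esub> g i),
      smult = (\<lambda>a f i. a \<otimes>\<^bsub>R\<^esub> f i)\<rparr>"

definition free_basis :: "('r, 'm) ring_scheme \<Rightarrow> 'i \<Rightarrow> 'i \<Rightarrow> 'r" where
  "free_basis R i = (\<lambda>j. if j = i then \<one>\<^bsub>R\<^esub> else \<zero>\<^bsub>R\<^esub>)"

definition End_alg ::
    "('r, 'm) ring_scheme \<Rightarrow> ('r, 'a) module \<Rightarrow> ('r, 'a \<Rightarrow> 'a) module" where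
  "End_alg R M =
     \<lparr>carrier = {f \<in> carrier M \<rightarrow>\<^sub>E carrier M.
        (\<forall>x\<in>carrier M. \<forall>y\<in>carrier M. f (x \<oplus>\<^bsub>M\<^esub> y) = f x \<oplus>\<^bsub>M\<^esub> f y) \<and>
        (\<forall>a\<in>carrier R. \<forall>x\<in>carrier M. f (a \<odot>\<^bsub>M\<^esub> x) = a \<odot>\<^bsub>M\<^esub> f x)},
      mult = compose (carrier M), one = (\<lambda>x\<in>carrier M. x),
      zero = (\<lambda>x\<in>carrier M. \<zero>\<^bsub>M\<^esub>), add = (\<lambda>f g. \<lambda>x\<in>carrier M. f x \<oplus>\<^bsub>M\<^esub> g x),
      smult = (\<lambda>a f. \<lambda>x\<in>carrier M. a \<odot>\<^bsub>M\<^esub> f x)\<rparr>"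


section \<open>Algebras given by generators and relations\<close>

text \<open>
  The universal \<open>R\<close>-algebra (without unit) on generators \<open>X\<close> subject to relations \<open>Q\<close> is the set of
  formal algebra expressions over \<open>X\<close>, modulo the least congruence that contains \<open>Q\<close> and
  satisfies the axioms of an associative \<open>R\<close>-algebra. The universal property is
  \<open>presented_universal\<close> below.
\<close>

datatype ('r, 'g) alg_term =
    Gen 'g
  | Zero
  | Neg "('r, 'g) alg_term"
  | Add "('r, 'g) alg_term" "('r, 'g) alg_term"
  | Mul "('r, 'g) alg_term" "('r, 'g) alg_term"
  | Scal 'r "('r, 'g) alg_term"

inductive_set alg_terms ::
    "('r, 'm) ring_scheme \<Rightarrow> 'g set \<Rightarrow> ('r, 'g) alg_term set"
  for R :: "('r, 'm) ring_scheme" and X :: "'g set" where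
  Gen: "x \<in> X \<Longrightarrow> Gen x \<in> alg_terms R X"
| Zero: "Zero \<in> alg_terms R X"
| Neg: "s \<in> alg_terms R X \<Longrightarrow> Neg s \<in> alg_terms R X"
| Add: "\<lbrakk>s \<in> alg_terms R X; t \<in> alg_terms R X\<rbrakk> \<Longrightarrow> Add s t \<in> alg_terms R X"
| Mul: "\<lbrakk>s \<in> alg_terms R X; t \<in> alg_terms R X\<rbrakk> \<Longrightarrow> Mul s t \<in> alg_terms R X"
| Scal: "\<lbrakk>a \<in> carrier R; s \<in> alg_terms R X\<rbrakk> \<Longrightarrow> Scal a s \<in> alg_terms R X"

inductive_set alg_cong ::
    "('r, 'm) ring_scheme \<Rightarrow> 'g set \<Rightarrow> (('r, 'g) alg_term \<times> ('r, 'g) alg_term) set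
      \<Rightarrow> (('r, 'g) alg_term \<times> ('r, 'g) alg_term) set"
  for R :: "('r, 'm) ring_scheme" and X :: "'g set" and Q where
  rel: "\<lbrakk>(s, t) \<in> Q; s \<in> alg_terms R X; t \<in> alg_terms R X\<rbrakk> \<Longrightarrow> (s, t) \<in> alg_cong R X Q"
| refl: "s \<in> alg_terms R X \<Longrightarrow> (s, s) \<in> alg_cong R X Q"
| sym: "(s, t) \<in> alg_cong R X Q \<Longrightarrow> (t, s) \<in> alg_cong R X Q"
| trans: "\<lbrakk>(s, t) \<in> alg_cong R X Q; (t, u) \<in> alg_cong R X Q\<rbrakk> \<Longrightarrow> (s, u) \<in> alg_cong R X Q"
| Neg_cong: "(s, s') \<in> alg_cong R X Q \<Longrightarrow> (Neg s, Neg s') \<in> alg_cong R X Q"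
| Add_cong: "\<lbrakk>(s, s') \<in> alg_cong R X Q; (t, t') \<in> alg_cong R X Q\<rbrakk>
    \<Longrightarrow> (Add s t, Add s' t') \<in> alg_cong R X Q"
| Mul_cong: "\<lbrakk>(s, s') \<in> alg_cong R X Q; (t, t') \<in> alg_cong R X Q\<rbrakk>
    \<Longrightarrow> (Mul s t, Mul s' t') \<in> alg_cong R X Q"
| Scal_cong: "\<lbrakk>a \<in> carrier R; (s, s') \<in> alg_cong R X Q\<rbrakk>
    \<Longrightarrow> (Scal a s, Scal a s') \<in> alg_cong R X Q"
| Add_assoc: "\<lbrakk>s \<in> alg_terms R X; t \<in> alg_terms R X; u \<in> alg_terms R X\<rbrakk>
    \<Longrightarrow> (Add (Add s t) u, Add s (Add t u)) \<in> alg_cong R X Q"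
| Add_comm: "\<lbrakk>s \<in> alg_terms R X; t \<in> alg_terms R X\<rbrakk>
    \<Longrightarrow> (Add s t, Add t s) \<in> alg_cong R X Q"
| Add_Zero: "s \<in> alg_terms R X \<Longrightarrow> (Add Zero s, s) \<in> alg_cong R X Q"
| Add_Neg: "s \<in> alg_terms R X \<Longrightarrow> (Add (Neg s) s, Zero) \<in> alg_cong R X Q"
| Mul_assoc: "\<lbrakk>s \<in> alg_terms R X; t \<in> alg_terms R X; u \<in> alg_terms R X\<rbrakk>
    \<Longrightarrow> (Mul (Mul s t) u, Mul s (Mul t u)) \<in> alg_cong R X Q"
| distrib_right: "\<lbrakk>s \<in> alg_terms R X; t \<in> alg_terms R X; u \<in> alg_terms R X\<rbrakk>
    \<Longrightarrow> (Mul (Add s t) u, Add (Mul s u) (Mul t u)) \<in> alg_cong R X Q"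
| distrib_left: "\<lbrakk>s \<in> alg_terms R X; t \<in> alg_terms R X; u \<in> alg_terms R X\<rbrakk>
    \<Longrightarrow> (Mul s (Add t u), Add (Mul s t) (Mul s u)) \<in> alg_cong R X Q"
| Scal_add: "\<lbrakk>a \<in> carrier R; b \<in> carrier R; s \<in> alg_terms R X\<rbrakk>
    \<Longrightarrow> (Scal (a \<oplus>\<^bsub>R\<^esub> b) s, Add (Scal a s) (Scal b s)) \<in> alg_cong R X Q"
| Scal_Add: "\<lbrakk>a \<in> carrier R; s \<in> alg_terms R X; t \<in> alg_terms R X\<rbrakk>
    \<Longrightarrow> (Scal a (Add s t), Add (Scal a s) (Scal a t)) \<in> alg_cong R X Q"
| Scal_mult: "\<lbrakk>a \<in> carrier R; b \<in> carrier R; s \<in> alg_terms R X\<rbrakk>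
    \<Longrightarrow> (Scal (a \<otimes>\<^bsub>R\<^esub> b) s, Scal a (Scal b s)) \<in> alg_cong R X Q"
| Scal_one: "s \<in> alg_terms R X \<Longrightarrow> (Scal \<one>\<^bsub>R\<^esub> s, s) \<in> alg_cong R X Q"
| Scal_Mul_left: "\<lbrakk>a \<in> carrier R; s \<in> alg_terms R X; t \<in> alg_terms R X\<rbrakk>
    \<Longrightarrow> (Mul (Scal a s) t, Scal a (Mul s t)) \<in> alg_cong R X Q"
| Scal_Mul_right: "\<lbrakk>a \<in> carrier R; s \<in> alg_terms R X; t \<in> alg_terms R X\<rbrakk>
    \<Longrightarrow> (Mul s (Scal a t), Scal a (Mul s t)) \<in> alg_cong R X Q"

definition presented_algebra ::
    "('r, 'm) ring_scheme \<Rightarrow> 'g set \<Rightarrow> (('r, 'g) alg_term \<times> ('r, 'g) alg_term) set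
      \<Rightarrow> ('r, ('r, 'g) alg_term set) module" where
  "presented_algebra R X Q = (let cls = (\<lambda>t. alg_cong R X Q `` {t}) in
     \<lparr>carrier = alg_terms R X // alg_cong R X Q,
      mult = (\<lambda>x y. \<Union>s\<in>x. \<Union>t\<in>y. cls (Mul s t)), one = undefined,
      zero = cls Zero, add = (\<lambda>x y. \<Union>s\<in>x. \<Union>t\<in>y. cls (Add s t)),
      smult = (\<lambda>a x. \<Union>s\<in>x. cls (Scal a s))\<rparr>)"

primrec alg_eval :: "('r, 'b) module \<Rightarrow> ('g \<Rightarrow> 'b) \<Rightarrow> ('r, 'g) alg_term \<Rightarrow> 'b" where
  "alg_eval B \<phi> (Gen x) = \<phi> x"
| "alg_eval B \<phi> Zero = \<zero>\<^bsub>B\<^esub>"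
| "alg_eval B \<phi> (Neg s) = \<ominus>\<^bsub>B\<^esub> alg_eval B \<phi> s"
| "alg_eval B \<phi> (Add s t) = alg_eval B \<phi> s \<oplus>\<^bsub>B\<^esub> alg_eval B \<phi> t"
| "alg_eval B \<phi> (Mul s t) = alg_eval B \<phi> s \<otimes>\<^bsub>B\<^esub> alg_eval B \<phi> t"
| "alg_eval B \<phi> (Scal a s) = a \<odot>\<^bsub>B\<^esub> alg_eval B \<phi> s"


locale algebra_presentation = cring R for R :: "('r, 'm) ring_scheme" (structure) +
  fixes X :: "'g set" and Q :: "(('r, 'g) alg_term \<times> ('r, 'g) alg_term) set"
begin

abbreviation "T \<equiv> alg_terms R X"
abbreviation "C \<equiv> alg_cong R X Q"
abbreviation "P \<equiv> presented_algebra R X Q"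

lemma cong_terms: "(s, t) \<in> C \<Longrightarrow> s \<in> T \<and> t \<in> T"
  by (induction rule: alg_cong.induct) (auto intro: alg_terms.intros)

lemma equiv_cong: "equiv T C"
proof (rule equivI)
  show "C \<subseteq> T \<times> T" using cong_terms by auto
  show "refl_on T C" using cong_terms by (auto simp: refl_on_def intro: alg_cong.refl)
  show "sym C" by (auto simp: sym_def intro: alg_cong.sym)
  show "trans C" by (auto simp: trans_def intro: alg_cong.trans)
qed

lemma cls_eq_iff: "s \<in> T \<Longrightarrow> t \<in> T \<Longrightarrow> C `` {s} = C `` {t} \<longleftrightarrow> (s, t) \<in> C"
  using equiv_cong by (simp add: eq_equiv_class_iff)

lemma cls_eqI: "(s, t) \<in> C \<Longrightarrow> C `` {s} = C `` {t}"
  by (rule equiv_class_eq[OF equiv_cong])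

lemma carrierE:
  assumes "x \<in> carrier P"
  obtains t where "t \<in> T" "x = C `` {t}"
  using assms by (auto simp: presented_algebra_def Let_def elim: quotientE)

lemma cls_closed: "t \<in> T \<Longrightarrow> C `` {t} \<in> carrier P"
  by (simp add: presented_algebra_def Let_def quotientI)

lemma zero_cls: "\<zero>\<^bsub>P\<^esub> = C `` {Zero}"
  by (simp add: presented_algebra_def Let_def)

lemma add_cls: "s \<in> T \<Longrightarrow> t \<in> T \<Longrightarrow> C `` {s} \<oplus>\<^bsub>P\<^esub> C `` {t} = C `` {Add s t}"
  unfolding presented_algebra_def Let_def
  by (simp, rule UN_equiv_class2[OF equiv_cong equiv_cong])
     (auto intro!: congruent2I' equiv_class_eq[OF equiv_cong] alg_cong.Add_cong)

lemma mult_cls: "s \<in> T \<Longrightarrow> t \<in> T \<Longrightarrow> C `` {s} \<otimes>\<^bsub>P\<^esub> C `` {t} = C `` {Mul s t}"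
  unfolding presented_algebra_def Let_def
  by (simp, rule UN_equiv_class2[OF equiv_cong equiv_cong])
     (auto intro!: congruent2I' equiv_class_eq[OF equiv_cong] alg_cong.Mul_cong)

lemma smult_cls: "a \<in> carrier R \<Longrightarrow> s \<in> T \<Longrightarrow> a \<odot>\<^bsub>P\<^esub> C `` {s} = C `` {Scal a s}"
  unfolding presented_algebra_def Let_def
  by (simp, rule UN_equiv_class[OF equiv_cong])
     (auto intro!: congruentI equiv_class_eq[OF equiv_cong] alg_cong.Scal_cong)

lemmas cls_simps = zero_cls add_cls mult_cls smult_cls cls_closed alg_terms.intros

theorem presented_assoc_algebra: "assoc_algebra R P"
proof -
  have grp: "abelian_group P"
  proof (rule abelian_groupI)
    fix x assume "x \<in> carrier P"
    then obtain t where t: "t \<in> T" "x = C `` {t}" by (rule carrierE)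
    show "\<exists>y\<in>carrier P. y \<oplus>\<^bsub>P\<^esub> x = \<zero>\<^bsub>P\<^esub>"
      by (rule bexI[of _ "C `` {Neg t}"]) 
         (use t in \<open>auto simp: cls_simps cls_eq_iff intro: alg_cong.intros\<close>)
  qed (auto elim!: carrierE simp: cls_simps intro!: cls_eqI intro: alg_cong.intros del: equalityI)
  have mod: "module R P"
    by (rule moduleI[OF is_cring grp])
       (auto elim!: carrierE simp: cls_simps intro!: cls_eqI intro: alg_cong.intros del: equalityI)
  show ?thesis
    by (intro assoc_algebra.intro mod assoc_algebra_axioms.intro)
       (auto elim!: carrierE simp: cls_simps intro!: cls_eqI intro: alg_cong.intros del: equalityI)
qed

lemma alg_eval_closed:
  assumes "assoc_algebra R B" "\<phi> \<in> X \<rightarrow> carrier B" "t \<in> T"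
  shows "alg_eval B \<phi> t \<in> carrier B"
proof -
  interpret B: assoc_algebra R B by fact
  show ?thesis using assms(3) by induction (use assms(2) in auto)
qed

lemma alg_eval_cong:
  assumes B: "assoc_algebra R B" and \<phi>: "\<phi> \<in> X \<rightarrow> carrier B"
    and Q: "\<And>s t. (s, t) \<in> Q \<Longrightarrow> s \<in> T \<Longrightarrow> t \<in> T \<Longrightarrow> alg_eval B \<phi> s = alg_eval B \<phi> t"
    and "(s, t) \<in> C"
  shows "alg_eval B \<phi> s = alg_eval B \<phi> t"
proof -
  interpret B: assoc_algebra R B by fact
  note [simp] = alg_eval_closed[OF B \<phi>]
  show ?thesis using assms(4)
    by induction
       (auto simp: Q B.a_ac B.r_neg B.mult_assoc B.distrib_right B.distrib_left B.smult_l_distr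
         B.smult_r_distr B.smult_assoc1 B.smult_mult_left B.smult_mult_right)
qed

theorem presented_universal:
  assumes B: "assoc_algebra R B" and \<phi>: "\<phi> \<in> X \<rightarrow> carrier B"
    and Q: "\<And>s t. (s, t) \<in> Q \<Longrightarrow> s \<in> T \<Longrightarrow> t \<in> T \<Longrightarrow> alg_eval B \<phi> s = alg_eval B \<phi> t"
  shows "\<exists>!h. h \<in> extensional (carrier P) \<and> h \<in> alg_hom R P B \<and> (\<forall>x\<in>X. h (C `` {Gen x}) = \<phi> x)"
proof -
  interpret B: assoc_algebra R B by fact
  interpret P: assoc_algebra R P by (rule presented_assoc_algebra)
  define h where "h = (\<lambda>x\<in>carrier P. alg_eval B \<phi> (SOME t. t \<in> T \<and> x = C `` {t}))"
  have h: "h (C `` {t}) = alg_eval B \<phi> t" if t: "t \<in> T" for t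
  proof -
    let ?s = "SOME s. s \<in> T \<and> C `` {t} = C `` {s}"
    have "?s \<in> T \<and> C `` {t} = C `` {?s}" by (rule someI[of _ t]) (simp add: t)
    hence "(?s, t) \<in> C" using t cls_eq_iff by (metis (lifting))
    thus ?thesis using alg_eval_cong[OF B \<phi> Q] t by (simp add: h_def cls_closed)
  qed
  show ?thesis
  proof (rule ex1I[of _ h])
    show "h \<in> extensional (carrier P) \<and> h \<in> alg_hom R P B \<and> (\<forall>x\<in>X. h (C `` {Gen x}) = \<phi> x)"
      by (auto simp: alg_hom_def h cls_simps alg_eval_closed[OF B \<phi>] elim!: carrierE)
         (simp add: h_def)
  next
    fix g assume g: "g \<in> extensional (carrier P) \<and> g \<in> alg_hom R P B \<and> (\<forall>x\<in>X. g (C `` {Gen x}) = \<phi> x)"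
    have gc: "x \<in> carrier P \<Longrightarrow> g x \<in> carrier B" for x using g by (auto simp: alg_hom_def)
    have ga: "x \<in> carrier P \<Longrightarrow> y \<in> carrier P \<Longrightarrow> g (x \<oplus>\<^bsub>P\<^esub> y) = g x \<oplus>\<^bsub>B\<^esub> g y" for x y
      using g by (auto simp: alg_hom_def)
    have g0: "g \<zero>\<^bsub>P\<^esub> = \<zero>\<^bsub>B\<^esub>"
      using ga[of "\<zero>\<^bsub>P\<^esub>" "\<zero>\<^bsub>P\<^esub>"] gc[of "\<zero>\<^bsub>P\<^esub>"] by simp
    have "g (C `` {t}) = alg_eval B \<phi> t" if "t \<in> T" for t using that
    proof induction
      case (Neg s)
      have "(Add (Neg s) s, Zero) \<in> C" using Neg by (auto intro: alg_cong.intros)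
      hence "C `` {Neg s} \<oplus>\<^bsub>P\<^esub> C `` {s} = \<zero>\<^bsub>P\<^esub>" using Neg by (simp add: cls_simps cls_eq_iff)
      hence "g (C `` {Neg s}) \<oplus>\<^bsub>B\<^esub> g (C `` {s}) = \<zero>\<^bsub>B\<^esub>"
        using ga g0 Neg by (metis cls_closed alg_terms.Neg)
      thus ?case using Neg gc[of "C `` {Neg s}"] alg_eval_closed[OF B \<phi>, of s] B.minus_equality
        by (simp add: cls_closed alg_terms.Neg)
    next
      case Zero thus ?case using g0 by (simp add: zero_cls)
    qed (use g in \<open>auto simp: alg_hom_def cls_closed simp flip: add_cls mult_cls smult_cls\<close>)
    thus "g = h"
      by (intro extensionalityI[of _ "carrier P"]) (use g in \<open>auto simp: h elim!: carrierE\<close>, simp add: h_def)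
  qed
qed

end


section \<open>Paths and trails\<close>

text \<open>
  A graph is a \<^locale>\<open>wf_digraph\<close>, with source \<open>tail\<close> and range \<open>head\<close>. A path is a pair of its
  source and its list of edges, so that \<open>(v, [])\<close> is the vertex \<open>v\<close> as a path of length zero.
\<close>

type_synonym ('v, 'e) gpath = "'v \<times> 'e list"

definition is_sink :: "('v, 'e) pre_digraph \<Rightarrow> 'v \<Rightarrow> bool" where
  "is_sink G v \<longleftrightarrow> v \<in> verts G \<and> out_arcs G v = {}"

definition regular_vertex :: "('v, 'e) pre_digraph \<Rightarrow> 'v \<Rightarrow> bool" where
  "regular_vertex G v \<longleftrightarrow> v \<in> verts G \<and> finite (out_arcs G v) \<and> out_arcs G v \<noteq> {}"

definition gpaths :: "('v, 'e) pre_digraph \<Rightarrow> ('v, 'e) gpath set" where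
  "gpaths G = {(u, p). \<exists>v. pre_digraph.awalk G u p v}"

definition path_range :: "('v, 'e) pre_digraph \<Rightarrow> ('v, 'e) gpath \<Rightarrow> 'v" where
  "path_range G \<alpha> = last (pre_digraph.awalk_verts G (fst \<alpha>) (snd \<alpha>))"

abbreviation path_source :: "('v, 'e) gpath \<Rightarrow> 'v" where
  "path_source \<alpha> \<equiv> fst \<alpha>"

abbreviation path_length :: "('v, 'e) gpath \<Rightarrow> nat" where
  "path_length \<alpha> \<equiv> length (snd \<alpha>)"

abbreviation vertex_path :: "'v \<Rightarrow> ('v, 'e) gpath" where
  "vertex_path v \<equiv> (v, [])"

abbreviation edge_path :: "('v, 'e) pre_digraph \<Rightarrow> 'e \<Rightarrow> ('v, 'e) gpath" where
  "edge_path G e \<equiv> (tail G e, [e])"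

definition path_append :: "('v, 'e) gpath \<Rightarrow> ('v, 'e) gpath \<Rightarrow> ('v, 'e) gpath" where
  "path_append \<alpha> \<beta> = (fst \<alpha>, snd \<alpha> @ snd \<beta>)"

definition has_exit :: "('v, 'e) pre_digraph \<Rightarrow> 'e list \<Rightarrow> bool" where
  "has_exit G p \<longleftrightarrow> (\<exists>i<length p. \<exists>e\<in>arcs G. tail G e = tail G (p ! i) \<and> e \<noteq> p ! i)"

datatype ('v, 'e) gtrail = FinTrail "('v, 'e) gpath" | InfTrail "'e word"

definition trails :: "('v, 'e) pre_digraph \<Rightarrow> ('v, 'e) gtrail set" where
  "trails G = {FinTrail \<alpha> |\<alpha>. \<alpha> \<in> gpaths G \<and> is_sink G (path_range G \<alpha>)} \<union>
              {InfTrail w |w. \<forall>n. w n \<in> arcs G \<and> head G (w n) = tail G (w (Suc n))}"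

fun trail_source :: "('v, 'e) pre_digraph \<Rightarrow> ('v, 'e) gtrail \<Rightarrow> 'v" where
  "trail_source G (FinTrail \<alpha>) = path_source \<alpha>"
| "trail_source G (InfTrail w) = tail G (w 0)"

fun trail_append :: "('v, 'e) gpath \<Rightarrow> ('v, 'e) gtrail \<Rightarrow> ('v, 'e) gtrail" where
  "trail_append \<alpha> (FinTrail \<beta>) = FinTrail (path_append \<alpha> \<beta>)"
| "trail_append \<alpha> (InfTrail w) = InfTrail (snd \<alpha> \<frown> w)"

text \<open>
  The edge \<open>e\<^sub>n\<close> of an infinite trail \<open>w\<close> is \<open>w (n - 1)\<close>. This moves the start of the periodic part
  down by one and leaves unchanged which pair has the least sum.
\<close>

definition repeats_from :: "'e word \<Rightarrow> nat \<Rightarrow> nat \<Rightarrow> bool" where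
  "repeats_from w j k \<longleftrightarrow> 1 \<le> k \<and> (\<forall>n\<ge>j. w (n + k) = w n)"

definition periodic :: "'e word \<Rightarrow> bool" where
  "periodic w \<longleftrightarrow> (\<exists>j k. repeats_from w j k)"

definition is_period :: "'e word \<Rightarrow> 'e list \<Rightarrow> bool" where
  "is_period w p \<longleftrightarrow> (\<exists>j k. repeats_from w j k \<and>
     (\<forall>j' k'. repeats_from w j' k' \<longrightarrow> j + k \<le> j' + k') \<and> p = map w [j..<j + k])"

fun essentially_aperiodic :: "('v, 'e) pre_digraph \<Rightarrow> ('v, 'e) gtrail \<Rightarrow> bool" where
  "essentially_aperiodic G (FinTrail \<alpha>) \<longleftrightarrow> True"
| "essentially_aperiodic G (InfTrail w) \<longleftrightarrow> \<not> periodic w \<or> (\<exists>p. is_period w p \<and> \<not> has_exit G p)"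

definition ap_trails :: "('v, 'e) pre_digraph \<Rightarrow> ('v, 'e) gtrail set" where
  "ap_trails G = {\<tau> \<in> trails G. essentially_aperiodic G \<tau>}"


section \<open>Leavitt path algebras and Cuntz-Krieger systems\<close>

datatype ('v, 'e) leavitt_gen = Vert 'v | Edge 'e | Ghost 'e

definition leavitt_gens :: "('v, 'e) pre_digraph \<Rightarrow> ('v, 'e) leavitt_gen set" where
  "leavitt_gens G = Vert ` verts G \<union> Edge ` arcs G \<union> Ghost ` arcs G"

text \<open>
  In \<open>CK2\<close> the list \<open>es\<close> enumerates the edges emitted by the regular vertex \<open>v\<close>. The relation is
  imposed for every enumeration.
\<close>

inductive_set leavitt_rels ::
    "('v, 'e) pre_digraph \<Rightarrow>
      (('r, ('v, 'e) leavitt_gen) alg_term \<times> ('r, ('v, 'e) leavitt_gen) alg_term) set"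
  for G :: "('v, 'e) pre_digraph" where
  idem: "v \<in> verts G \<Longrightarrow> (Mul (Gen (Vert v)) (Gen (Vert v)), Gen (Vert v)) \<in> leavitt_rels G"
| orth: "\<lbrakk>v \<in> verts G; w \<in> verts G; v \<noteq> w\<rbrakk> \<Longrightarrow> (Mul (Gen (Vert v)) (Gen (Vert w)), Zero) \<in> leavitt_rels G"
| source_edge: "e \<in> arcs G \<Longrightarrow> (Mul (Gen (Vert (tail G e))) (Gen (Edge e)), Gen (Edge e)) \<in> leavitt_rels G"
| edge_range: "e \<in> arcs G \<Longrightarrow> (Mul (Gen (Edge e)) (Gen (Vert (head G e))), Gen (Edge e)) \<in> leavitt_rels G"
| range_ghost: "e \<in> arcs G \<Longrightarrow> (Mul (Gen (Vert (head G e))) (Gen (Ghost e)), Gen (Ghost e)) \<in> leavitt_rels G"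
| ghost_source: "e \<in> arcs G \<Longrightarrow> (Mul (Gen (Ghost e)) (Gen (Vert (tail G e))), Gen (Ghost e)) \<in> leavitt_rels G"
| CK1_same: "e \<in> arcs G \<Longrightarrow> (Mul (Gen (Ghost e)) (Gen (Edge e)), Gen (Vert (head G e))) \<in> leavitt_rels G"
| CK1_diff: "\<lbrakk>e \<in> arcs G; f \<in> arcs G; e \<noteq> f\<rbrakk> \<Longrightarrow> (Mul (Gen (Ghost e)) (Gen (Edge f)), Zero) \<in> leavitt_rels G"
| CK2: "\<lbrakk>regular_vertex G v; distinct es; set es = out_arcs G v\<rbrakk>
    \<Longrightarrow> (Gen (Vert v), foldr (\<lambda>e t. Add (Mul (Gen (Edge e)) (Gen (Ghost e))) t) es Zero) \<in> leavitt_rels G"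

definition leavitt_algebra ::
    "('r, 'm) ring_scheme \<Rightarrow> ('v, 'e) pre_digraph
      \<Rightarrow> ('r, ('r, ('v, 'e) leavitt_gen) alg_term set) module" where
  "leavitt_algebra R G = presented_algebra R (leavitt_gens G) (leavitt_rels G)"

fun path_term :: "('v, 'e) gpath \<Rightarrow> ('r, ('v, 'e) leavitt_gen) alg_term" where
  "path_term (u, []) = Gen (Vert u)"
| "path_term (u, [e]) = Gen (Edge e)"
| "path_term (u, e # f # p) = Mul (Gen (Edge e)) (path_term (u, f # p))"

fun path_star_term :: "('v, 'e) gpath \<Rightarrow> ('r, ('v, 'e) leavitt_gen) alg_term" where
  "path_star_term (u, []) = Gen (Vert u)"
| "path_star_term (u, [e]) = Gen (Ghost e)"
| "path_star_term (u, e # f # p) = Mul (path_star_term (u, f # p)) (Gen (Ghost e))"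

definition leavitt_monomial ::
    "('r, 'm) ring_scheme \<Rightarrow> ('v, 'e) pre_digraph \<Rightarrow> ('v, 'e) gpath \<Rightarrow> ('v, 'e) gpath
      \<Rightarrow> ('r, ('v, 'e) leavitt_gen) alg_term set" where
  "leavitt_monomial R G \<alpha> \<beta> =
     alg_cong R (leavitt_gens G) (leavitt_rels G) `` {Mul (path_term \<alpha>) (path_star_term \<beta>)}"

text \<open>
  A Cuntz-Krieger system is taken together with its extension to all paths. The vertices and the
  edges are the paths of length zero and one.
\<close>

definition cuntz_krieger_system ::
    "('v, 'e) pre_digraph \<Rightarrow> ('r, 'a) module \<Rightarrow> ('a \<Rightarrow> 'a) \<Rightarrow> (('v, 'e) gpath \<Rightarrow> 'a) \<Rightarrow> bool" where
  "cuntz_krieger_system G A star S \<longleftrightarrow>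
     (\<forall>\<alpha>\<in>gpaths G. S \<alpha> \<in> carrier A) \<and>
     (\<forall>v\<in>verts G. S (vertex_path v) \<otimes>\<^bsub>A\<^esub> S (vertex_path v) = S (vertex_path v)) \<and>
     (\<forall>v\<in>verts G. \<forall>w\<in>verts G. v \<noteq> w \<longrightarrow> S (vertex_path v) \<otimes>\<^bsub>A\<^esub> S (vertex_path w) = \<zero>\<^bsub>A\<^esub>) \<and>
     (\<forall>v\<in>verts G. star (S (vertex_path v)) = S (vertex_path v)) \<and>
     (\<forall>e\<in>arcs G. S (vertex_path (tail G e)) \<otimes>\<^bsub>A\<^esub> S (edge_path G e) = S (edge_path G e)) \<and>
     (\<forall>e\<in>arcs G. S (edge_path G e) \<otimes>\<^bsub>A\<^esub> S (vertex_path (head G e)) = S (edge_path G e)) \<and>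
     (\<forall>e\<in>arcs G. star (S (edge_path G e)) \<otimes>\<^bsub>A\<^esub> S (edge_path G e) = S (vertex_path (head G e))) \<and>
     (\<forall>e\<in>arcs G. \<forall>f\<in>arcs G. e \<noteq> f \<longrightarrow>
        star (S (edge_path G e)) \<otimes>\<^bsub>A\<^esub> S (edge_path G f) = \<zero>\<^bsub>A\<^esub>) \<and>
     (\<forall>v. regular_vertex G v \<longrightarrow>
        S (vertex_path v) =
          (\<Oplus>\<^bsub>A\<^esub>e\<in>out_arcs G v. S (edge_path G e) \<otimes>\<^bsub>A\<^esub> star (S (edge_path G e)))) \<and>
     (\<forall>\<alpha>\<in>gpaths G. \<forall>\<beta>\<in>gpaths G. path_range G \<alpha> = path_source \<beta> \<longrightarrow>
        S (path_append \<alpha> \<beta>) = S \<alpha> \<otimes>\<^bsub>A\<^esub> S \<beta>)"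


section \<open>The aperiodic representation\<close>

text \<open>
  The basis element written with subscript \<open>\<tau>\<close> and superscript \<open>n\<close> is \<open>trail_basis R \<tau> n\<close>. The
  superscript grades the free module, with \<open>trail_module_part R G n\<close> in degree \<open>n\<close>, and
  \<open>degree_part R G k\<close> consists of the endomorphisms that raise this degree by \<open>k\<close>.
\<close>

definition trail_module ::
    "('r, 'm) ring_scheme \<Rightarrow> ('v, 'e) pre_digraph
      \<Rightarrow> ('r, ('v, 'e) gtrail \<times> int \<Rightarrow> 'r) module" where
  "trail_module R G = free_module R (ap_trails G \<times> UNIV)"

definition trail_basis ::
    "('r, 'm) ring_scheme \<Rightarrow> ('v, 'e) gtrail \<Rightarrow> int \<Rightarrow> ('v, 'e) gtrail \<times> int \<Rightarrow> 'r" where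
  "trail_basis R \<tau> n = free_basis R (\<tau>, n)"

definition trail_module_part ::
    "('r, 'm) ring_scheme \<Rightarrow> ('v, 'e) pre_digraph \<Rightarrow> int \<Rightarrow> (('v, 'e) gtrail \<times> int \<Rightarrow> 'r) set" where
  "trail_module_part R G n =
     {x \<in> carrier (trail_module R G). \<forall>\<tau> m. x (\<tau>, m) \<noteq> \<zero>\<^bsub>R\<^esub> \<longrightarrow> m = n}"

definition degree_part ::
    "('r, 'm) ring_scheme \<Rightarrow> ('v, 'e) pre_digraph \<Rightarrow> int
      \<Rightarrow> ((('v, 'e) gtrail \<times> int \<Rightarrow> 'r) \<Rightarrow> ('v, 'e) gtrail \<times> int \<Rightarrow> 'r) set" where
  "degree_part R G k = {T \<in> carrier (End_alg R (trail_module R G)).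
     \<forall>n. T ` trail_module_part R G n \<subseteq> trail_module_part R G (n + k)}"

definition trail_system ::
    "('r, 'm) ring_scheme \<Rightarrow> ('v, 'e) pre_digraph
      \<Rightarrow> (('v, 'e) gpath \<Rightarrow> (('v, 'e) gtrail \<times> int \<Rightarrow> 'r) \<Rightarrow> ('v, 'e) gtrail \<times> int \<Rightarrow> 'r) \<Rightarrow> bool" where
  "trail_system R G S \<longleftrightarrow>
     (\<forall>\<alpha>\<in>gpaths G. \<forall>\<tau>\<in>ap_trails G. \<forall>n.
        S \<alpha> (trail_basis R \<tau> n) =
          (if path_range G \<alpha> = trail_source G \<tau>
           then trail_basis R (trail_append \<alpha> \<tau>) (int (path_length \<alpha>) + n)
           else \<zero>\<^bsub>trail_module R G\<^esub>))"

definition associated_rep ::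
    "('r, 'm) ring_scheme \<Rightarrow> ('v, 'e) pre_digraph \<Rightarrow> ('r, 'a) module \<Rightarrow> ('a \<Rightarrow> 'a)
      \<Rightarrow> (('v, 'e) gpath \<Rightarrow> 'a) \<Rightarrow> (('r, ('v, 'e) leavitt_gen) alg_term set \<Rightarrow> 'a) \<Rightarrow> bool" where
  "associated_rep R G A star S \<Phi> \<longleftrightarrow>
     \<Phi> \<in> alg_hom R (leavitt_algebra R G) A \<and>
     (\<forall>\<alpha>\<in>gpaths G. \<forall>\<beta>\<in>gpaths G. path_range G \<alpha> = path_range G \<beta> \<longrightarrow>
        \<Phi> (leavitt_monomial R G \<alpha> \<beta>) = S \<alpha> \<otimes>\<^bsub>A\<^esub> star (S \<beta>))"

end

theory Submission
  imports Defs "HOL-Library.Discrete_Functions"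
begin


text \<open>
  The algebra \<open>\<E>\<close> consists of the finite sums of homogeneous endomorphisms of the free module that
  have an adjoint for the pairing making the basis orthonormal, with the adjoint as involution. The
  operator \<open>S\<^sub>\<alpha>\<close> permutes part of the basis injectively, so its adjoint is the partial inverse, and the
  Cuntz-Krieger relations are checked on basis elements.

  Injectivity is an induction on the least \<open>n\<close> such that \<open>x\<close> is a combination of monomials \<open>\<alpha>\<beta>\<^sup>*\<close> with
  \<open>l(\<beta>) \<le> n\<close>. If \<open>x\<close> is in the kernel then \<open>xe = 0\<close> for every edge \<open>e\<close> by induction, since \<open>xe\<close> has a
  smaller \<open>n\<close>. Hence \<open>xv = \<Sum>xee\<^sup>* = 0\<close> at a regular vertex \<open>v\<close>. At any other vertex write \<open>x = p + z\<close>, where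
  \<open>p\<close> is a combination of paths and \<open>z\<close> ends in ghosts of finitely many edges. Some essentially aperiodic
  trail from \<open>v\<close> begins with none of these edges, so \<open>p\<close> kills its basis element; as distinct paths send
  it to distinct basis elements, \<open>pv = 0\<close>, and then \<open>zv = 0\<close> follows from \<open>xe = 0\<close>. Because the integer
  index of the basis records lengths, no homogeneity of \<open>x\<close> is needed.
\<close>

section \<open>Algebras of endomorphisms\<close>

text \<open>The full endomorphism ring cannot serve as \<open>\<E>\<close>: in infinite rank the
  transpose of a column-finite matrix need not be column-finite, so adjoints may fail to exist, and
  an endomorphism may have nonzero components in infinitely many degrees, so it need not be a finite
  sum of homogeneous ones. Both defects are removed at once by generating from homogeneous maps that
  have an adjoint. Restricting the basis to essentially aperiodic trails makes the supply of test
  vectors the combinatorial obstacle: every vertex must be the source of such a trail. If no sink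
  can be reached, an infinite walk has to be steered so that it never settles into a cycle with an
  exit. Over an arbitrary commutative ring scalars cannot be divided out, and independence of the
  paths in \<open>L\<close> is not known beforehand. Both difficulties are met by expanding
  \<open>p\<close> times a vertex with coefficients that are entries of the image of a single basis
  element, so that a vanishing image annihilates the expansion inside \<open>L\<close> itself. As
  \<open>L\<close> may lack a unit, finite sums of vertices take its place.\<close>

lemma additive_finsum:
  assumes A: "abelian_group A" and B: "abelian_group B"
    and h: "h \<in> carrier A \<rightarrow> carrier B"
    and add: "\<And>x y. x \<in> carrier A \<Longrightarrow> y \<in> carrier A \<Longrightarrow> h (x \<oplus>\<^bsub>A\<^esub> y) = h x \<oplus>\<^bsub>B\<^esub> h y"
    and f: "f \<in> F \<rightarrow> carrier A"
  shows "h (finsum A f F) = finsum B (\<lambda>i. h (f i)) F"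
proof -
  interpret A: abelian_group A by fact
  interpret B: abelian_group B by fact
  have "h \<zero>\<^bsub>A\<^esub> \<oplus>\<^bsub>B\<^esub> h \<zero>\<^bsub>A\<^esub> = h \<zero>\<^bsub>A\<^esub>" using add[of "\<zero>\<^bsub>A\<^esub>" "\<zero>\<^bsub>A\<^esub>"] by simp
  hence h0: "h \<zero>\<^bsub>A\<^esub> = \<zero>\<^bsub>B\<^esub>" using h by (simp add: Pi_iff)
  show ?thesis using f
  \<comment> \<open>The rule includes infinite \<open>F\<close>, where both sums take the default
    value zero and \<open>h0\<close> matches them.\<close>
  proof (induction F rule: infinite_finite_induct)
    case (insert i F)
    have "h (finsum A f (insert i F)) = h (f i \<oplus>\<^bsub>A\<^esub> finsum A f F)" using insert by (simp add: Pi_iff)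
    also have "\<dots> = h (f i) \<oplus>\<^bsub>B\<^esub> h (finsum A f F)" using insert by (intro add) (auto simp: Pi_iff)
    also have "\<dots> = finsum B (\<lambda>i. h (f i)) (insert i F)" using insert h
      by (subst B.finsum_insert) (auto simp: Pi_iff)
    finally show ?case .
  qed (simp_all add: h0)
qed

context assoc_algebra
begin

text \<open>The zero of \<open>A\<close> is itself multiplied by the zero of \<open>R\<close>, and
  this scalar can be pulled out of the product.\<close>

lemma mult_zero_left [simp]: "x \<in> carrier A \<Longrightarrow> \<zero>\<^bsub>A\<^esub> \<otimes>\<^bsub>A\<^esub> x = \<zero>\<^bsub>A\<^esub>"
  by (metis M.zero_closed R.zero_closed mult_closed smult_l_null smult_mult_left)

lemma mult_zero_right [simp]: "x \<in> carrier A \<Longrightarrow> x \<otimes>\<^bsub>A\<^esub> \<zero>\<^bsub>A\<^esub> = \<zero>\<^bsub>A\<^esub>"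
  by (metis M.zero_closed R.zero_closed mult_closed smult_l_null smult_mult_right)

lemma finsum_mult_left:
  assumes "f \<in> F \<rightarrow> carrier A" "a \<in> carrier A"
  shows "finsum A f F \<otimes>\<^bsub>A\<^esub> a = (\<Oplus>\<^bsub>A\<^esub>i\<in>F. f i \<otimes>\<^bsub>A\<^esub> a)"
  by (rule additive_finsum[OF M.abelian_group_axioms M.abelian_group_axioms])
     (use assms in \<open>auto simp: distrib_right\<close>)

lemma finsum_mult_right:
  assumes "f \<in> F \<rightarrow> carrier A" "a \<in> carrier A"
  shows "a \<otimes>\<^bsub>A\<^esub> finsum A f F = (\<Oplus>\<^bsub>A\<^esub>i\<in>F. a \<otimes>\<^bsub>A\<^esub> f i)"
  by (rule additive_finsum[OF M.abelian_group_axioms M.abelian_group_axioms])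
     (use assms in \<open>auto simp: distrib_left\<close>)

lemma smult_minus_one:
  assumes "x \<in> carrier A"
  shows "(\<ominus>\<^bsub>R\<^esub> \<one>\<^bsub>R\<^esub>) \<odot>\<^bsub>A\<^esub> x = \<ominus>\<^bsub>A\<^esub> x"
  using assms by (simp add: smult_l_minus)

text \<open>Closure under negatives is closure under multiplication by the scalar \<open>-1\<close>.\<close>

lemma restrict_carrier_assoc_algebra:
  assumes B: "B \<subseteq> carrier A" "\<zero>\<^bsub>A\<^esub> \<in> B"
    and add: "\<And>x y. x \<in> B \<Longrightarrow> y \<in> B \<Longrightarrow> x \<oplus>\<^bsub>A\<^esub> y \<in> B"
    and mult: "\<And>x y. x \<in> B \<Longrightarrow> y \<in> B \<Longrightarrow> x \<otimes>\<^bsub>A\<^esub> y \<in> B"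
    and smult: "\<And>a x. a \<in> carrier R \<Longrightarrow> x \<in> B \<Longrightarrow> a \<odot>\<^bsub>A\<^esub> x \<in> B"
  shows "assoc_algebra R (A\<lparr>carrier := B\<rparr>)"
proof -
  have c: "x \<in> B \<Longrightarrow> x \<in> carrier A" for x using B by auto
  have neg: "\<ominus>\<^bsub>A\<^esub> x \<in> B" if "x \<in> B" for x
    using smult[of "\<ominus>\<^bsub>R\<^esub> \<one>\<^bsub>R\<^esub>" x] that c by (simp add: smult_minus_one)
  have grp: "abelian_group (A\<lparr>carrier := B\<rparr>)"
  proof (rule abelian_groupI)
    fix x assume x: "x \<in> carrier (A\<lparr>carrier := B\<rparr>)"
    show "\<exists>y\<in>carrier (A\<lparr>carrier := B\<rparr>). y \<oplus>\<^bsub>A\<lparr>carrier := B\<rparr>\<^esub> x = \<zero>\<^bsub>A\<lparr>carrier := B\<rparr>\<^esub>"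
      by (rule bexI[of _ "\<ominus>\<^bsub>A\<^esub> x"]) (use x neg c in \<open>auto simp: M.l_neg\<close>)
  qed (use B add c in \<open>auto simp: M.a_assoc intro: M.a_comm\<close>)
  have mod: "module R (A\<lparr>carrier := B\<rparr>)"
    by (rule moduleI[OF is_cring grp])
       (use smult c in \<open>auto simp: smult_l_distr smult_r_distr smult_assoc1\<close>)
  show ?thesis
    by (intro assoc_algebra.intro mod assoc_algebra_axioms.intro)
       (use mult c in \<open>auto simp: mult_assoc distrib_left distrib_right smult_mult_left smult_mult_right\<close>)
qed

end

section \<open>The endomorphism algebra of a module\<close>

locale endo_module = module R M for R :: "('r, 'm) ring_scheme" and M :: "('r, 'a) module" (structure)
begin

lemma End_algE:
  assumes "T \<in> carrier (End_alg R M)"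
  shows "x \<in> carrier M \<Longrightarrow> T x \<in> carrier M"
    and "x \<in> carrier M \<Longrightarrow> y \<in> carrier M \<Longrightarrow> T (x \<oplus>\<^bsub>M\<^esub> y) = T x \<oplus>\<^bsub>M\<^esub> T y"
    and "a \<in> carrier R \<Longrightarrow> x \<in> carrier M \<Longrightarrow> T (a \<odot>\<^bsub>M\<^esub> x) = a \<odot>\<^bsub>M\<^esub> T x"
    and "T \<zero>\<^bsub>M\<^esub> = \<zero>\<^bsub>M\<^esub>"
    and "T \<in> extensional (carrier M)"
proof -
  show *: "x \<in> carrier M \<Longrightarrow> T x \<in> carrier M"
    "a \<in> carrier R \<Longrightarrow> x \<in> carrier M \<Longrightarrow> T (a \<odot>\<^bsub>M\<^esub> x) = a \<odot>\<^bsub>M\<^esub> T x" for x a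
    using assms by (auto simp: End_alg_def)
  show "x \<in> carrier M \<Longrightarrow> y \<in> carrier M \<Longrightarrow> T (x \<oplus>\<^bsub>M\<^esub> y) = T x \<oplus>\<^bsub>M\<^esub> T y"
    "T \<in> extensional (carrier M)"
    using assms by (auto simp: End_alg_def PiE_iff)
  show "T \<zero>\<^bsub>M\<^esub> = \<zero>\<^bsub>M\<^esub>"
    by (metis "*" M.zero_closed R.zero_closed smult_l_null)
qed

lemma End_algI:
  assumes "T \<in> extensional (carrier M)" "\<And>x. x \<in> carrier M \<Longrightarrow> T x \<in> carrier M"
    and "\<And>x y. x \<in> carrier M \<Longrightarrow> y \<in> carrier M \<Longrightarrow> T (x \<oplus>\<^bsub>M\<^esub> y) = T x \<oplus>\<^bsub>M\<^esub> T y"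
    and "\<And>a x. a \<in> carrier R \<Longrightarrow> x \<in> carrier M \<Longrightarrow> T (a \<odot>\<^bsub>M\<^esub> x) = a \<odot>\<^bsub>M\<^esub> T x"
  shows "T \<in> carrier (End_alg R M)"
  using assms by (auto simp: End_alg_def PiE_iff)

lemma End_alg_simps:
  "\<zero>\<^bsub>End_alg R M\<^esub> = (\<lambda>x\<in>carrier M. \<zero>\<^bsub>M\<^esub>)"
  "T \<oplus>\<^bsub>End_alg R M\<^esub> U = (\<lambda>x\<in>carrier M. T x \<oplus>\<^bsub>M\<^esub> U x)"
  "T \<otimes>\<^bsub>End_alg R M\<^esub> U = (\<lambda>x\<in>carrier M. T (U x))"
  "a \<odot>\<^bsub>End_alg R M\<^esub> T = (\<lambda>x\<in>carrier M. a \<odot>\<^bsub>M\<^esub> T x)"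
  by (simp_all add: End_alg_def compose_def)

lemma End_assoc_algebra: "assoc_algebra R (End_alg R M)"
proof -
  note [simp] = End_algE End_alg_simps
  have ext: "T = U" if "T \<in> carrier (End_alg R M)" "U \<in> carrier (End_alg R M)"
    "\<And>x. x \<in> carrier M \<Longrightarrow> T x = U x" for T U
    using that by (intro extensionalityI[of _ "carrier M"]) auto
  have add: "T \<oplus>\<^bsub>End_alg R M\<^esub> U \<in> carrier (End_alg R M)"
    if "T \<in> carrier (End_alg R M)" "U \<in> carrier (End_alg R M)" for T U
    by (rule End_algI) (use that in \<open>auto simp: smult_r_distr M.a_ac\<close>)
  have mult: "T \<otimes>\<^bsub>End_alg R M\<^esub> U \<in> carrier (End_alg R M)"
    if "T \<in> carrier (End_alg R M)" "U \<in> carrier (End_alg R M)" for T U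
    by (rule End_algI) (use that in auto)
  have smult: "a \<odot>\<^bsub>End_alg R M\<^esub> U \<in> carrier (End_alg R M)"
    if "a \<in> carrier R" "U \<in> carrier (End_alg R M)" for a U
    by (rule End_algI) (use that in \<open>auto simp: smult_r_distr smult_assoc1[symmetric] R.m_comm\<close>)
  have zero: "\<zero>\<^bsub>End_alg R M\<^esub> \<in> carrier (End_alg R M)"
    by (rule End_algI) auto
  have grp: "abelian_group (End_alg R M)"
  proof (rule abelian_groupI)
    fix T assume T: "T \<in> carrier (End_alg R M)"
    show "\<exists>U\<in>carrier (End_alg R M). U \<oplus>\<^bsub>End_alg R M\<^esub> T = \<zero>\<^bsub>End_alg R M\<^esub>"
      by (rule bexI[of _ "(\<ominus>\<^bsub>R\<^esub> \<one>\<^bsub>R\<^esub>) \<odot>\<^bsub>End_alg R M\<^esub> T"])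
         (use T smult in \<open>auto simp: smult_l_minus M.l_neg intro!: restrict_ext\<close>)
  qed (auto intro!: add zero ext simp del: End_alg_simps,
       (auto simp: M.a_ac)) 
  have mod: "module R (End_alg R M)"
    by (rule moduleI[OF is_cring grp])
       (auto intro!: smult ext add simp del: End_alg_simps,
        (auto simp: smult_l_distr smult_r_distr smult_assoc1))
  show ?thesis
    by (intro assoc_algebra.intro mod assoc_algebra_axioms.intro)
       (auto intro!: smult ext add mult simp del: End_alg_simps, auto)
qed

end

section \<open>Adjoints and gradings on a free module\<close>

locale free_endos = cring R for R :: "('r, 'm) ring_scheme" (structure) +
  fixes I :: "'i set"
begin

abbreviation "M \<equiv> free_module R I"
abbreviation "b \<equiv> free_basis R"

lemma free_simps:
  "x \<in> carrier M \<longleftrightarrow> (\<forall>i\<in>I. x i \<in> carrier R) \<and> (\<forall>i. i \<notin> I \<longrightarrow> x i = \<zero>) \<and> finite {i. x i \<noteq> \<zero>}"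
  "\<zero>\<^bsub>M\<^esub> = (\<lambda>i. \<zero>)" "x \<oplus>\<^bsub>M\<^esub> y = (\<lambda>i. x i \<oplus> y i)" "a \<odot>\<^bsub>M\<^esub> x = (\<lambda>i. a \<otimes> x i)"
  by (simp_all add: free_module_def)

lemma coeff_closed [simp]: "x \<in> carrier M \<Longrightarrow> x i \<in> carrier R"
  by (cases "i \<in> I") (auto simp: free_simps)

lemma finite_support: "x \<in> carrier M \<Longrightarrow> finite {i. x i \<noteq> \<zero>}"
  by (simp add: free_simps)

lemma free_module: "module R M"
proof -
  have add: "x \<oplus>\<^bsub>M\<^esub> y \<in> carrier M" if "x \<in> carrier M" "y \<in> carrier M" for x y
  proof -
    have "{i. x i \<oplus> y i \<noteq> \<zero>} \<subseteq> {i. x i \<noteq> \<zero>} \<union> {i. y i \<noteq> \<zero>}" by auto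
    hence "finite {i. x i \<oplus> y i \<noteq> \<zero>}" by (rule finite_subset) (use that in \<open>simp add: free_simps\<close>)
    thus ?thesis using that by (simp add: free_simps)
  qed
  have smult: "a \<odot>\<^bsub>M\<^esub> x \<in> carrier M" if "a \<in> carrier R" "x \<in> carrier M" for a x
  proof -
    have "{i. a \<otimes> x i \<noteq> \<zero>} \<subseteq> {i. x i \<noteq> \<zero>}" using that by auto
    hence "finite {i. a \<otimes> x i \<noteq> \<zero>}" by (rule finite_subset) (use that in \<open>simp add: free_simps\<close>)
    thus ?thesis using that by (simp add: free_simps)
  qed
  have grp: "abelian_group M"
  proof (rule abelian_groupI)
    fix x assume x: "x \<in> carrier M"
    show "\<exists>y\<in>carrier M. y \<oplus>\<^bsub>M\<^esub> x = \<zero>\<^bsub>M\<^esub>"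
    proof (rule bexI[of _ "(\<ominus> \<one>) \<odot>\<^bsub>M\<^esub> x"])
      show "(\<ominus> \<one>) \<odot>\<^bsub>M\<^esub> x \<oplus>\<^bsub>M\<^esub> x = \<zero>\<^bsub>M\<^esub>" using x by (simp add: free_simps(2-4) l_minus l_neg)
    qed (use x smult in simp)
  next
    fix x y z assume "x \<in> carrier M" "y \<in> carrier M" "z \<in> carrier M"
    thus "x \<oplus>\<^bsub>M\<^esub> y \<oplus>\<^bsub>M\<^esub> z = x \<oplus>\<^bsub>M\<^esub> (y \<oplus>\<^bsub>M\<^esub> z)" by (simp add: free_simps(2-4) a_assoc)
  next
    fix x y assume "x \<in> carrier M" "y \<in> carrier M"
    thus "x \<oplus>\<^bsub>M\<^esub> y = y \<oplus>\<^bsub>M\<^esub> x" by (simp add: free_simps(2-4) a_comm)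
  next
    fix x assume "x \<in> carrier M"
    thus "\<zero>\<^bsub>M\<^esub> \<oplus>\<^bsub>M\<^esub> x = x" by (simp add: free_simps(2-4))
  qed (use add in \<open>auto simp: free_simps(1,2)\<close>)
  show ?thesis
  proof (rule moduleI[OF is_cring grp smult])
    fix a c x assume "a \<in> carrier R" "c \<in> carrier R" "x \<in> carrier M"
    thus "(a \<oplus> c) \<odot>\<^bsub>M\<^esub> x = a \<odot>\<^bsub>M\<^esub> x \<oplus>\<^bsub>M\<^esub> c \<odot>\<^bsub>M\<^esub> x" "a \<otimes> c \<odot>\<^bsub>M\<^esub> x = a \<odot>\<^bsub>M\<^esub> (c \<odot>\<^bsub>M\<^esub> x)"
      by (simp_all add: free_simps(2-4) l_distr m_assoc)
  next
    fix a x y assume "a \<in> carrier R" "x \<in> carrier M" "y \<in> carrier M"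
    thus "a \<odot>\<^bsub>M\<^esub> (x \<oplus>\<^bsub>M\<^esub> y) = a \<odot>\<^bsub>M\<^esub> x \<oplus>\<^bsub>M\<^esub> a \<odot>\<^bsub>M\<^esub> y" by (simp add: free_simps(2-4) r_distr)
  next
    fix x assume "x \<in> carrier M"
    thus "\<one> \<odot>\<^bsub>M\<^esub> x = x" by (simp add: free_simps(2-4))
  qed
qed

sublocale F: endo_module R M
  by (intro endo_module.intro free_module)

abbreviation "End \<equiv> End_alg R M"

sublocale E: assoc_algebra R End
  by (rule F.End_assoc_algebra)

lemma basis_closed [simp]: "i \<in> I \<Longrightarrow> b i \<in> carrier M"
  by (auto simp: free_simps free_basis_def)

text \<open>Induction on the finite support: resetting the coefficient at \<open>j\<close> to
  \<open>\<zero>\<close> shrinks the support, and the part removed is a multiple of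
  \<open>b j\<close>.\<close>

lemma free_induct [consumes 1, case_names zero add basis]:
  assumes x: "x \<in> carrier M" and zero: "P \<zero>\<^bsub>M\<^esub>"
    and add: "\<And>x y. x \<in> carrier M \<Longrightarrow> y \<in> carrier M \<Longrightarrow> P x \<Longrightarrow> P y \<Longrightarrow> P (x \<oplus>\<^bsub>M\<^esub> y)"
    and basis: "\<And>a i. a \<in> carrier R \<Longrightarrow> i \<in> I \<Longrightarrow> P (a \<odot>\<^bsub>M\<^esub> b i)"
  shows "P x"
proof -
  have "\<forall>x\<in>carrier M. {i. x i \<noteq> \<zero>} = A \<longrightarrow> P x" if "finite A" for A
    using that
  proof (induction A)
    case empty
    show ?case using zero by (auto simp: free_simps(2))
  next
    case (insert j A)
    show ?case
    proof (intro ballI impI)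
      fix x assume x: "x \<in> carrier M" and s: "{i. x i \<noteq> \<zero>} = insert j A"
      have j: "j \<in> I" using x s by (auto simp: free_simps)
      let ?y = "x(j := \<zero>)"
      have sy: "{i. ?y i \<noteq> \<zero>} = A" using s insert by auto
      hence y: "?y \<in> carrier M" using x insert by (auto simp: free_simps(1))
      have "x = ?y \<oplus>\<^bsub>M\<^esub> (x j \<odot>\<^bsub>M\<^esub> b j)" using x y
        by (auto simp: free_simps(2-4) free_basis_def fun_eq_iff)
      moreover have "P \<dots>" by (rule add) (use y sy x j insert in \<open>auto intro: basis\<close>)
      ultimately show "P x" by simp
    qed
  qed
  thus ?thesis using x by (auto simp: free_simps(1))
qed

text \<open>The tool for the operator identities below: the Cuntz-Krieger relations and the
  uniqueness of the grading and of the system are all compared on basis elements through it.\<close>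

lemma linear_ext:
  assumes T: "T \<in> carrier End" and U: "U \<in> carrier End" and eq: "\<And>i. i \<in> I \<Longrightarrow> T (b i) = U (b i)"
  shows "T = U"
proof (rule extensionalityI[OF F.End_algE(5)[OF T] F.End_algE(5)[OF U]])
  fix x assume "x \<in> carrier M"
  thus "T x = U x"
    by (induction rule: free_induct)
       (simp_all add: F.End_algE[OF T] F.End_algE[OF U] eq)
qed

text \<open>Summing over the support of the first argument keeps the sum finite. The asymmetry is
  only apparent, by \<open>pairing_sym\<close>.\<close>

definition pairing :: "('i \<Rightarrow> 'r) \<Rightarrow> ('i \<Rightarrow> 'r) \<Rightarrow> 'r" where
  "pairing x y = (\<Oplus>i\<in>{i. x i \<noteq> \<zero>}. x i \<otimes> y i)"

text \<open>Any finite set that contains the common support may index the sum. This gives arguments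
  with different supports a shared index set, and disjoint supports the empty one.\<close>

lemma pairing_eq:
  assumes x: "x \<in> carrier M" and y: "y \<in> carrier M" and A: "finite A"
    and sub: "\<And>i. x i \<noteq> \<zero> \<Longrightarrow> y i \<noteq> \<zero> \<Longrightarrow> i \<in> A"
  shows "pairing x y = (\<Oplus>i\<in>A. x i \<otimes> y i)"
  unfolding pairing_def
proof (rule add.finprod_mono_neutral_cong)
  fix i assume "i \<in> {i. x i \<noteq> \<zero>} - A"
  hence "y i = \<zero>" using sub[of i] by blast
  thus "x i \<otimes> y i = \<zero>" using x by simp
next
  fix i assume "i \<in> A - {i. x i \<noteq> \<zero>}"
  thus "x i \<otimes> y i = \<zero>" using y by simp
next
  show "finite {i. x i \<noteq> \<zero>}" by (rule finite_support[OF x])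
qed (use x y A in \<open>simp_all add: Pi_iff\<close>)

lemma pairing_closed [simp]: "x \<in> carrier M \<Longrightarrow> y \<in> carrier M \<Longrightarrow> pairing x y \<in> carrier R"
  unfolding pairing_def by (rule finsum_closed) auto

lemma pairing_sym:
  assumes "x \<in> carrier M" "y \<in> carrier M" shows "pairing x y = pairing y x"
proof -
  have "pairing x y = (\<Oplus>i\<in>{i. y i \<noteq> \<zero>}. x i \<otimes> y i)"
    by (rule pairing_eq) (use assms finite_support in auto)
  also have "\<dots> = pairing y x" unfolding pairing_def
    by (rule finsum_cong') (use assms in \<open>auto simp: m_comm\<close>)
  finally show ?thesis .
qed

lemma pairing_add_left:
  assumes "x \<in> carrier M" "y \<in> carrier M" "z \<in> carrier M"
  shows "pairing (x \<oplus>\<^bsub>M\<^esub> y) z = pairing x z \<oplus> pairing y z"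
proof -
  \<comment> \<open>The support of the common second argument indexes all three pairings, whereas
    the supports of \<open>x\<close>, \<open>y\<close> and their sum differ.\<close>
  let ?A = "{i. z i \<noteq> \<zero>}"
  have A: "finite ?A" using assms finite_support by auto
  have "pairing (x \<oplus>\<^bsub>M\<^esub> y) z = (\<Oplus>i\<in>?A. (x \<oplus>\<^bsub>M\<^esub> y) i \<otimes> z i)"
    by (rule pairing_eq) (use assms A in auto)
  also have "\<dots> = (\<Oplus>i\<in>?A. x i \<otimes> z i \<oplus> y i \<otimes> z i)"
    by (rule finsum_cong') (use assms in \<open>auto simp: free_simps(3) l_distr\<close>)
  also have "\<dots> = (\<Oplus>i\<in>?A. x i \<otimes> z i) \<oplus> (\<Oplus>i\<in>?A. y i \<otimes> z i)"
    by (rule finsum_addf) (use assms in auto)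
  also have "\<dots> = pairing x z \<oplus> pairing y z"
    using assms A by (simp add: pairing_eq[of _ z ?A])
  finally show ?thesis .
qed

lemma pairing_smult_left:
  assumes "a \<in> carrier R" "x \<in> carrier M" "z \<in> carrier M"
  shows "pairing (a \<odot>\<^bsub>M\<^esub> x) z = a \<otimes> pairing x z"
proof -
  let ?A = "{i. z i \<noteq> \<zero>}"
  have A: "finite ?A" using assms finite_support by auto
  have "pairing (a \<odot>\<^bsub>M\<^esub> x) z = (\<Oplus>i\<in>?A. (a \<odot>\<^bsub>M\<^esub> x) i \<otimes> z i)"
    by (rule pairing_eq) (use assms A in auto)
  also have "\<dots> = (\<Oplus>i\<in>?A. a \<otimes> (x i \<otimes> z i))"
    by (rule finsum_cong') (use assms in \<open>auto simp: free_simps(4) m_assoc\<close>)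
  also have "\<dots> = a \<otimes> (\<Oplus>i\<in>?A. x i \<otimes> z i)"
    by (rule finsum_rdistr[symmetric]) (use assms A in auto)
  also have "\<dots> = a \<otimes> pairing x z"
    using assms A by (simp add: pairing_eq[of _ z ?A])
  finally show ?thesis .
qed

lemma pairing_basis [simp]:
  assumes "x \<in> carrier M" "i \<in> I"
  shows "pairing x (b i) = x i"
proof -
  have "pairing x (b i) = (\<Oplus>j\<in>{i}. x j \<otimes> b i j)"
    by (rule pairing_eq) (simp_all add: assms, simp add: free_basis_def split: if_splits)
  also have "\<dots> = x i" using assms by (simp add: free_basis_def)
  finally show ?thesis .
qed

text \<open>Nondegeneracy: pairing with \<open>b i\<close> reads off the coefficient at
  \<open>i\<close>. Uniqueness of adjoints rests on it.\<close>

lemma pairing_ext: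
  assumes "x \<in> carrier M" "y \<in> carrier M" "\<And>z. z \<in> carrier M \<Longrightarrow> pairing z x = pairing z y"
  shows "x = y"
proof
  fix i show "x i = y i"
  proof (cases "i \<in> I")
    case True
    thus ?thesis using assms(3)[of "b i"] assms(1,2) by (simp add: pairing_sym[of "b i"])
  qed (use assms(1,2) in \<open>simp add: free_simps(1)\<close>)
qed

text \<open>A relation between two endomorphisms rather than an operation, because in infinite rank
  an adjoint need not exist. \<open>adj\<close> is meaningful only where one does.\<close>

definition adjoint :: "(('i \<Rightarrow> 'r) \<Rightarrow> 'i \<Rightarrow> 'r) \<Rightarrow> (('i \<Rightarrow> 'r) \<Rightarrow> 'i \<Rightarrow> 'r) \<Rightarrow> bool" where
  "adjoint T U \<longleftrightarrow> T \<in> carrier End \<and> U \<in> carrier End \<and>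
     (\<forall>x\<in>carrier M. \<forall>y\<in>carrier M. pairing (T x) y = pairing x (U y))"

definition adj :: "(('i \<Rightarrow> 'r) \<Rightarrow> 'i \<Rightarrow> 'r) \<Rightarrow> ('i \<Rightarrow> 'r) \<Rightarrow> 'i \<Rightarrow> 'r" where
  "adj T = (THE U. adjoint T U)"

lemma adjoint_unique:
  assumes "adjoint T U" "adjoint T U'" shows "U = U'"
proof (rule extensionalityI[of _ "carrier M"])
  fix y assume y: "y \<in> carrier M"
  show "U y = U' y"
  proof (rule pairing_ext)
    show "U y \<in> carrier M" "U' y \<in> carrier M" using assms y by (auto simp: adjoint_def F.End_algE(1))
    fix z assume "z \<in> carrier M"
    hence "pairing (T z) y = pairing z (U y)" "pairing (T z) y = pairing z (U' y)"
      using assms y by (auto simp: adjoint_def)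
    thus "pairing z (U y) = pairing z (U' y)" by simp
  qed
qed (use assms in \<open>auto simp: adjoint_def F.End_algE(5)\<close>)

lemma adjE: "adjoint T U \<Longrightarrow> adj T = U"
  unfolding adj_def by (rule the_equality) (auto dest: adjoint_unique)

lemma adjointD:
  assumes "adjoint T U"
  shows "T \<in> carrier End" "U \<in> carrier End"
    and "x \<in> carrier M \<Longrightarrow> y \<in> carrier M \<Longrightarrow> pairing (T x) y = pairing x (U y)"
    and "x \<in> carrier M \<Longrightarrow> T x \<in> carrier M" "x \<in> carrier M \<Longrightarrow> U x \<in> carrier M"
  using assms by (auto simp: adjoint_def F.End_algE(1))

lemma adjointI:
  assumes "T \<in> carrier End" "U \<in> carrier End"
    and "\<And>x y. x \<in> carrier M \<Longrightarrow> y \<in> carrier M \<Longrightarrow> pairing (T x) y = pairing x (U y)"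
  shows "adjoint T U"
  using assms by (simp add: adjoint_def)

lemma adjoint_sym:
  assumes "adjoint T U" shows "adjoint U T"
proof (rule adjointI)
  fix x y assume xy: "x \<in> carrier M" "y \<in> carrier M"
  have "pairing (U x) y = pairing y (U x)" by (rule pairing_sym) (use xy adjointD[OF assms] in auto)
  also have "\<dots> = pairing (T y) x" using xy adjointD[OF assms] by simp
  also have "\<dots> = pairing x (T y)" by (rule pairing_sym) (use xy adjointD[OF assms] in auto)
  finally show "pairing (U x) y = pairing x (T y)" .
qed (rule adjointD[OF assms])+

lemma pairing_zero_left: "x \<in> carrier M \<Longrightarrow> pairing \<zero>\<^bsub>M\<^esub> x = \<zero>"
  by (simp add: pairing_def free_simps(2))

lemma pairing_zero_right: "x \<in> carrier M \<Longrightarrow> pairing x \<zero>\<^bsub>M\<^esub> = \<zero>"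
  by (metis pairing_zero_left pairing_sym F.M.zero_closed)

lemma pairing_add_right:
  assumes "x \<in> carrier M" "y \<in> carrier M" "z \<in> carrier M"
  shows "pairing z (x \<oplus>\<^bsub>M\<^esub> y) = pairing z x \<oplus> pairing z y"
  using pairing_add_left[OF assms] assms by (simp add: pairing_sym[of z])

lemma pairing_smult_right:
  assumes "a \<in> carrier R" "x \<in> carrier M" "z \<in> carrier M"
  shows "pairing z (a \<odot>\<^bsub>M\<^esub> x) = a \<otimes> pairing z x"
  using pairing_smult_left[OF assms] assms by (simp add: pairing_sym[of z])

lemma adjoint_zero: "adjoint \<zero>\<^bsub>End\<^esub> \<zero>\<^bsub>End\<^esub>"
  using E.M.zero_closed by (auto simp: adjoint_def F.End_alg_simps pairing_zero_left pairing_zero_right)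

lemma adjoint_add:
  assumes T: "adjoint T U" and T': "adjoint T' U'"
  shows "adjoint (T \<oplus>\<^bsub>End\<^esub> T') (U \<oplus>\<^bsub>End\<^esub> U')"
  by (rule adjointI)
     (simp_all add: E.M.a_closed adjointD[OF T] adjointD[OF T'],
      simp add: F.End_alg_simps pairing_add_left pairing_add_right adjointD[OF T] adjointD[OF T'])

lemma adjoint_smult:
  assumes a: "a \<in> carrier R" and T: "adjoint T U"
  shows "adjoint (a \<odot>\<^bsub>End\<^esub> T) (a \<odot>\<^bsub>End\<^esub> U)"
  by (rule adjointI)
     (simp_all add: a adjointD[OF T],
      simp add: a F.End_alg_simps pairing_smult_left pairing_smult_right adjointD[OF T])

lemma adjoint_mult:
  assumes T: "adjoint T U" and T': "adjoint T' U'"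
  shows "adjoint (T \<otimes>\<^bsub>End\<^esub> T') (U' \<otimes>\<^bsub>End\<^esub> U)"
  by (rule adjointI)
     (simp_all add: adjointD[OF T] adjointD[OF T'],
      simp add: F.End_alg_simps adjointD[OF T] adjointD[OF T'])

end

section \<open>The graded algebra of endomorphisms with an adjoint\<close>

locale graded_free_endos = free_endos R I for R :: "('r, 'm) ring_scheme" (structure) and I :: "'i set" +
  fixes deg :: "'i \<Rightarrow> int"
begin

definition mpart :: "int \<Rightarrow> ('i \<Rightarrow> 'r) set" where
  "mpart n = {x \<in> carrier M. \<forall>i. x i \<noteq> \<zero> \<longrightarrow> deg i = n}"

definition dpart :: "int \<Rightarrow> (('i \<Rightarrow> 'r) \<Rightarrow> 'i \<Rightarrow> 'r) set" where
  "dpart k = {T \<in> carrier End. \<forall>n. T ` mpart n \<subseteq> mpart (n + k)}"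

definition adj_part :: "int \<Rightarrow> (('i \<Rightarrow> 'r) \<Rightarrow> 'i \<Rightarrow> 'r) set" where
  "adj_part k = {T \<in> dpart k. \<exists>U. adjoint T U}"

text \<open>
  The finite sums of homogeneous endomorphisms with an adjoint, in other words the matrices with
  finite rows and columns and with entries in finitely many degrees.
\<close>

inductive_set graded_adj :: "(('i \<Rightarrow> 'r) \<Rightarrow> 'i \<Rightarrow> 'r) set" where
  hom: "T \<in> adj_part k \<Longrightarrow> T \<in> graded_adj"
| add: "T \<in> graded_adj \<Longrightarrow> U \<in> graded_adj \<Longrightarrow> T \<oplus>\<^bsub>End\<^esub> U \<in> graded_adj"

abbreviation "A \<equiv> End\<lparr>carrier := graded_adj\<rparr>"

lemma mpart_zero: "\<zero>\<^bsub>M\<^esub> \<in> mpart n"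
  by (auto simp: mpart_def) (simp add: free_simps)

lemma mpart_add: "x \<in> mpart n \<Longrightarrow> y \<in> mpart n \<Longrightarrow> x \<oplus>\<^bsub>M\<^esub> y \<in> mpart n"
  by (auto simp: mpart_def) (metis (lifting) coeff_closed free_simps(3) l_zero zero_closed)

lemma mpart_smult: "a \<in> carrier R \<Longrightarrow> x \<in> mpart n \<Longrightarrow> a \<odot>\<^bsub>M\<^esub> x \<in> mpart n"
  by (auto simp: mpart_def) (metis (lifting) free_simps(4) r_null)

lemma basis_mpart: "i \<in> I \<Longrightarrow> b i \<in> mpart (deg i)"
  by (auto simp: mpart_def) (simp add: free_basis_def split: if_splits)

lemma dpart_End: "T \<in> dpart k \<Longrightarrow> T \<in> carrier End"
  by (simp add: dpart_def)

lemma dpartD: "T \<in> dpart k \<Longrightarrow> x \<in> mpart n \<Longrightarrow> T x \<in> mpart (n + k)"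
  by (auto simp: dpart_def)

lemma mpart_carrier: "x \<in> mpart n \<Longrightarrow> x \<in> carrier M"
  by (simp add: mpart_def)

lemma adj_part_dpart: "adj_part k \<subseteq> dpart k"
  by (auto simp: adj_part_def)

lemma adj_part_zero: "\<zero>\<^bsub>End\<^esub> \<in> adj_part k"
  unfolding adj_part_def dpart_def using adjoint_zero E.M.zero_closed
  by (auto simp: mpart_zero mpart_carrier F.End_alg_simps)

lemma adj_part_add:
  assumes "T \<in> adj_part k" "U \<in> adj_part k" shows "T \<oplus>\<^bsub>End\<^esub> U \<in> adj_part k"
proof -
  obtain T' U' where "adjoint T T'" "adjoint U U'" using assms by (auto simp: adj_part_def)
  hence *: "adjoint (T \<oplus>\<^bsub>End\<^esub> U) (T' \<oplus>\<^bsub>End\<^esub> U')" by (rule adjoint_add)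
  moreover have "T \<oplus>\<^bsub>End\<^esub> U \<in> dpart k" using assms adjointD(1)[OF *]
    by (auto simp: adj_part_def dpart_def) (auto simp: F.End_alg_simps mpart_carrier mpart_add image_subset_iff)
  ultimately show ?thesis by (auto simp: adj_part_def)
qed

lemma adj_part_smult:
  assumes "a \<in> carrier R" "T \<in> adj_part k" shows "a \<odot>\<^bsub>End\<^esub> T \<in> adj_part k"
proof -
  obtain T' where "adjoint T T'" using assms by (auto simp: adj_part_def)
  hence *: "adjoint (a \<odot>\<^bsub>End\<^esub> T) (a \<odot>\<^bsub>End\<^esub> T')" by (rule adjoint_smult[OF assms(1)])
  moreover have "a \<odot>\<^bsub>End\<^esub> T \<in> dpart k" using assms adjointD(1)[OF *]
    by (auto simp: adj_part_def dpart_def) (auto simp: F.End_alg_simps mpart_carrier mpart_smult image_subset_iff)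
  ultimately show ?thesis by (auto simp: adj_part_def)
qed

lemma adj_part_mult:
  assumes "T \<in> adj_part j" "U \<in> adj_part k" shows "T \<otimes>\<^bsub>End\<^esub> U \<in> adj_part (j + k)"
proof -
  have "T (U x) \<in> mpart (n + (j + k))" if "x \<in> mpart n" for x n
    using dpartD[of U k x n] dpartD[of T j "U x" "n + k"] assms that adj_part_dpart
    by (auto simp: ac_simps)
  hence "T \<otimes>\<^bsub>End\<^esub> U \<in> dpart (j + k)" using assms
    by (auto simp: adj_part_def dpart_def) (auto simp: F.End_alg_simps mpart_carrier)
  moreover obtain T' U' where "adjoint T T'" "adjoint U U'" using assms by (auto simp: adj_part_def)
  hence "adjoint (T \<otimes>\<^bsub>End\<^esub> U) (U' \<otimes>\<^bsub>End\<^esub> T')" by (rule adjoint_mult)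
  ultimately show ?thesis by (auto simp: adj_part_def)
qed

text \<open>Parts of the module in different degrees are orthogonal, so the adjoint must undo the
  shift of degree. This keeps the involution inside \<open>graded_adj\<close>.\<close>

lemma adj_part_adjoint:
  assumes T: "T \<in> adj_part k" and U: "adjoint T U"
  shows "U \<in> adj_part (- k)"
proof -
  have "U y \<in> mpart (n - k)" if y: "y \<in> mpart n" for y n
  proof -
    have yc: "y \<in> carrier M" "U y \<in> carrier M" 
      using y U by (auto simp: mpart_def adjoint_def F.End_algE)
    have "deg i = n - k" if i: "U y i \<noteq> \<zero>" for i
    proof (rule ccontr)
      assume ne: "deg i \<noteq> n - k"
      have I: "i \<in> I" using i yc by (auto simp: free_simps)
      have Tb: "T (b i) \<in> mpart (deg i + k)" 
        using T I basis_mpart dpartD adj_part_dpart by blast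
      have "U y i = pairing (b i) (U y)" using I yc by (simp add: pairing_sym[of "b i"])
      also have "\<dots> = pairing (T (b i)) y" using U I yc by (simp add: adjoint_def)
      \<comment> \<open>\<open>T (b i)\<close> lives in degree \<open>deg i + k\<close> and
        \<open>y\<close> in degree \<open>n\<close>. By \<open>ne\<close> these differ, so the
        supports are disjoint and the empty index set is admissible.\<close>
      also have "\<dots> = (\<Oplus>i\<in>{}. T (b i) i \<otimes> y i)"
        by (subst pairing_eq[of _ _ "{}"]) (use Tb y ne in \<open>auto simp: mpart_def\<close>)
      finally show False using i by simp
    qed
    thus ?thesis using yc by (simp add: mpart_def)
  qed
  hence "U \<in> dpart (- k)" using U by (auto simp: dpart_def adjoint_def)
  thus ?thesis using adjoint_sym[OF U] by (auto simp: adj_part_def)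
qed

lemma graded_adj_adjoint:
  assumes "T \<in> graded_adj" shows "\<exists>U\<in>graded_adj. adjoint T U"
  using assms
proof induction
  case (hom T k)
  then obtain U where "adjoint T U" by (auto simp: adj_part_def)
  thus ?case using adj_part_adjoint[OF hom] graded_adj.hom by blast
qed (meson adjoint_add graded_adj.add)

lemma graded_adj_End: "T \<in> graded_adj \<Longrightarrow> T \<in> carrier End"
  by (auto dest: graded_adj_adjoint simp: adjoint_def)

lemma graded_adj_mult:
  assumes "T \<in> graded_adj" "U \<in> graded_adj" shows "T \<otimes>\<^bsub>End\<^esub> U \<in> graded_adj"
  using assms
proof (induction arbitrary: U)
  case (hom T k)
  have T: "T \<in> carrier End" using hom.hyps by (auto intro: graded_adj_End graded_adj.hom)
  from hom.prems show ?case
  proof induction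
    case (hom U j)
    thus ?case using adj_part_mult[OF \<open>T \<in> adj_part k\<close>] by (blast intro: graded_adj.hom)
  next
    case (add U V)
    thus ?case using T by (simp add: E.distrib_left graded_adj_End graded_adj.add)
  qed
next
  case (add T V)
  thus ?case by (simp add: E.distrib_right graded_adj_End graded_adj.add)
qed

lemma graded_adj_smult:
  assumes "a \<in> carrier R" "T \<in> graded_adj" shows "a \<odot>\<^bsub>End\<^esub> T \<in> graded_adj"
  using assms(2)
proof induction
  case (hom T k) thus ?case using adj_part_smult[OF assms(1)] by (blast intro: graded_adj.hom)
next
  case (add T U) thus ?case using assms(1) by (simp add: E.smult_r_distr graded_adj_End graded_adj.add)
qed

lemma A_assoc_algebra: "assoc_algebra R A"
  by (rule E.restrict_carrier_assoc_algebra)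
     (use adj_part_zero[of 0] in \<open>auto intro: graded_adj.intros graded_adj_End graded_adj_mult graded_adj_smult\<close>)

sublocale A: assoc_algebra R A
  by (rule A_assoc_algebra)

lemma A_subalgebra: "subalgebra R A End"
  by (auto simp: subalgebra_def A_assoc_algebra graded_adj_End)

lemma A_simps [simp]: "T \<oplus>\<^bsub>A\<^esub> U = T \<oplus>\<^bsub>End\<^esub> U" "T \<otimes>\<^bsub>A\<^esub> U = T \<otimes>\<^bsub>End\<^esub> U" "a \<odot>\<^bsub>A\<^esub> T = a \<odot>\<^bsub>End\<^esub> T"
  "\<zero>\<^bsub>A\<^esub> = \<zero>\<^bsub>End\<^esub>" "carrier A = graded_adj"
  by simp_all

lemma adj_adjoint: "T \<in> graded_adj \<Longrightarrow> adjoint T (adj T)"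
  using graded_adj_adjoint adjE by metis

lemma A_involution: "involution_on R A adj"
  unfolding involution_on_def A_simps
proof (intro conjI ballI)
  fix T assume T: "T \<in> graded_adj"
  show "adj T \<in> graded_adj" using T graded_adj_adjoint adjE by metis
  show "adj (adj T) = T" by (rule adjE) (rule adjoint_sym[OF adj_adjoint[OF T]])
qed (auto intro!: adjE adjoint_add adjoint_mult adjoint_smult adj_adjoint)

lemma A_finsum_apply:
  assumes "f \<in> F \<rightarrow> graded_adj" "x \<in> carrier M"
  shows "finsum A f F x = (\<Oplus>\<^bsub>M\<^esub>k\<in>F. f k x)"
  by (rule additive_finsum[where h = "\<lambda>T. T x", OF A.M.abelian_group_axioms F.M.abelian_group_axioms])
     (use assms in \<open>auto simp: F.End_algE graded_adj_End F.End_alg_simps\<close>)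

lemma free_finsum_apply:
  assumes "f \<in> F \<rightarrow> carrier M"
  shows "finsum M f F i = (\<Oplus>k\<in>F. f k i)"
  by (rule additive_finsum[where h = "\<lambda>x. x i", OF F.M.abelian_group_axioms abelian_group_axioms])
     (use assms in auto, simp add: free_simps)

text \<open>The matrix entry from \<open>j\<close> to \<open>i\<close> receives a contribution only
  from the component whose degree is \<open>deg i - deg j\<close>. Hence each component can be
  recovered from the sum, which is the uniqueness half of the grading.\<close>

lemma component_coeff:
  assumes F: "finite F" and c: "\<And>k. c k \<in> adj_part k" and ij: "i \<in> I" "deg i = deg j + k" "j \<in> I"
    and supp: "k \<notin> F \<Longrightarrow> c k = \<zero>\<^bsub>End\<^esub>"
  shows "finsum A c F (b j) i = c k (b j) i"
proof -
  have cc: "c k (b j) \<in> carrier M" for k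
    using c ij by (meson F.End_algE(1) basis_closed adj_part_dpart dpart_End subsetD)
  have z: "c l (b j) i = \<zero>" if "l \<noteq> k" for l
  proof -
    have "c l (b j) \<in> mpart (deg j + l)" 
      using c ij basis_mpart dpartD adj_part_dpart by blast
    thus ?thesis using ij that by (auto simp: mpart_def)
  qed
  have "finsum A c F (b j) i = (\<Oplus>\<^bsub>M\<^esub>k\<in>F. c k (b j)) i"
    by (subst A_finsum_apply) (use c ij in \<open>auto intro: graded_adj.hom\<close>)
  also have "\<dots> = (\<Oplus>l\<in>F. c l (b j) i)"
    by (rule free_finsum_apply) (use cc in auto)
  \<comment> \<open>\<open>k\<close> may lie outside \<open>F\<close>. The added summand is then
    zero by \<open>supp\<close>.\<close>
  also have "\<dots> = (\<Oplus>l\<in>insert k F. c l (b j) i)"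
    by (rule add.finprod_mono_neutral_cong_left) 
       (use F supp cc ij in \<open>auto simp: F.End_alg_simps free_simps(2)\<close>)
  also have "\<dots> = (\<Oplus>l\<in>insert k F. if k = l then c l (b j) i else \<zero>)"
    by (rule finsum_cong') (use z cc in auto)
  also have "\<dots> = c k (b j) i"
    by (rule finsum_singleton) (use F cc in auto)
  finally show ?thesis .
qed

lemma adj_part_coeff_zero:
  assumes "T \<in> adj_part k" "j \<in> I" "deg i \<noteq> deg j + k"
  shows "T (b j) i = \<zero>"
proof -
  have "T (b j) \<in> mpart (deg j + k)" 
    using assms basis_mpart dpartD adj_part_dpart by blast
  thus ?thesis using assms by (auto simp: mpart_def)
qed

text \<open>\<open>F\<close> only has to contain the support of \<open>c\<close>: components of two
  summands may cancel, so exact supports do not behave well under addition. \<open>A_grading\<close>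
  trims \<open>F\<close> to the exact support afterwards.\<close>

lemma graded_adj_decomp:
  assumes "T \<in> graded_adj"
  shows "\<exists>c F. finite F \<and> (\<forall>k. c k \<in> adj_part k) \<and> (\<forall>k. k \<notin> F \<longrightarrow> c k = \<zero>\<^bsub>End\<^esub>) \<and> T = finsum A c F"
  using assms
proof induction
  case (hom T k)
  let ?c = "(\<lambda>j. if j = k then T else \<zero>\<^bsub>End\<^esub>)"
  have "T = finsum A ?c {k}" using graded_adj.hom[OF hom]
    by (simp add: A.M.finsum_insert graded_adj_End)
  thus ?case using hom adj_part_zero by (intro exI[of _ ?c] exI[of _ "{k}"]) auto
next
  case (add T U)
  then obtain c F d G where *: "finite F" "\<forall>k. c k \<in> adj_part k" "\<forall>k. k \<notin> F \<longrightarrow> c k = \<zero>\<^bsub>End\<^esub>" "T = finsum A c F"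
    "finite G" "\<forall>k. d k \<in> adj_part k" "\<forall>k. k \<notin> G \<longrightarrow> d k = \<zero>\<^bsub>End\<^esub>" "U = finsum A d G" by blast
  let ?e = "\<lambda>k. c k \<oplus>\<^bsub>End\<^esub> d k"
  have cc: "c k \<in> graded_adj" "d k \<in> graded_adj" for k using * graded_adj.hom by blast+
  have T: "T = finsum A c (F \<union> G)" unfolding *(4)
    by (rule A.M.add.finprod_mono_neutral_cong_left) (use * cc in auto)
  have U: "U = finsum A d (F \<union> G)" unfolding *(8)
    by (rule A.M.add.finprod_mono_neutral_cong_left) (use * cc in auto)
  have "T \<oplus>\<^bsub>A\<^esub> U = (\<Oplus>\<^bsub>A\<^esub>k\<in>F \<union> G. c k \<oplus>\<^bsub>A\<^esub> d k)"
    unfolding T U by (rule A.M.finsum_addf[symmetric]) (use cc in auto)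
  hence "T \<oplus>\<^bsub>End\<^esub> U = finsum A ?e (F \<union> G)" by simp
  thus ?case using * adj_part_add by (intro exI[of _ ?e] exI[of _ "F \<union> G"]) auto
qed

lemma A_grading: "int_grading R A adj_part"
  unfolding int_grading_def
proof (intro conjI allI ballI)
  fix k
  have neg: "\<ominus>\<^bsub>A\<^esub> T \<in> adj_part k" if "T \<in> adj_part k" for T
    using adj_part_smult[of "\<ominus> \<one>" T k] A.smult_minus_one[of T] that by (simp add: graded_adj.hom)
  show "submodule (adj_part k) R A"
    by (rule A.submoduleI) (use neg adj_part_zero adj_part_add adj_part_smult in \<open>auto intro: graded_adj.hom\<close>)
next
  fix T assume "T \<in> carrier A"
  then obtain c F where c: "finite F" "\<forall>k. c k \<in> adj_part k" "\<forall>k. k \<notin> F \<longrightarrow> c k = \<zero>\<^bsub>End\<^esub>" "T = finsum A c F"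
    using graded_adj_decomp by (metis A_simps(5))
  have cc: "c k \<in> graded_adj" for k using c graded_adj.hom by blast
  have sub: "{k. c k \<noteq> \<zero>\<^bsub>End\<^esub>} \<subseteq> F" using c by auto
  have T: "T = finsum A c {k. c k \<noteq> \<zero>\<^bsub>End\<^esub>}" unfolding c(4)
    by (rule A.M.add.finprod_mono_neutral_cong_right) (use c cc in auto)
  show "\<exists>!c. (\<forall>k. c k \<in> adj_part k) \<and> finite {k. c k \<noteq> \<zero>\<^bsub>A\<^esub>} \<and> T = (\<Oplus>\<^bsub>A\<^esub>k\<in>{k. c k \<noteq> \<zero>\<^bsub>A\<^esub>}. c k)"
  proof (rule ex1I[of _ c])
    show "(\<forall>k. c k \<in> adj_part k) \<and> finite {k. c k \<noteq> \<zero>\<^bsub>A\<^esub>} \<and> T = (\<Oplus>\<^bsub>A\<^esub>k\<in>{k. c k \<noteq> \<zero>\<^bsub>A\<^esub>}. c k)"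
      using c(1,2) sub T by (auto intro: finite_subset)
  next
    fix d assume d: "(\<forall>k. d k \<in> adj_part k) \<and> finite {k. d k \<noteq> \<zero>\<^bsub>A\<^esub>} \<and> T = (\<Oplus>\<^bsub>A\<^esub>k\<in>{k. d k \<noteq> \<zero>\<^bsub>A\<^esub>}. d k)"
    have dc: "d k \<in> carrier End" "c k \<in> carrier End" for k
      using c(2) d graded_adj_End graded_adj.hom by blast+
    show "d = c"
    proof
      fix k show "d k = c k"
      proof (rule linear_ext[OF dc], rule ext)
        fix j i assume j: "j \<in> I"
        show "d k (b j) i = c k (b j) i"
        \<comment> \<open>Entries that raise the degree by \<open>k\<close> are entries of
          \<open>T\<close> itself, hence the same for \<open>c\<close> and \<open>d\<close>. All
          other entries of a component of degree \<open>k\<close> vanish.\<close>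
        proof (cases "i \<in> I \<and> deg i = deg j + k")
          case True
          have "T (b j) i = c k (b j) i" unfolding c(4)
            by (rule component_coeff) (use True j c in auto)
          moreover have "finsum A d {k. d k \<noteq> \<zero>\<^bsub>A\<^esub>} (b j) i = d k (b j) i"
            by (rule component_coeff) (use True j d in auto)
          ultimately show ?thesis using d by auto
        next
          case False
          have out: "T (b j) i = \<zero>" if "T \<in> adj_part k" for T
          proof (cases "i \<in> I")
            case False
            have "T (b j) \<in> carrier M" using that j by (simp add: F.End_algE(1) graded_adj.hom graded_adj_End)
            thus ?thesis using False by (simp add: free_simps(1))
          qed (use False adj_part_coeff_zero that j in blast)
          show ?thesis using out[of "c k"] out[of "d k"] c(2) d by simp
        qed
      qed
    qed
  qed
next
  fix j k T U assume "T \<in> adj_part j" "U \<in> adj_part k"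
  thus "T \<otimes>\<^bsub>A\<^esub> U \<in> adj_part (j + k)" using adj_part_mult by simp
qed

end

section \<open>Essentially aperiodic trails\<close>

context wf_digraph
begin

lemma gpaths_iff: "(u, p) \<in> gpaths G \<longleftrightarrow> awalk u p (awlast u p)"
  by (auto simp: gpaths_def awlast_if_cas elim: awalkE')

lemma path_range_simps [simp]:
  "path_range G (u, []) = u" "path_range G (u, e # p) = path_range G (head G e, p)"
  by (simp_all add: path_range_def)

lemma gpaths_Nil [simp]: "(u, []) \<in> gpaths G \<longleftrightarrow> u \<in> verts G"
  by (simp add: gpaths_iff awalk_Nil_iff)

lemma gpaths_Cons [simp]: "(u, e # p) \<in> gpaths G \<longleftrightarrow> e \<in> arcs G \<and> u = tail G e \<and> (head G e, p) \<in> gpaths G"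
  by (simp add: gpaths_iff awalk_Cons_iff)

lemma gpaths_source: "(u, p) \<in> gpaths G \<Longrightarrow> u \<in> verts G"
  by (cases p) auto

lemma gpaths_append:
  "(u, p @ q) \<in> gpaths G \<longleftrightarrow> (u, p) \<in> gpaths G \<and> (path_range G (u, p), q) \<in> gpaths G"
  by (induction p arbitrary: u) (auto dest: gpaths_source)

lemma path_range_append: "path_range G (u, p @ q) = path_range G (path_range G (u, p), q)"
  by (induction p arbitrary: u) auto

lemma path_range_verts: "\<alpha> \<in> gpaths G \<Longrightarrow> path_range G \<alpha> \<in> verts G"
proof (cases \<alpha>)
  case (Pair u p)
  show "\<alpha> \<in> gpaths G \<Longrightarrow> ?thesis" unfolding Pair
    by (induction p arbitrary: u) auto
qed

lemma path_append_gpaths: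
  "\<lbrakk>\<alpha> \<in> gpaths G; \<beta> \<in> gpaths G; path_range G \<alpha> = path_source \<beta>\<rbrakk> \<Longrightarrow> path_append \<alpha> \<beta> \<in> gpaths G"
  by (cases \<alpha>; cases \<beta>) (auto simp: path_append_def gpaths_append)

lemma path_range_path_append:
  "path_range G \<alpha> = path_source \<beta> \<Longrightarrow> path_range G (path_append \<alpha> \<beta>) = path_range G \<beta>"
  by (cases \<alpha>; cases \<beta>) (auto simp: path_append_def path_range_append)

end

text \<open>Exits are detected edge by edge, which turns the condition on a period into one on the
  single edges \<open>w n\<close>.\<close>

lemma has_exit_iff: "has_exit G p \<longleftrightarrow> (\<exists>e\<in>set p. has_exit G [e])"
proof -
  have "has_exit G [x] \<longleftrightarrow> (\<exists>e\<in>arcs G. tail G e = tail G x \<and> e \<noteq> x)" for x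
    by (simp add: has_exit_def)
  thus ?thesis unfolding has_exit_def[of G p] by (metis in_set_conv_nth)
qed

lemma repeats_from_mult:
  assumes "repeats_from w j k" "n \<ge> j" shows "w (n + m * k) = w n"
proof (induction m)
  case (Suc m)
  have "w ((n + m * k) + k) = w (n + m * k)"
    using assms unfolding repeats_from_def by (meson trans_le_add1)
  thus ?case using Suc by (simp add: ac_simps)
qed simp

lemma periodic_suffix: "periodic (suffix m w) \<longleftrightarrow> periodic w"
proof
  assume "periodic (suffix m w)"
  then obtain j k where jk: "k \<ge> 1" "\<And>n. n \<ge> j \<Longrightarrow> w (m + (n + k)) = w (m + n)"
    by (auto simp: periodic_def repeats_from_def)
  have "w (n + k) = w n" if "n \<ge> m + j" for n using jk(2)[of "n - m"] that by simp
  thus "periodic w" using jk(1) unfolding periodic_def repeats_from_def by blast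
next
  assume "periodic w"
  then obtain j k where "repeats_from w j k" by (auto simp: periodic_def)
  hence "repeats_from (suffix m w) j k" by (auto simp: repeats_from_def add.assoc[symmetric])
  thus "periodic (suffix m w)" by (auto simp: periodic_def)
qed

text \<open>The right-hand side makes no reference to a choice of period, and depends only on the tail of \<open>w\<close>.\<close>

lemma essentially_aperiodic_iff:
  "essentially_aperiodic G (InfTrail w) \<longleftrightarrow>
     \<not> periodic w \<or> (\<exists>N. \<forall>n\<ge>N. \<not> has_exit G [w n])"
proof (cases "periodic w")
  case True
  then obtain j0 k0 where "repeats_from w j0 k0" by (auto simp: periodic_def)
  \<comment> \<open>A repeating pair of least sum exists by well-ordering, which supplies the period
    required by \<open>is_period\<close>.\<close>
  define P where "P = (\<lambda>m. \<exists>j k. repeats_from w j k \<and> j + k = m)"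
  have "P (j0 + k0)" using \<open>repeats_from w j0 k0\<close> by (auto simp: P_def)
  hence "P (LEAST m. P m)" by (rule LeastI)
  then obtain j k where jk: "repeats_from w j k" "j + k = (LEAST m. P m)" by (auto simp: P_def)
  have "j + k \<le> j' + k'" if "repeats_from w j' k'" for j' k'
    unfolding jk(2) by (rule Least_le) (use that in \<open>auto simp: P_def\<close>)
  hence period: "is_period w (map w [j..<j + k])" using jk(1) unfolding is_period_def by blast
  \<comment> \<open>Stated for an arbitrary repeating pair: each edge of the repeated block recurs
    every \<open>k\<close> steps, and each edge from \<open>j\<close> on equals one of the block,
    with its position reduced modulo \<open>k\<close>.\<close>
  have key: "has_exit G (map w [j..<j + k]) \<longleftrightarrow> (\<forall>N. \<exists>n\<ge>N. has_exit G [w n])" if jk: "repeats_from w j k" for j k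
  proof
    have k: "k \<ge> 1" using jk by (simp add: repeats_from_def)
    assume "has_exit G (map w [j..<j + k])"
    then obtain i where i: "i \<ge> j" "has_exit G [w i]" by (subst (asm) has_exit_iff) auto
    show "\<forall>N. \<exists>n\<ge>N. has_exit G [w n]"
    proof
      fix N
      have "N \<le> i + N * k" using k by (simp add: trans_le_add2)
      moreover have "has_exit G [w (i + N * k)]" using i repeats_from_mult[OF jk, of i N] by simp
      ultimately show "\<exists>n\<ge>N. has_exit G [w n]" by blast
    qed
  next
    have k: "k \<ge> 1" using jk by (simp add: repeats_from_def)
    assume "\<forall>N. \<exists>n\<ge>N. has_exit G [w n]"
    then obtain n where n: "n \<ge> j" "has_exit G [w n]" by blast
    let ?i = "(n - j) mod k"
    have "n = (j + ?i) + (n - j) div k * k" using n(1) by simp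
    hence "w n = w (j + ?i)" using repeats_from_mult[OF jk, of "j + ?i" "(n - j) div k"] by simp
    hence "has_exit G [w (j + ?i)]" using n by simp
    moreover have "?i < k" using k by simp
    ultimately show "has_exit G (map w [j..<j + k])"
      by (subst has_exit_iff) auto
  qed
  have "(\<exists>p. is_period w p \<and> \<not> has_exit G p) \<longleftrightarrow> (\<exists>N. \<forall>n\<ge>N. \<not> has_exit G [w n])"
  proof
    assume "\<exists>p. is_period w p \<and> \<not> has_exit G p"
    then obtain j k where "repeats_from w j k" "\<not> has_exit G (map w [j..<j + k])"
      by (auto simp: is_period_def)
    thus "\<exists>N. \<forall>n\<ge>N. \<not> has_exit G [w n]" using key by blast
  next
    assume "\<exists>N. \<forall>n\<ge>N. \<not> has_exit G [w n]"
    hence "\<not> has_exit G (map w [j..<j + k])" using key[OF jk(1)] by blast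
    thus "\<exists>p. is_period w p \<and> \<not> has_exit G p" using period by blast
  qed
  thus ?thesis using True by simp
qed simp

lemma essentially_aperiodic_suffix:
  "essentially_aperiodic G (InfTrail (suffix m w)) \<longleftrightarrow> essentially_aperiodic G (InfTrail w)"
proof -
  have "(\<exists>N. \<forall>n\<ge>N. \<not> has_exit G [w (m + n)]) \<longleftrightarrow> (\<exists>N. \<forall>n\<ge>N. \<not> has_exit G [w n])"
  proof
    assume "\<exists>N. \<forall>n\<ge>N. \<not> has_exit G [w (m + n)]"
    then obtain N where N: "\<And>n. n \<ge> N \<Longrightarrow> \<not> has_exit G [w (m + n)]" by blast
    have "\<not> has_exit G [w n]" if "n \<ge> m + N" for n using N[of "n - m"] that by simp
    thus "\<exists>N. \<forall>n\<ge>N. \<not> has_exit G [w n]" by blast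
  next
    assume "\<exists>N. \<forall>n\<ge>N. \<not> has_exit G [w n]"
    thus "\<exists>N. \<forall>n\<ge>N. \<not> has_exit G [w (m + n)]" by (meson trans_le_add2)
  qed
  thus ?thesis unfolding essentially_aperiodic_iff periodic_suffix suffix_nth by simp
qed

text \<open>The bit at \<open>n\<close> is the parity of the binary logarithm. It is constant on the
  dyadic block from \<open>2^i\<close> to \<open>2^(i+1) - 1\<close> and flips from one block to the
  next. These blocks grow, and a progression of step \<open>k\<close> cannot jump over a block of
  length at least \<open>k\<close>.\<close>

lemma non_constant_on_progressions:
  obtains b :: "nat \<Rightarrow> bool" where "\<And>n k. k \<ge> 1 \<Longrightarrow> \<exists>m. b (n + m * k) \<noteq> b n"
proof (rule that)
  let ?b = "\<lambda>n. even (floor_log n)"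
  fix n k :: nat assume k: "k \<ge> 1"
  have surj: "\<exists>m. floor_log (n + m * k) = i" if i: "n + k \<le> 2 ^ i" for i
  proof -
    \<comment> \<open>This gives the last term of the progression not exceeding
      \<open>2 ^ Suc i - 1\<close>. It falls short of that bound by less than \<open>k\<close>, and
      \<open>k \<le> 2 ^ i\<close> keeps it inside the block.\<close>
    let ?m = "(2 ^ Suc i - 1 - n) div k"
    define r where "r = (2 ^ Suc i - 1 - n) mod k"
    have "?m * k + r = 2 ^ Suc i - 1 - n" unfolding r_def by (rule div_mult_mod_eq)
    moreover have "r < k" using k by (simp add: r_def)
    moreover have "(2::nat) ^ Suc i = 2 ^ i + 2 ^ i" by simp
    ultimately have "2 ^ i \<le> n + ?m * k" "n + ?m * k < 2 ^ Suc i" using i by linarith+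
    moreover from this(1) have "0 < n + ?m * k" by (rule less_le_trans[rotated]) simp
    ultimately have "floor_log (n + ?m * k) = i" by (intro floor_log_eqI) simp_all
    thus ?thesis by blast
  qed
  define i where "i = n + k"
  have i: "n + k \<le> 2 ^ i" unfolding i_def by (rule less_imp_le[OF less_exp])
  hence i': "n + k \<le> 2 ^ Suc i" by simp
  from surj[OF i] obtain m where "floor_log (n + m * k) = i" ..
  moreover from surj[OF i'] obtain m' where "floor_log (n + m' * k) = Suc i" ..
  \<comment> \<open>Neighbouring blocks carry opposite bits, so at least one of the two terms
    differs from the bit at \<open>n\<close>.\<close>
  ultimately have "?b (n + m * k) \<noteq> ?b (n + m' * k)" by simp
  thus "\<exists>m. ?b (n + m * k) \<noteq> ?b n" by (cases "?b (n + m * k) = ?b n") auto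
qed

section \<open>Prepending paths to trails, cancellation, and existence of trails\<close>

context wf_digraph
begin

lemma ap_trails_InfTrail: "InfTrail w \<in> ap_trails G \<longleftrightarrow>
    (\<forall>n. w n \<in> arcs G \<and> head G (w n) = tail G (w (Suc n))) \<and> essentially_aperiodic G (InfTrail w)"
  by (simp add: ap_trails_def trails_def del: essentially_aperiodic.simps)

lemma ap_trails_FinTrail: "FinTrail \<alpha> \<in> ap_trails G \<longleftrightarrow> \<alpha> \<in> gpaths G \<and> is_sink G (path_range G \<alpha>)"
  by (cases \<alpha>) (simp add: ap_trails_def trails_def)

lemma trail_append_Nil: "trail_append (trail_source G \<tau>, []) \<tau> = \<tau>"
  by (cases \<tau>) (auto simp: path_append_def prod_eq_iff)

lemma trail_append_Nil': "u = trail_source G \<tau> \<Longrightarrow> trail_append (u, []) \<tau> = \<tau>"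
  by (simp add: trail_append_Nil)

lemma trail_append_path_append:
  "trail_append (path_append \<alpha> \<beta>) \<tau> = trail_append \<alpha> (trail_append \<beta> \<tau>)"
  by (cases \<tau>) (auto simp: path_append_def)

lemma trail_append_Cons: 
  "trail_append (u, e # p) \<tau> = trail_append (u, [e]) (trail_append (head G e, p) \<tau>)"
  by (simp add: trail_append_path_append[symmetric] path_append_def)

lemma trail_source_append:
  assumes "\<alpha> \<in> gpaths G" "path_range G \<alpha> = trail_source G \<tau>"
  shows "trail_source G (trail_append \<alpha> \<tau>) = path_source \<alpha>"
proof (cases \<tau>)
  case (InfTrail w)
  obtain u p where "\<alpha> = (u, p)" by (cases \<alpha>)
  thus ?thesis using assms InfTrail by (cases p) auto
qed (simp add: path_append_def)

text \<open>One edge in front changes neither the end of a finite trail nor the tail that decides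
  whether an infinite one is essentially aperiodic.\<close>

lemma edge_append_ap_trail:
  assumes e: "e \<in> arcs G" and \<tau>: "trail_source G \<tau> = head G e"
  shows "trail_append (tail G e, [e]) \<tau> \<in> ap_trails G \<longleftrightarrow> \<tau> \<in> ap_trails G"
proof (cases \<tau>)
  case (FinTrail \<beta>)
  thus ?thesis using assms by (cases \<beta>) (auto simp: ap_trails_FinTrail path_append_def)
next
  case (InfTrail w)
  have "essentially_aperiodic G (InfTrail (e ## w)) \<longleftrightarrow> essentially_aperiodic G (InfTrail w)"
  proof -
    have "suffix 1 (e ## w) = w" by (rule ext) simp
    thus ?thesis using essentially_aperiodic_suffix[of G 1 "e ## w"] by metis
  qed
  moreover have "(\<forall>n. (e ## w) n \<in> arcs G \<and> head G ((e ## w) n) = tail G ((e ## w) (Suc n))) \<longleftrightarrow>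
     (\<forall>n. w n \<in> arcs G \<and> head G (w n) = tail G (w (Suc n)))"
    (is "(\<forall>n. ?P n) \<longleftrightarrow> _")
  proof -
    have "(\<forall>n. ?P n) \<longleftrightarrow> ?P 0 \<and> (\<forall>n. ?P (Suc n))" by (metis nat.exhaust)
    thus ?thesis using assms InfTrail by auto
  qed
  ultimately show ?thesis using assms InfTrail by (simp add: ap_trails_InfTrail del: essentially_aperiodic.simps)
qed

lemma trail_append_ap_trails:
  assumes "\<alpha> \<in> gpaths G" "path_range G \<alpha> = trail_source G \<tau>" "\<tau> \<in> ap_trails G"
  shows "trail_append \<alpha> \<tau> \<in> ap_trails G"
proof -
  obtain u p where \<alpha>: "\<alpha> = (u, p)" by (cases \<alpha>)
  show ?thesis using assms(1,2) unfolding \<alpha>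
  proof (induction p arbitrary: u)
    case (Cons e p)
    thus ?case by (simp add: trail_append_Cons[of _ e p] edge_append_ap_trail trail_source_append)
  qed (use assms(3) in \<open>simp add: trail_append_Nil\<close>)
qed

text \<open>Splitting off the first edge stays within the basis. The second Cuntz-Krieger relation
  is checked along this distinction.\<close>

lemma ap_trail_cases:
  assumes "\<tau> \<in> ap_trails G"
  obtains (sink) v where "is_sink G v" "\<tau> = FinTrail (v, [])"
    | (edge) e \<tau>' where "e \<in> arcs G" "\<tau>' \<in> ap_trails G" "trail_source G \<tau>' = head G e"
        "\<tau> = trail_append (tail G e, [e]) \<tau>'"
proof (cases \<tau>)
  case (FinTrail \<beta>)
  obtain u p where \<beta>: "\<beta> = (u, p)" by (cases \<beta>)
  show ?thesis
  proof (cases p)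
    case Nil
    thus ?thesis using assms FinTrail \<beta> sink by (auto simp: ap_trails_FinTrail)
  next
    case (Cons e q)
    show ?thesis
      by (rule edge[of e "FinTrail (head G e, q)"])
         (use assms FinTrail \<beta> Cons in \<open>auto simp: ap_trails_FinTrail path_append_def\<close>)
  qed
next
  case (InfTrail w)
  have eq: "w = [w 0] \<frown> suffix 1 w" by simp
  show ?thesis
  proof (rule edge[of "w 0" "InfTrail (suffix 1 w)"])
    show "InfTrail (suffix 1 w) \<in> ap_trails G" using assms InfTrail
      by (simp add: ap_trails_InfTrail essentially_aperiodic_suffix del: essentially_aperiodic.simps)
    show "\<tau> = trail_append (tail G (w 0), [w 0]) (InfTrail (suffix 1 w))" using InfTrail eq by simp
  qed (use assms InfTrail in \<open>auto simp: ap_trails_InfTrail\<close>)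
qed

text \<open>\<open>path_append\<close> forgets the source of its second argument, so in the finite
  case the edge lists alone do not identify a trail. The equal sources restore this
  information.\<close>

lemma trail_append_inj_trail:
  "trail_source G \<tau> = trail_source G \<tau>' \<Longrightarrow> trail_append \<alpha> \<tau> = trail_append \<alpha> \<tau>' \<Longrightarrow> \<tau> = \<tau>'"
  by (cases \<tau>; cases \<tau>') (auto simp: path_append_def prod_eq_iff)

text \<open>Equal lengths are essential: if \<open>\<tau>\<close> runs around a cycle forever,
  prepending that cycle or only its base vertex yields the same trail. In the representation the
  integer superscript supplies this equality.\<close>

lemma trail_append_inj_path:
  assumes "\<alpha> \<in> gpaths G" "\<beta> \<in> gpaths G" "path_range G \<alpha> = trail_source G \<tau>" "path_range G \<beta> = trail_source G \<tau>'"
    and eq: "trail_append \<alpha> \<tau> = trail_append \<beta> \<tau>'" and len: "path_length \<alpha> = path_length \<beta>"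
  shows "\<alpha> = \<beta>"
proof -
  have "fst \<alpha> = fst \<beta>" using assms trail_source_append by metis
  moreover have "snd \<alpha> = snd \<beta>"
  proof (cases \<tau>)
    case (FinTrail \<gamma>)
    thus ?thesis using eq len by (cases \<tau>') (auto simp: path_append_def)
  next
    case (InfTrail w)
    then obtain w' where w': "\<tau>' = InfTrail w'" "snd \<alpha> \<frown> w = snd \<beta> \<frown> w'" using eq by (cases \<tau>') auto
    show ?thesis
    proof (rule nth_equalityI[OF len])
      fix i assume "i < length (snd \<alpha>)"
      thus "snd \<alpha> ! i = snd \<beta> ! i" using fun_cong[OF w'(2), of i] len by simp
    qed
  qed
  ultimately show ?thesis by (simp add: prod_eq_iff)
qed

text \<open>
  The walk takes one of two edges at a branching vertex, and the bit that decides is not constant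
  along any arithmetic progression of times. So a branching vertex cannot recur periodically with
  the same edge chosen.
\<close>

lemma infinite_ap_trail:
  assumes v: "v \<in> verts G" and no_sink: "\<And>\<alpha>. \<alpha> \<in> gpaths G \<Longrightarrow> path_source \<alpha> = v \<Longrightarrow> \<not> is_sink G (path_range G \<alpha>)"
  shows "\<exists>\<tau>\<in>ap_trails G. trail_source G \<tau> = v"
proof -
  obtain b :: "nat \<Rightarrow> bool" where b: "\<And>n k. k \<ge> 1 \<Longrightarrow> \<exists>m. b (n + m * k) \<noteq> b n"
    by (rule non_constant_on_progressions) blast
  define c where "c u = (SOME e. e \<in> out_arcs G u)" for u
  \<comment> \<open>\<open>d u\<close> agrees with \<open>c u\<close> only if \<open>c u\<close> is
    the sole edge emitted, so at a branching vertex the chosen edge reveals the bit.\<close>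
  define d where "d u = (SOME e. e \<in> out_arcs G u \<and> (e \<noteq> c u \<or> out_arcs G u = {c u}))" for u
  define step where "step n u = (if b n then c u else d u)" for n u
  define x where "x = rec_nat v (\<lambda>n u. head G (step n u))"
  define w where "w n = step n (x n)" for n
  have x: "x 0 = v" "x (Suc n) = head G (w n)" for n by (simp_all add: x_def w_def)
  have c: "c u \<in> out_arcs G u" if "out_arcs G u \<noteq> {}" for u
    unfolding c_def using that some_in_eq by metis
  have d: "d u \<in> out_arcs G u" "out_arcs G u = {c u} \<or> d u \<noteq> c u" if "out_arcs G u \<noteq> {}" for u
  proof -
    have "\<exists>e. e \<in> out_arcs G u \<and> (e \<noteq> c u \<or> out_arcs G u = {c u})" using c[OF that] by blast
    hence "d u \<in> out_arcs G u \<and> (d u \<noteq> c u \<or> out_arcs G u = {c u})" unfolding d_def by (rule someI_ex)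
    thus "d u \<in> out_arcs G u" "out_arcs G u = {c u} \<or> d u \<noteq> c u" by auto
  qed
  \<comment> \<open>Every vertex visited is the range of a path from \<open>v\<close>. By
    \<open>no_sink\<close> it therefore emits an edge and the walk can always be continued.\<close>
  have reach: "\<exists>\<alpha>\<in>gpaths G. path_source \<alpha> = v \<and> path_range G \<alpha> = x n" for n
  proof (induction n)
    case 0
    show ?case by (rule bexI[of _ "(v, [])"]) (use v in \<open>auto simp: x\<close>)
  next
    case (Suc n)
    then obtain \<alpha> where \<alpha>: "\<alpha> \<in> gpaths G" "path_source \<alpha> = v" "path_range G \<alpha> = x n" by blast
    hence "out_arcs G (x n) \<noteq> {}" using no_sink[of \<alpha>] path_range_verts[of \<alpha>] by (auto simp: is_sink_def)
    hence "w n \<in> out_arcs G (x n)" using c d by (auto simp: w_def step_def)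
    hence "path_append \<alpha> (x n, [w n]) \<in> gpaths G \<and> path_range G (path_append \<alpha> (x n, [w n])) = x (Suc n)"
      using \<alpha> by (auto intro!: path_append_gpaths simp: path_range_path_append x)
    moreover have "path_source (path_append \<alpha> (x n, [w n])) = v" using \<alpha> by (simp add: path_append_def)
    ultimately show ?case by blast
  qed
  have ne: "out_arcs G (x n) \<noteq> {}" for n
  proof -
    obtain \<alpha> where "\<alpha> \<in> gpaths G" "path_source \<alpha> = v" "path_range G \<alpha> = x n" using reach by blast
    thus ?thesis using no_sink[of \<alpha>] path_range_verts[of \<alpha>] by (auto simp: is_sink_def)
  qed
  have w: "w n \<in> arcs G" "tail G (w n) = x n" for n using c[OF ne] d(1)[OF ne] by (auto simp: w_def step_def)
  have "essentially_aperiodic G (InfTrail w)"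
  proof (rule ccontr)
    assume "\<not> essentially_aperiodic G (InfTrail w)"
    then obtain j k where jk: "repeats_from w j k" and exit: "\<And>N. \<exists>n\<ge>N. has_exit G [w n]"
      unfolding essentially_aperiodic_iff by (auto simp: periodic_def)
    obtain n where n: "n \<ge> j" "has_exit G [w n]" using exit by blast
    then obtain e where "e \<in> arcs G" "tail G e = x n" "e \<noteq> w n" by (auto simp: has_exit_def w)
    hence "e \<in> out_arcs G (x n)" "w n \<in> out_arcs G (x n)" "e \<noteq> w n" using w by auto
    hence cd: "d (x n) \<noteq> c (x n)" using d(2)[OF ne[of n]] by (metis singletonD)
    obtain m where m: "b (n + m * k) \<noteq> b n" using b[of k n] jk by (auto simp: repeats_from_def)
    have eq: "w (n + m * k) = w n" by (rule repeats_from_mult[OF jk n(1)])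
    hence "x (n + m * k) = x n" using w(2) by metis
    hence "step (n + m * k) (x n) = step n (x n)" using eq by (simp add: w_def)
    thus False using m cd by (auto simp: step_def split: if_splits)
  qed
  hence "InfTrail w \<in> ap_trails G" using w x by (simp add: ap_trails_InfTrail del: essentially_aperiodic.simps)
  thus ?thesis using w(2)[of 0] x(1) by (intro bexI[of _ "InfTrail w"]) auto
qed

text \<open>A reachable sink gives a finite trail, otherwise the walk above applies. This provides a
  test vector at every vertex for the proof of injectivity.\<close>

lemma ap_trail_from:
  assumes v: "v \<in> verts G" obtains \<tau> where "\<tau> \<in> ap_trails G" "trail_source G \<tau> = v"
proof (cases "\<exists>\<alpha>\<in>gpaths G. path_source \<alpha> = v \<and> is_sink G (path_range G \<alpha>)")
  case True
  then obtain \<alpha> where "\<alpha> \<in> gpaths G" "path_source \<alpha> = v" "is_sink G (path_range G \<alpha>)" by blast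
  thus ?thesis using that[of "FinTrail \<alpha>"] by (simp add: ap_trails_FinTrail)
next
  case False
  thus ?thesis using infinite_ap_trail[OF v] that by blast
qed

end

section \<open>Shift operators\<close>

context free_endos
begin

text \<open>A partial permutation matrix, given by its effect on coordinates. On the basis it sends
  \<open>b j\<close> to \<open>b (f j)\<close> for \<open>j\<close> in \<open>D\<close> and kills
  the rest, provided that \<open>f\<close> is injective on \<open>D\<close> with values in
  \<open>I\<close>.\<close>

definition shift :: "'i set \<Rightarrow> ('i \<Rightarrow> 'i) \<Rightarrow> ('i \<Rightarrow> 'r) \<Rightarrow> 'i \<Rightarrow> 'r" where
  "shift D f = (\<lambda>x\<in>carrier M. \<lambda>i. if i \<in> f ` D then x (the_inv_into D f i) else \<zero>)"

text \<open>The transpose of the matrix of \<open>shift\<close>: coordinates are pulled back along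
  \<open>f\<close>.\<close>

definition coshift :: "'i set \<Rightarrow> ('i \<Rightarrow> 'i) \<Rightarrow> ('i \<Rightarrow> 'r) \<Rightarrow> 'i \<Rightarrow> 'r" where
  "coshift D f = (\<lambda>x\<in>carrier M. \<lambda>i. if i \<in> D then x (f i) else \<zero>)"

context
  fixes D f assumes D: "D \<subseteq> I" "f ` D \<subseteq> I" and inj: "inj_on f D"
begin

lemma shift_image: "x \<in> carrier M \<Longrightarrow> j \<in> D \<Longrightarrow> shift D f x (f j) = x j"
  by (simp add: shift_def the_inv_into_f_f[OF inj])

lemma shift_outside: "x \<in> carrier M \<Longrightarrow> i \<notin> f ` D \<Longrightarrow> shift D f x i = \<zero>"
  by (simp add: shift_def)

lemma coshift_apply: "x \<in> carrier M \<Longrightarrow> coshift D f x i = (if i \<in> D then x (f i) else \<zero>)"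
  by (simp add: coshift_def)

lemma shift_closed: assumes x: "x \<in> carrier M" shows "shift D f x \<in> carrier M"
proof -
  have "i \<in> f ` {j. x j \<noteq> \<zero>}" if "shift D f x i \<noteq> \<zero>" for i
  proof -
    have "i \<in> f ` D" using that shift_outside[OF x] by blast
    then obtain j where j: "j \<in> D" "i = f j" by blast
    hence "x j \<noteq> \<zero>" using that shift_image[OF x] by simp
    thus ?thesis using j by blast
  qed
  hence "{i. shift D f x i \<noteq> \<zero>} \<subseteq> f ` {j. x j \<noteq> \<zero>}" by blast
  hence "finite {i. shift D f x i \<noteq> \<zero>}"
    by (rule finite_subset[OF _ finite_imageI[OF finite_support[OF x]]])
  moreover have "shift D f x i \<in> carrier R" for i
    using x by (simp add: shift_def)
  moreover have "i \<notin> I \<Longrightarrow> shift D f x i = \<zero>" for i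
    using shift_outside[OF x] D by blast
  ultimately show ?thesis by (simp add: free_simps(1))
qed

text \<open>Injectivity keeps the support finite, since \<open>f\<close> embeds the support of the
  image into the support of \<open>x\<close>.\<close>

lemma coshift_closed: assumes x: "x \<in> carrier M" shows "coshift D f x \<in> carrier M"
proof -
  have "finite (f ` {i. coshift D f x i \<noteq> \<zero>})"
    by (rule finite_subset[OF _ finite_support[OF x]]) (auto simp: coshift_apply[OF x] split: if_splits)
  moreover have "inj_on f {i. coshift D f x i \<noteq> \<zero>}"
    by (rule inj_on_subset[OF inj]) (auto simp: coshift_apply[OF x] split: if_splits)
  ultimately have "finite {i. coshift D f x i \<noteq> \<zero>}" by (rule finite_imageD)
  moreover have "coshift D f x i \<in> carrier R" "i \<notin> I \<Longrightarrow> coshift D f x i = \<zero>" for i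
    using x D by (auto simp: coshift_apply)
  ultimately show ?thesis by (simp add: free_simps(1))
qed

lemma shift_End: "shift D f \<in> carrier End"
proof (rule F.End_algI)
  fix x y assume x: "x \<in> carrier M" "y \<in> carrier M"
  hence "(\<lambda>i. x i \<oplus> y i) \<in> carrier M" using F.M.a_closed[OF x] by (simp add: free_simps(3))
  thus "shift D f (x \<oplus>\<^bsub>M\<^esub> y) = shift D f x \<oplus>\<^bsub>M\<^esub> shift D f y" 
    using x by (auto simp: free_simps(3) shift_def fun_eq_iff)
next
  fix a x assume x: "a \<in> carrier R" "x \<in> carrier M"
  hence "(\<lambda>i. a \<otimes> x i) \<in> carrier M" using F.smult_closed[OF x] by (simp add: free_simps(4))
  thus "shift D f (a \<odot>\<^bsub>M\<^esub> x) = a \<odot>\<^bsub>M\<^esub> shift D f x" 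
    using x by (auto simp: free_simps(4) shift_def fun_eq_iff)
qed (simp_all add: shift_closed, simp add: shift_def)

lemma coshift_End: "coshift D f \<in> carrier End"
proof (rule F.End_algI)
  fix x y assume x: "x \<in> carrier M" "y \<in> carrier M"
  hence "(\<lambda>i. x i \<oplus> y i) \<in> carrier M" using F.M.a_closed[OF x] by (simp add: free_simps(3))
  thus "coshift D f (x \<oplus>\<^bsub>M\<^esub> y) = coshift D f x \<oplus>\<^bsub>M\<^esub> coshift D f y" 
    using x by (auto simp: free_simps(3) coshift_def fun_eq_iff)
next
  fix a x assume x: "a \<in> carrier R" "x \<in> carrier M"
  hence "(\<lambda>i. a \<otimes> x i) \<in> carrier M" using F.smult_closed[OF x] by (simp add: free_simps(4))
  thus "coshift D f (a \<odot>\<^bsub>M\<^esub> x) = a \<odot>\<^bsub>M\<^esub> coshift D f x" 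
    using x by (auto simp: free_simps(4) coshift_def fun_eq_iff)
qed (simp_all add: coshift_closed, simp add: coshift_def)

lemma adjoint_shift: "adjoint (shift D f) (coshift D f)"
proof (rule adjointI[OF shift_End coshift_End])
  fix x y assume x: "x \<in> carrier M" and y: "y \<in> carrier M"
  \<comment> \<open>The part of the support of \<open>x\<close> that \<open>shift\<close> does not
    kill. Reindexing along \<open>f\<close> carries it onto the support of the shifted vector and
    turns one pairing into the other.\<close>
  let ?B = "{j. x j \<noteq> \<zero>} \<inter> D"
  have fin: "finite ?B" using finite_support[OF x] by simp
  have injB: "inj_on f ?B" by (rule inj_on_subset[OF inj]) auto
  have "pairing (shift D f x) y = (\<Oplus>i\<in>f ` ?B. shift D f x i \<otimes> y i)"
  proof (rule pairing_eq[OF shift_closed[OF x] y])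
    fix i assume i: "shift D f x i \<noteq> \<zero>"
    hence "i \<in> f ` D" using shift_outside[OF x] by blast
    then obtain j where j: "j \<in> D" "i = f j" by blast
    hence "x j \<noteq> \<zero>" using i shift_image[OF x] by simp
    thus "i \<in> f ` ?B" using j by blast
  qed (use fin in simp)
  also have "\<dots> = (\<Oplus>j\<in>?B. shift D f x (f j) \<otimes> y (f j))"
    by (rule finsum_reindex) (use x y injB shift_closed[OF x] in auto)
  also have "\<dots> = (\<Oplus>j\<in>?B. x j \<otimes> coshift D f y j)"
    by (rule finsum_cong') (use x y in \<open>auto simp: shift_image coshift_apply\<close>)
  also have "\<dots> = pairing x (coshift D f y)"
    by (rule pairing_eq[symmetric, OF x coshift_closed[OF y] fin]) (auto simp: coshift_apply[OF y] split: if_splits)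
  finally show "pairing (shift D f x) y = pairing x (coshift D f y)" .
qed

lemma shift_basis:
  assumes "j \<in> I" shows "shift D f (b j) = (if j \<in> D then b (f j) else \<zero>\<^bsub>M\<^esub>)"
proof
  fix i
  have bj: "b j \<in> carrier M" using assms by simp
  show "shift D f (b j) i = (if j \<in> D then b (f j) else \<zero>\<^bsub>M\<^esub>) i"
  proof (cases "i \<in> f ` D")
    case True
    then obtain l where "l \<in> D" "i = f l" by auto
    thus ?thesis using inj bj by (auto simp: shift_image free_basis_def free_simps(2) inj_on_eq_iff)
  next
    case False
    thus ?thesis using bj by (auto simp: shift_outside) (auto simp: free_basis_def free_simps(2))
  qed
qed

lemma coshift_basis_image: assumes "j \<in> D" shows "coshift D f (b (f j)) = b j"
proof
  fix i
  have bj: "b (f j) \<in> carrier M" using assms D by auto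
  show "coshift D f (b (f j)) i = b j i"
    using inj assms by (auto simp: coshift_apply[OF bj]) (auto simp: free_basis_def inj_on_eq_iff)
qed

lemma coshift_basis_outside: assumes "i \<in> I" "i \<notin> f ` D" shows "coshift D f (b i) = \<zero>\<^bsub>M\<^esub>"
proof
  fix l
  have bi: "b i \<in> carrier M" using assms by auto
  show "coshift D f (b i) l = \<zero>\<^bsub>M\<^esub> l"
    using assms by (auto simp: coshift_apply[OF bi] free_simps(2)) (auto simp: free_basis_def)
qed

end

end

lemma (in graded_free_endos) shift_adj_part:
  assumes D: "D \<subseteq> I" "f ` D \<subseteq> I" "inj_on f D" and deg: "\<And>j. j \<in> D \<Longrightarrow> deg (f j) = deg j + k"
  shows "shift D f \<in> adj_part k"
proof -
  have "shift D f x \<in> mpart (n + k)" if x: "x \<in> mpart n" for x n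
  proof -
    have xc: "x \<in> carrier M" using x by (rule mpart_carrier)
    have "deg i = n + k" if i: "shift D f x i \<noteq> \<zero>" for i
    proof -
      have "i \<in> f ` D" using i shift_outside[OF D xc] by blast
      then obtain j where j: "j \<in> D" "i = f j" by auto
      hence "x j \<noteq> \<zero>" using i shift_image[OF D xc] by auto
      thus ?thesis using x j deg by (auto simp: mpart_def)
    qed
    thus ?thesis using shift_closed[OF D xc] by (simp add: mpart_def)
  qed
  thus ?thesis using adjoint_shift[OF D] shift_End[OF D] by (auto simp: adj_part_def dpart_def)
qed

section \<open>Representations associated with Cuntz-Krieger systems\<close>

locale leavitt = wf_digraph G + cring R for G :: "('v, 'e) pre_digraph" and R :: "('r, 'm) ring_scheme"
begin

sublocale Q: algebra_presentation R "leavitt_gens G" "leavitt_rels G"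
  by unfold_locales

abbreviation "L \<equiv> leavitt_algebra R G"

definition cl :: "('r, ('v, 'e) leavitt_gen) alg_term \<Rightarrow> ('r, ('v, 'e) leavitt_gen) alg_term set" where
  "cl t = alg_cong R (leavitt_gens G) (leavitt_rels G) `` {t}"

abbreviation "V v \<equiv> cl (Gen (Vert v))"
abbreviation "Ed e \<equiv> cl (Gen (Edge e))"
abbreviation "Gh e \<equiv> cl (Gen (Ghost e))"

lemma L_eq: "L = Q.P"
  by (simp add: leavitt_algebra_def)

sublocale L: assoc_algebra R L
  unfolding L_eq by (rule Q.presented_assoc_algebra)

lemma gen_terms [simp]:
  "v \<in> verts G \<Longrightarrow> Gen (Vert v) \<in> Q.T" "e \<in> arcs G \<Longrightarrow> Gen (Edge e) \<in> Q.T" "e \<in> arcs G \<Longrightarrow> Gen (Ghost e) \<in> Q.T"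
  by (auto intro!: alg_terms.Gen simp: leavitt_gens_def)

lemma cl_closed [simp]: "t \<in> Q.T \<Longrightarrow> cl t \<in> carrier L"
  unfolding L_eq cl_def by (rule Q.cls_closed)

lemma cl_simps:
  "cl Zero = \<zero>\<^bsub>L\<^esub>" "s \<in> Q.T \<Longrightarrow> t \<in> Q.T \<Longrightarrow> cl (Add s t) = cl s \<oplus>\<^bsub>L\<^esub> cl t"
  "s \<in> Q.T \<Longrightarrow> t \<in> Q.T \<Longrightarrow> cl (Mul s t) = cl s \<otimes>\<^bsub>L\<^esub> cl t"
  "a \<in> carrier R \<Longrightarrow> s \<in> Q.T \<Longrightarrow> cl (Scal a s) = a \<odot>\<^bsub>L\<^esub> cl s"
  unfolding L_eq cl_def by (simp_all add: Q.cls_simps)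

lemma cl_rel:
  assumes "(s, t) \<in> leavitt_rels G" "s \<in> Q.T" "t \<in> Q.T" shows "cl s = cl t"
  unfolding cl_def by (rule Q.cls_eqI[OF alg_cong.rel[OF assms]])

lemma L_rels:
  "v \<in> verts G \<Longrightarrow> V v \<otimes>\<^bsub>L\<^esub> V v = V v"
  "v \<in> verts G \<Longrightarrow> w \<in> verts G \<Longrightarrow> v \<noteq> w \<Longrightarrow> V v \<otimes>\<^bsub>L\<^esub> V w = \<zero>\<^bsub>L\<^esub>"
  "e \<in> arcs G \<Longrightarrow> V (tail G e) \<otimes>\<^bsub>L\<^esub> Ed e = Ed e"
  "e \<in> arcs G \<Longrightarrow> Ed e \<otimes>\<^bsub>L\<^esub> V (head G e) = Ed e"
  "e \<in> arcs G \<Longrightarrow> V (head G e) \<otimes>\<^bsub>L\<^esub> Gh e = Gh e"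
  "e \<in> arcs G \<Longrightarrow> Gh e \<otimes>\<^bsub>L\<^esub> V (tail G e) = Gh e"
  "e \<in> arcs G \<Longrightarrow> Gh e \<otimes>\<^bsub>L\<^esub> Ed e = V (head G e)"
  "e \<in> arcs G \<Longrightarrow> f \<in> arcs G \<Longrightarrow> e \<noteq> f \<Longrightarrow> Gh e \<otimes>\<^bsub>L\<^esub> Ed f = \<zero>\<^bsub>L\<^esub>"
  by (simp_all add: cl_rel[OF leavitt_rels.idem] cl_rel[OF leavitt_rels.orth] cl_rel[OF leavitt_rels.source_edge]
      cl_rel[OF leavitt_rels.edge_range] cl_rel[OF leavitt_rels.range_ghost] cl_rel[OF leavitt_rels.ghost_source]
      cl_rel[OF leavitt_rels.CK1_same] cl_rel[OF leavitt_rels.CK1_diff] alg_terms.intros flip: cl_simps)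

lemma CK2_sum:
  assumes "set es \<subseteq> arcs G" "distinct es"
  shows "foldr (\<lambda>e t. Add (Mul (Gen (Edge e)) (Gen (Ghost e))) t) es Zero \<in> Q.T"
    and "cl (foldr (\<lambda>e t. Add (Mul (Gen (Edge e)) (Gen (Ghost e))) t) es Zero) = (\<Oplus>\<^bsub>L\<^esub>e\<in>set es. Ed e \<otimes>\<^bsub>L\<^esub> Gh e)"
  using assms
proof (induction es)
  case (Cons e es)
  {
    case 1 thus ?case using Cons by (auto intro!: alg_terms.intros simp: leavitt_gens_def)
  next
    case 2
    have "(\<lambda>e. Ed e \<otimes>\<^bsub>L\<^esub> Gh e) \<in> set es \<rightarrow> carrier L" using 2 by auto
    thus ?case using Cons 2 by (simp add: cl_simps alg_terms.Mul L.M.finsum_insert)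
  }
qed (simp_all add: alg_terms.Zero cl_simps)

lemma L_CK2:
  assumes v: "regular_vertex G v"
  shows "V v = (\<Oplus>\<^bsub>L\<^esub>e\<in>out_arcs G v. Ed e \<otimes>\<^bsub>L\<^esub> Gh e)"
proof -
  obtain es where es: "set es = out_arcs G v" "distinct es"
    using v finite_distinct_list by (auto simp: regular_vertex_def)
  hence sub: "set es \<subseteq> arcs G" by auto
  show ?thesis using cl_rel[OF leavitt_rels.CK2[OF v es(2,1)]] CK2_sum[OF sub es(2)] v es(1)
    by (simp add: regular_vertex_def)
qed

text \<open>The recursive calls of \<open>path_term\<close> and \<open>path_star_term\<close> keep
  the vertex \<open>u\<close>, although the remaining path starts elsewhere. This is harmless
  because \<open>u\<close> enters the term only for the empty path.\<close>

lemma path_term_source: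
  "(path_term (u, f # q) :: ('r, ('v, 'e) leavitt_gen) alg_term) = path_term (u', f # q)"
  "(path_star_term (u, f # q) :: ('r, ('v, 'e) leavitt_gen) alg_term) = path_star_term (u', f # q)"
proof -
  show "(path_term (u, f # q) :: ('r, ('v, 'e) leavitt_gen) alg_term) = path_term (u', f # q)" by (induction q arbitrary: f) auto
  show "(path_star_term (u, f # q) :: ('r, ('v, 'e) leavitt_gen) alg_term) = path_star_term (u', f # q)" by (induction q arbitrary: f) auto
qed

lemma path_terms:
  assumes "\<alpha> \<in> gpaths G" shows "path_term \<alpha> \<in> Q.T" "path_star_term \<alpha> \<in> Q.T"
proof -
  obtain u p where \<alpha>: "\<alpha> = (u, p)" by (cases \<alpha>)
  have "path_term (u, p) \<in> Q.T \<and> path_star_term (u, p) \<in> Q.T" using assms unfolding \<alpha>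
  proof (induction p arbitrary: u)
    case (Cons e p)
    thus ?case using path_term_source[of u _ _ "head G e"]
      by (cases p) (auto intro: alg_terms.Mul)
  qed simp
  thus "path_term \<alpha> \<in> Q.T" "path_star_term \<alpha> \<in> Q.T" by (auto simp: \<alpha>)
qed

lemma leavitt_monomial_eq:
  "\<alpha> \<in> gpaths G \<Longrightarrow> \<beta> \<in> gpaths G \<Longrightarrow>
    leavitt_monomial R G \<alpha> \<beta> = cl (path_term \<alpha>) \<otimes>\<^bsub>L\<^esub> cl (path_star_term \<beta>)"
  by (simp add: leavitt_monomial_def path_terms flip: cl_simps(3)) (simp add: cl_def)

text \<open>A uniform recursion in the quotient. For \<open>p = []\<close> the terms differ by a
  vertex factor, which the range relations for edges and ghosts absorb.\<close>

lemma cl_path_Cons: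
  assumes "(u, e # p) \<in> gpaths G"
  shows "cl (path_term (u, e # p)) = Ed e \<otimes>\<^bsub>L\<^esub> cl (path_term (head G e, p))"
    "cl (path_star_term (u, e # p)) = cl (path_star_term (head G e, p)) \<otimes>\<^bsub>L\<^esub> Gh e"
proof -
  have e: "e \<in> arcs G" "(head G e, p) \<in> gpaths G" using assms by auto
  have "cl (path_term (u, e # p)) = Ed e \<otimes>\<^bsub>L\<^esub> cl (path_term (head G e, p)) \<and>
    cl (path_star_term (u, e # p)) = cl (path_star_term (head G e, p)) \<otimes>\<^bsub>L\<^esub> Gh e"
  proof (cases p)
    case (Cons f q)
    thus ?thesis using e path_terms[OF e(2)] path_term_source[of u f q "head G e"] by (simp add: cl_simps)
  qed (use e in \<open>simp add: L_rels\<close>)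
  thus "cl (path_term (u, e # p)) = Ed e \<otimes>\<^bsub>L\<^esub> cl (path_term (head G e, p))"
    "cl (path_star_term (u, e # p)) = cl (path_star_term (head G e, p)) \<otimes>\<^bsub>L\<^esub> Gh e" by auto
qed

end

locale ck_rep = leavitt G R + A: assoc_algebra R A
  for G :: "('v, 'e) pre_digraph" and R :: "('r, 'm) ring_scheme" and A :: "('r, 'a) module" +
  fixes star S
  assumes star: "involution_on R A star" and CK: "cuntz_krieger_system G A star S"
begin

definition gen_image :: "('v, 'e) leavitt_gen \<Rightarrow> 'a" where
  "gen_image x = (case x of Vert v \<Rightarrow> S (v, []) | Edge e \<Rightarrow> S (edge_path G e) | Ghost e \<Rightarrow> star (S (edge_path G e)))"

lemma gen_image_simps [simp]:
  "gen_image (Vert v) = S (v, [])" "gen_image (Edge e) = S (edge_path G e)" 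
  "gen_image (Ghost e) = star (S (edge_path G e))"
  by (simp_all add: gen_image_def)

lemma S_closed [simp]: "\<alpha> \<in> gpaths G \<Longrightarrow> S \<alpha> \<in> carrier A"
  using CK by (simp add: cuntz_krieger_system_def)

lemma star_closed [simp]: "x \<in> carrier A \<Longrightarrow> star x \<in> carrier A"
  using star by (simp add: involution_on_def)

lemma star_mult: "x \<in> carrier A \<Longrightarrow> y \<in> carrier A \<Longrightarrow> star (x \<otimes>\<^bsub>A\<^esub> y) = star y \<otimes>\<^bsub>A\<^esub> star x"
  using star by (simp add: involution_on_def)

lemma S_append:
  "\<alpha> \<in> gpaths G \<Longrightarrow> \<beta> \<in> gpaths G \<Longrightarrow> path_range G \<alpha> = path_source \<beta> \<Longrightarrow> S (path_append \<alpha> \<beta>) = S \<alpha> \<otimes>\<^bsub>A\<^esub> S \<beta>"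
  using CK by (simp add: cuntz_krieger_system_def)

lemma S_Cons:
  assumes "(u, e # p) \<in> gpaths G"
  shows "S (u, e # p) = S (edge_path G e) \<otimes>\<^bsub>A\<^esub> S (head G e, p)"
  using S_append[of "edge_path G e" "(head G e, p)"] assms by (simp add: path_append_def)

lemma gen_image_closed: "gen_image \<in> leavitt_gens G \<rightarrow> carrier A"
  by (auto simp: leavitt_gens_def)

text \<open>The two relations between ghosts and vertices are not among the axioms of a
  Cuntz-Krieger system. They arise by applying \<open>star\<close> to the relations for edges, since
  \<open>star\<close> reverses products and fixes the images of vertices.\<close>

lemma gen_image_rels:
  assumes "(s, t) \<in> leavitt_rels G" 
  shows "alg_eval A gen_image s = alg_eval A gen_image t"
  using assms
proof cases
  case (range_ghost e)
  have "star (S (edge_path G e) \<otimes>\<^bsub>A\<^esub> S (head G e, [])) = star (S (edge_path G e))"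
    using CK range_ghost by (simp add: cuntz_krieger_system_def)
  thus ?thesis using CK range_ghost by (simp add: star_mult) (simp add: cuntz_krieger_system_def)
next
  case (ghost_source e)
  have "star (S (tail G e, []) \<otimes>\<^bsub>A\<^esub> S (edge_path G e)) = star (S (edge_path G e))"
    using CK ghost_source by (simp add: cuntz_krieger_system_def)
  thus ?thesis using CK ghost_source by (simp add: star_mult) (simp add: cuntz_krieger_system_def)
next
  case (CK2 v es)
  have "set es \<subseteq> arcs G \<Longrightarrow> distinct es \<Longrightarrow>
    alg_eval A gen_image (foldr (\<lambda>e t. Add (Mul (Gen (Edge e)) (Gen (Ghost e))) t) es Zero) =
      (\<Oplus>\<^bsub>A\<^esub>e\<in>set es. S (edge_path G e) \<otimes>\<^bsub>A\<^esub> star (S (edge_path G e)))" for es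
  proof (induction es)
    case (Cons e es)
    have "(\<lambda>e. S (edge_path G e) \<otimes>\<^bsub>A\<^esub> star (S (edge_path G e))) \<in> set es \<rightarrow> carrier A"
      using Cons by auto
    thus ?case using Cons by (simp add: A.M.finsum_insert)
  qed simp
  moreover have "set es \<subseteq> arcs G" using CK2 by auto
  ultimately show ?thesis using CK CK2 by (simp add: cuntz_krieger_system_def)
qed (use CK in \<open>simp_all add: cuntz_krieger_system_def\<close>)

lemma hom_path:
  assumes h: "h \<in> alg_hom R L A" "\<And>x. x \<in> leavitt_gens G \<Longrightarrow> h (cl (Gen x)) = gen_image x"
    and "\<alpha> \<in> gpaths G"
  shows "h (cl (path_term \<alpha>)) = S \<alpha> \<and> h (cl (path_star_term \<alpha>)) = star (S \<alpha>)"
proof -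
  obtain u p where \<alpha>: "\<alpha> = (u, p)" by (cases \<alpha>)
  have m: "x \<in> carrier L \<Longrightarrow> y \<in> carrier L \<Longrightarrow> h (x \<otimes>\<^bsub>L\<^esub> y) = h x \<otimes>\<^bsub>A\<^esub> h y" for x y
    using h(1) by (simp add: alg_hom_def)
  have g: "v \<in> verts G \<Longrightarrow> h (V v) = S (v, [])" "e \<in> arcs G \<Longrightarrow> h (Ed e) = S (edge_path G e)"
    "e \<in> arcs G \<Longrightarrow> h (Gh e) = star (S (edge_path G e))" for v e
    using h(2) by (simp_all add: leavitt_gens_def)
  show ?thesis using assms(3) unfolding \<alpha>
  proof (induction p arbitrary: u)
    case Nil
    thus ?case using CK by (simp add: g) (simp add: cuntz_krieger_system_def)
  next
    case (Cons e p)
    have e: "e \<in> arcs G" "(head G e, p) \<in> gpaths G" using Cons.prems by auto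
    show ?case unfolding cl_path_Cons[OF Cons.prems] S_Cons[OF Cons.prems]
      using Cons.IH[OF e(2)] e path_terms[OF e(2)] by (simp add: m g star_mult)
  qed
qed

text \<open>Each generator is a monomial: a vertex is paired with itself, an edge with its range,
  and the range with a ghost. So prescribing monomials amounts to prescribing generators, where the
  universal property applies.\<close>

lemma associated_rep_iff:
  "associated_rep R G A star S h \<longleftrightarrow>
     h \<in> alg_hom R L A \<and> (\<forall>x\<in>leavitt_gens G. h (cl (Gen x)) = gen_image x)"
proof (intro iffI conjI ballI)
  assume h: "associated_rep R G A star S h"
  show "h \<in> alg_hom R L A" using h by (simp add: associated_rep_def)
  have mono: "h (cl (path_term \<alpha>) \<otimes>\<^bsub>L\<^esub> cl (path_star_term \<beta>)) = S \<alpha> \<otimes>\<^bsub>A\<^esub> star (S \<beta>)"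
    if "\<alpha> \<in> gpaths G" "\<beta> \<in> gpaths G" "path_range G \<alpha> = path_range G \<beta>" for \<alpha> \<beta>
    using h that by (simp add: associated_rep_def leavitt_monomial_eq)
  have sv: "v \<in> verts G \<Longrightarrow> star (S (v, [])) = S (v, [])" for v
    using CK by (simp add: cuntz_krieger_system_def)
  fix x assume "x \<in> leavitt_gens G"
  then consider (v) v where "v \<in> verts G" "x = Vert v" | (e) e where "e \<in> arcs G" "x = Edge e"
    | (g) e where "e \<in> arcs G" "x = Ghost e" by (auto simp: leavitt_gens_def)
  thus "h (cl (Gen x)) = gen_image x"
  proof cases
    case v
    thus ?thesis using mono[of "(v, [])" "(v, [])"] CK
      by (simp add: L_rels sv) (simp add: cuntz_krieger_system_def)
  next
    case e
    thus ?thesis using mono[of "edge_path G e" "(head G e, [])"] CK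
      by (simp add: L_rels sv) (simp add: cuntz_krieger_system_def)
  next
    case g
    have "S (head G e, []) \<otimes>\<^bsub>A\<^esub> star (S (edge_path G e)) = star (S (edge_path G e))"
      using gen_image_rels[OF leavitt_rels.range_ghost[OF g(1)]] by simp
    thus ?thesis using g mono[of "(head G e, [])" "edge_path G e"]
      by (simp add: L_rels)
  qed
next
  assume h: "h \<in> alg_hom R L A \<and> (\<forall>x\<in>leavitt_gens G. h (cl (Gen x)) = gen_image x)"
  have m: "x \<in> carrier L \<Longrightarrow> y \<in> carrier L \<Longrightarrow> h (x \<otimes>\<^bsub>L\<^esub> y) = h x \<otimes>\<^bsub>A\<^esub> h y" for x y
    using h by (simp add: alg_hom_def)
  show "associated_rep R G A star S h"
    using h hom_path[of h] path_terms by (simp add: associated_rep_def leavitt_monomial_eq m)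
qed

theorem associated_rep_unique:
  "\<exists>!\<Phi>. \<Phi> \<in> extensional (carrier L) \<and> associated_rep R G A star S \<Phi>"
  using Q.presented_universal[OF A.assoc_algebra_axioms gen_image_closed gen_image_rels]
  unfolding associated_rep_iff L_eq cl_def by blast

end

section \<open>The Cuntz-Krieger system on trails\<close>

locale trail_rep = wf_digraph G + cring R for G :: "('v, 'e) pre_digraph" and R :: "('r, 'm) ring_scheme"
begin

sublocale X: graded_free_endos R "ap_trails G \<times> UNIV" snd
  by unfold_locales

lemma trail_module_eq: "trail_module R G = X.M"
  by (simp add: trail_module_def)

lemma degree_part_eq: "degree_part R G k = X.dpart k"
proof -
  have "trail_module_part R G n = X.mpart n" for n
    by (auto simp: trail_module_part_def X.mpart_def trail_module_eq)
  thus ?thesis by (simp add: degree_part_def X.dpart_def trail_module_eq)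
qed

definition prepend_dom :: "('v, 'e) gpath \<Rightarrow> (('v, 'e) gtrail \<times> int) set" where
  "prepend_dom \<alpha> = {\<tau> \<in> ap_trails G. path_range G \<alpha> = trail_source G \<tau>} \<times> UNIV"

definition prepend :: "('v, 'e) gpath \<Rightarrow> ('v, 'e) gtrail \<times> int \<Rightarrow> ('v, 'e) gtrail \<times> int" where
  "prepend \<alpha> = (\<lambda>(\<tau>, n). (trail_append \<alpha> \<tau>, int (path_length \<alpha>) + n))"

definition S :: "('v, 'e) gpath \<Rightarrow> (('v, 'e) gtrail \<times> int \<Rightarrow> 'r) \<Rightarrow> ('v, 'e) gtrail \<times> int \<Rightarrow> 'r" where
  "S = (\<lambda>\<alpha>\<in>gpaths G. X.shift (prepend_dom \<alpha>) (prepend \<alpha>))"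

lemma prepend_facts:
  assumes "\<alpha> \<in> gpaths G"
  shows "prepend_dom \<alpha> \<subseteq> ap_trails G \<times> UNIV" "prepend \<alpha> ` prepend_dom \<alpha> \<subseteq> ap_trails G \<times> UNIV" "inj_on (prepend \<alpha>) (prepend_dom \<alpha>)"
  using assms by (auto simp: prepend_dom_def prepend_def trail_append_ap_trails inj_on_def intro: trail_append_inj_trail)

lemma S_adj_part: "\<alpha> \<in> gpaths G \<Longrightarrow> S \<alpha> \<in> X.adj_part (int (path_length \<alpha>))"
  unfolding S_def by (simp, rule X.shift_adj_part[OF prepend_facts]) (auto simp: prepend_def)

lemma S_closed: "\<alpha> \<in> gpaths G \<Longrightarrow> S \<alpha> \<in> X.graded_adj"
  using S_adj_part X.graded_adj.hom by blast

lemma S_End: "\<alpha> \<in> gpaths G \<Longrightarrow> S \<alpha> \<in> carrier X.End"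
  using S_closed X.graded_adj_End by blast

lemma adj_S: "\<alpha> \<in> gpaths G \<Longrightarrow> X.adj (S \<alpha>) = X.coshift (prepend_dom \<alpha>) (prepend \<alpha>)"
  by (simp add: S_def) (rule X.adjE[OF X.adjoint_shift[OF prepend_facts]])

lemma adj_S_End: "\<alpha> \<in> gpaths G \<Longrightarrow> X.adj (S \<alpha>) \<in> carrier X.End"
  by (simp add: adj_S X.coshift_End[OF prepend_facts])

lemma adj_S_closed: "\<alpha> \<in> gpaths G \<Longrightarrow> X.adj (S \<alpha>) \<in> X.graded_adj"
  using X.A_involution S_closed by (auto simp: involution_on_def)

lemma S_basis:
  assumes "\<alpha> \<in> gpaths G" "\<tau> \<in> ap_trails G"
  shows "S \<alpha> (X.b (\<tau>, n)) = (if path_range G \<alpha> = trail_source G \<tau>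
     then X.b (trail_append \<alpha> \<tau>, int (path_length \<alpha>) + n) else \<zero>\<^bsub>X.M\<^esub>)"
  using assms by (simp add: S_def X.shift_basis[OF prepend_facts]) (simp add: prepend_dom_def prepend_def)

lemma adj_S_basis:
  assumes "\<alpha> \<in> gpaths G" "\<tau> \<in> ap_trails G" "path_range G \<alpha> = trail_source G \<tau>"
  shows "X.adj (S \<alpha>) (X.b (trail_append \<alpha> \<tau>, n)) = X.b (\<tau>, n - int (path_length \<alpha>))"
proof -
  have "(\<tau>, n - int (path_length \<alpha>)) \<in> prepend_dom \<alpha>" using assms by (simp add: prepend_dom_def)
  from X.coshift_basis_image[OF prepend_facts[OF assms(1)] this] show ?thesis
    by (simp add: adj_S assms prepend_def)
qed

lemma adj_S_basis_zero:
  assumes "\<alpha> \<in> gpaths G" "\<tau> \<in> ap_trails G"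
    and "\<And>\<tau>'. \<tau>' \<in> ap_trails G \<Longrightarrow> path_range G \<alpha> = trail_source G \<tau>' \<Longrightarrow> \<tau> \<noteq> trail_append \<alpha> \<tau>'"
  shows "X.adj (S \<alpha>) (X.b (\<tau>, n)) = \<zero>\<^bsub>X.M\<^esub>"
  unfolding adj_S[OF assms(1)]
  by (rule X.coshift_basis_outside[OF prepend_facts[OF assms(1)]])
     (use assms(2,3) in \<open>auto simp: prepend_dom_def prepend_def\<close>)

lemma trail_system_S: "trail_system R G S"
  by (simp add: trail_system_def trail_basis_def trail_module_eq S_basis)

lemma S_unique:
  assumes "U \<in> extensional (gpaths G)" "\<And>\<alpha>. \<alpha> \<in> gpaths G \<Longrightarrow> U \<alpha> \<in> carrier X.End" "trail_system R G U"
  shows "U = S"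
proof (rule extensionalityI[OF assms(1)])
  show "S \<in> extensional (gpaths G)" by (simp add: S_def)
  fix \<alpha> assume \<alpha>: "\<alpha> \<in> gpaths G"
  show "U \<alpha> = S \<alpha>"
    by (rule X.linear_ext[OF assms(2)[OF \<alpha>] S_End[OF \<alpha>]])
       (use assms(3) \<alpha> in \<open>auto simp: trail_system_def trail_basis_def trail_module_eq S_basis\<close>)
qed

lemma End_mult_apply: "x \<in> carrier X.M \<Longrightarrow> (T \<otimes>\<^bsub>X.End\<^esub> U) x = T (U x)"
  by (simp add: X.F.End_alg_simps)

lemma S_path_append:
  assumes "\<alpha> \<in> gpaths G" "\<beta> \<in> gpaths G" "path_range G \<alpha> = path_source \<beta>"
  shows "S (path_append \<alpha> \<beta>) = S \<alpha> \<otimes>\<^bsub>X.End\<^esub> S \<beta>"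
proof (rule X.linear_ext)
  have \<alpha>\<beta>: "path_append \<alpha> \<beta> \<in> gpaths G" using assms by (rule path_append_gpaths)
  show "S (path_append \<alpha> \<beta>) \<in> carrier X.End" by (rule S_End[OF \<alpha>\<beta>])
  show "S \<alpha> \<otimes>\<^bsub>X.End\<^esub> S \<beta> \<in> carrier X.End" using assms by (simp add: S_End)
  fix i assume "i \<in> ap_trails G \<times> (UNIV :: int set)"
  then obtain \<tau> n where i: "i = (\<tau>, n)" "\<tau> \<in> ap_trails G" by auto
  show "S (path_append \<alpha> \<beta>) (X.b i) = (S \<alpha> \<otimes>\<^bsub>X.End\<^esub> S \<beta>) (X.b i)"
  proof (cases "path_range G \<beta> = trail_source G \<tau>")
    case True
    thus ?thesis using assms i \<alpha>\<beta> path_range_path_append[of \<alpha> \<beta>]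
      by (simp add: End_mult_apply S_basis trail_append_ap_trails trail_source_append trail_append_path_append)
         (simp add: path_append_def add.assoc)
  next
    case False
    thus ?thesis using assms i \<alpha>\<beta> path_range_path_append[of \<alpha> \<beta>] X.F.End_algE(4)[OF S_End]
      by (simp add: End_mult_apply S_basis)
  qed
qed

lemma edge_trail_eqD:
  assumes "e \<in> arcs G" "f \<in> arcs G" "trail_source G \<tau> = head G e" "trail_source G \<tau>' = head G f"
    and "trail_append (tail G e, [e]) \<tau> = trail_append (tail G f, [f]) \<tau>'"
  shows "e = f"
proof -
  have "(tail G e, [e]) = (tail G f, [f])"
    by (rule trail_append_inj_path[OF _ _ _ _ assms(5)]) (use assms(1-4) in simp_all)
  thus ?thesis by simp
qed

text \<open>Each summand is the projection onto the basis elements whose trail begins with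
  \<open>e\<close>. A trail from \<open>v\<close> begins with exactly one edge emitted by
  \<open>v\<close>, because a regular vertex is not a sink.\<close>

lemma S_CK2:
  assumes v: "regular_vertex G v"
  shows "S (v, []) = (\<Oplus>\<^bsub>X.A\<^esub>e\<in>out_arcs G v. S (edge_path G e) \<otimes>\<^bsub>X.A\<^esub> X.adj (S (edge_path G e)))"
    (is "_ = finsum X.A ?f ?O")
proof (rule X.linear_ext)
  have vG: "(v, []) \<in> gpaths G" and fin: "finite ?O" using v by (simp_all add: regular_vertex_def)
  have e: "edge_path G e \<in> gpaths G" "e \<in> arcs G" "tail G e = v" if "e \<in> ?O" for e
    using that by simp_all
  have f: "?f \<in> ?O \<rightarrow> X.graded_adj"
  proof (rule Pi_I)
    fix x assume "x \<in> ?O"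
    from e(1)[OF this] show "?f x \<in> X.graded_adj"
      by (simp only: X.A_simps) (rule X.graded_adj_mult[OF S_closed adj_S_closed])
  qed
  show "S (v, []) \<in> carrier X.End" using vG by (rule S_End)
  show "finsum X.A ?f ?O \<in> carrier X.End"
    using X.A.M.finsum_closed[of ?f ?O] f X.graded_adj_End by simp
  fix i assume "i \<in> ap_trails G \<times> (UNIV :: int set)"
  then obtain \<tau> n where i: "i = (\<tau>, n)" "\<tau> \<in> ap_trails G" by auto
  have bi: "X.b i \<in> carrier X.M" using i by simp
  have "finsum X.A ?f ?O (X.b i) = (\<Oplus>\<^bsub>X.M\<^esub>e\<in>?O. ?f e (X.b i))"
    using f bi by (rule X.A_finsum_apply)
  also have "\<dots> = (\<Oplus>\<^bsub>X.M\<^esub>e\<in>?O. S (edge_path G e) (X.adj (S (edge_path G e)) (X.b i)))"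
    by (simp add: End_mult_apply[OF bi])
  also have "\<dots> = S (v, []) (X.b i)"
    using i(2)
  proof (cases rule: ap_trail_cases)
    \<comment> \<open>A trail of length zero begins with no edge, so every summand kills it. The
      left side kills it too, as \<open>u\<close> differs from the regular vertex
      \<open>v\<close>.\<close>
    case (sink u)
    have "X.adj (S (edge_path G e)) (X.b i) = \<zero>\<^bsub>X.M\<^esub>" if "e \<in> ?O" for e
      unfolding i(1)
    proof (rule adj_S_basis_zero[OF e(1)[OF that] i(2)])
      fix \<tau>' show "\<tau> \<noteq> trail_append (edge_path G e) \<tau>'"
        using sink by (cases \<tau>') (auto simp: path_append_def)
    qed
    hence "(\<Oplus>\<^bsub>X.M\<^esub>e\<in>?O. S (edge_path G e) (X.adj (S (edge_path G e)) (X.b i))) = \<zero>\<^bsub>X.M\<^esub>"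
      using X.F.End_algE(4)[OF S_End[OF e(1)]] by (intro X.F.M.add.finprod_one_eqI) simp
    moreover have "u \<noteq> v" using sink v by (auto simp: is_sink_def regular_vertex_def)
    ultimately show ?thesis using vG i sink by (simp add: S_basis)
  next
    case (edge e0 \<tau>')
    have src: "trail_source G \<tau> = tail G e0" using edge by (simp add: trail_source_append)
    \<comment> \<open>Removing \<open>e\<close> and prepending it again fixes trails that begin with
      \<open>e\<close>, including the superscript, and kills those that begin with another
      edge.\<close>
    have t: "S (edge_path G e) (X.adj (S (edge_path G e)) (X.b i)) = (if e0 = e then X.b i else \<zero>\<^bsub>X.M\<^esub>)"
      if eO: "e \<in> ?O" for e
    proof (cases "e0 = e")
      case True
      thus ?thesis using edge e[OF eO] by (simp add: i(1) adj_S_basis S_basis)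
    next
      case False
      have "X.adj (S (edge_path G e)) (X.b i) = \<zero>\<^bsub>X.M\<^esub>"
        unfolding i(1)
      proof (rule adj_S_basis_zero[OF e(1)[OF eO] i(2)])
        fix \<tau>'' assume "path_range G (edge_path G e) = trail_source G \<tau>''"
        thus "\<tau> \<noteq> trail_append (edge_path G e) \<tau>''"
          using False edge_trail_eqD[of e0 e \<tau>' \<tau>''] edge e[OF eO] by auto
      qed
      thus ?thesis using False X.F.End_algE(4)[OF S_End[OF e(1)[OF eO]]] by simp
    qed
    have "(\<Oplus>\<^bsub>X.M\<^esub>e\<in>?O. S (edge_path G e) (X.adj (S (edge_path G e)) (X.b i))) =
        (\<Oplus>\<^bsub>X.M\<^esub>e\<in>?O. if e0 = e then X.b i else \<zero>\<^bsub>X.M\<^esub>)"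
      by (rule X.F.M.finsum_cong') (use t bi in auto)
    also have "\<dots> = S (v, []) (X.b i)"
    proof (cases "tail G e0 = v")
      case True
      hence "(\<Oplus>\<^bsub>X.M\<^esub>e\<in>?O. if e0 = e then X.b i else \<zero>\<^bsub>X.M\<^esub>) = X.b i"
        using edge(1) fin bi by (intro X.F.M.finsum_singleton) auto
      thus ?thesis using True src vG i by (simp add: S_basis trail_append_Nil')
    next
      case False
      hence "(\<Oplus>\<^bsub>X.M\<^esub>e\<in>?O. if e0 = e then X.b i else \<zero>\<^bsub>X.M\<^esub>) = \<zero>\<^bsub>X.M\<^esub>"
        by (intro X.F.M.add.finprod_one_eqI) auto
      thus ?thesis using False src vG i by (simp add: S_basis)
    qed
    finally show ?thesis .
  qed
  finally show "S (v, []) (X.b i) = finsum X.A ?f ?O (X.b i)" by simp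
qed

text \<open>Idempotence of vertices and the relations between a vertex and an edge are instances of
  multiplicativity on paths. The relations with an adjoint and the orthogonality of vertices are
  compared on basis elements.\<close>

lemma cuntz_krieger_S: "cuntz_krieger_system G X.A X.adj S"
  unfolding cuntz_krieger_system_def
proof (intro conjI ballI allI impI)
  fix \<alpha> assume "\<alpha> \<in> gpaths G" thus "S \<alpha> \<in> carrier X.A" by (simp add: S_closed)
next
  fix v assume "v \<in> verts G"
  hence v: "(v, []) \<in> gpaths G" by simp
  show "S (v, []) \<otimes>\<^bsub>X.A\<^esub> S (v, []) = S (v, [])"
    using S_path_append[OF v v] by (simp add: path_append_def)
  show "X.adj (S (v, [])) = S (v, [])"
  proof (rule X.linear_ext[OF adj_S_End[OF v] S_End[OF v]])
    fix i assume "i \<in> ap_trails G \<times> (UNIV :: int set)"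
    then obtain \<tau> n where i: "i = (\<tau>, n)" "\<tau> \<in> ap_trails G" by auto
    show "X.adj (S (v, [])) (X.b i) = S (v, []) (X.b i)"
    proof (cases "v = trail_source G \<tau>")
      case True
      thus ?thesis using adj_S_basis[OF v i(2), of n] i v by (simp add: S_basis trail_append_Nil')
    next
      case False
      have "X.adj (S (v, [])) (X.b (\<tau>, n)) = \<zero>\<^bsub>X.M\<^esub>"
        by (rule adj_S_basis_zero[OF v i(2)]) (use False in \<open>auto simp: trail_append_Nil'\<close>)
      thus ?thesis using False i v by (simp add: S_basis)
    qed
  qed
next
  fix v w assume vw: "v \<in> verts G" "w \<in> verts G" "v \<noteq> w"
  show "S (v, []) \<otimes>\<^bsub>X.A\<^esub> S (w, []) = \<zero>\<^bsub>X.A\<^esub>" unfolding X.A_simps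
  proof (rule X.linear_ext)
    fix i assume "i \<in> ap_trails G \<times> (UNIV :: int set)"
    then obtain \<tau> n where i: "i = (\<tau>, n)" "\<tau> \<in> ap_trails G" by auto
    have "S (v, []) \<zero>\<^bsub>X.M\<^esub> = \<zero>\<^bsub>X.M\<^esub>" using vw by (simp add: X.F.End_algE(4) S_End)
    thus "(S (v, []) \<otimes>\<^bsub>X.End\<^esub> S (w, [])) (X.b i) = \<zero>\<^bsub>X.End\<^esub> (X.b i)"
      using i vw by (auto simp: End_mult_apply S_basis trail_append_Nil' X.F.End_alg_simps(1))
  qed (use vw in \<open>simp_all add: S_End\<close>)
next
  fix e assume e: "e \<in> arcs G"
  hence ep: "edge_path G e \<in> gpaths G" "(tail G e, []) \<in> gpaths G" "(head G e, []) \<in> gpaths G" by auto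
  show "S (tail G e, []) \<otimes>\<^bsub>X.A\<^esub> S (edge_path G e) = S (edge_path G e)"
    using S_path_append[OF ep(2,1)] by (simp add: path_append_def)
  show "S (edge_path G e) \<otimes>\<^bsub>X.A\<^esub> S (head G e, []) = S (edge_path G e)"
    using S_path_append[OF ep(1,3)] by (simp add: path_append_def)
  show "X.adj (S (edge_path G e)) \<otimes>\<^bsub>X.A\<^esub> S (edge_path G e) = S (head G e, [])" unfolding X.A_simps
  proof (rule X.linear_ext)
    fix i assume "i \<in> ap_trails G \<times> (UNIV :: int set)"
    then obtain \<tau> n where i: "i = (\<tau>, n)" "\<tau> \<in> ap_trails G" by auto
    show "(X.adj (S (edge_path G e)) \<otimes>\<^bsub>X.End\<^esub> S (edge_path G e)) (X.b i) = S (head G e, []) (X.b i)"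
      using i ep X.F.End_algE(4)[OF adj_S_End[OF ep(1)]]
      by (cases "head G e = trail_source G \<tau>") (simp_all add: End_mult_apply S_basis adj_S_basis trail_append_Nil')
  qed (use ep in \<open>simp_all add: S_End adj_S_End\<close>)
next
  fix e f assume ef: "e \<in> arcs G" "f \<in> arcs G" "e \<noteq> f"
  hence ep: "edge_path G e \<in> gpaths G" "edge_path G f \<in> gpaths G" by auto
  show "X.adj (S (edge_path G e)) \<otimes>\<^bsub>X.A\<^esub> S (edge_path G f) = \<zero>\<^bsub>X.A\<^esub>" unfolding X.A_simps
  proof (rule X.linear_ext)
    fix i assume "i \<in> ap_trails G \<times> (UNIV :: int set)"
    then obtain \<tau> n where i: "i = (\<tau>, n)" "\<tau> \<in> ap_trails G" by auto
    have "X.adj (S (edge_path G e)) (S (edge_path G f) (X.b i)) = \<zero>\<^bsub>X.M\<^esub>"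
    proof (cases "head G f = trail_source G \<tau>")
      case True
      have "X.adj (S (edge_path G e)) (X.b (trail_append (edge_path G f) \<tau>, 1 + n)) = \<zero>\<^bsub>X.M\<^esub>"
      proof (rule adj_S_basis_zero[OF ep(1)])
        show "trail_append (edge_path G f) \<tau> \<in> ap_trails G"
          using True i ep by (intro trail_append_ap_trails) auto
        fix \<tau>' assume "path_range G (edge_path G e) = trail_source G \<tau>'"
        thus "trail_append (edge_path G f) \<tau> \<noteq> trail_append (edge_path G e) \<tau>'"
          using edge_trail_eqD[of f e \<tau> \<tau>'] ef True by auto
      qed
      thus ?thesis using True i ep by (simp add: S_basis)
    next
      case False
      thus ?thesis using i ep X.F.End_algE(4)[OF adj_S_End[OF ep(1)]] by (simp add: S_basis)
    qed
    thus "(X.adj (S (edge_path G e)) \<otimes>\<^bsub>X.End\<^esub> S (edge_path G f)) (X.b i) = \<zero>\<^bsub>X.End\<^esub> (X.b i)"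
      using i by (simp add: End_mult_apply X.F.End_alg_simps(1))
  qed (use ep in \<open>simp_all add: S_End adj_S_End\<close>)
next
  fix v assume "regular_vertex G v"
  thus "S (v, []) = (\<Oplus>\<^bsub>X.A\<^esub>e\<in>out_arcs G v. S (edge_path G e) \<otimes>\<^bsub>X.A\<^esub> X.adj (S (edge_path G e)))"
    by (rule S_CK2)
next
  fix \<alpha> \<beta> assume "\<alpha> \<in> gpaths G" "\<beta> \<in> gpaths G" "path_range G \<alpha> = path_source \<beta>"
  thus "S (path_append \<alpha> \<beta>) = S \<alpha> \<otimes>\<^bsub>X.A\<^esub> S \<beta>" by (simp add: S_path_append)
qed

end

section \<open>Injectivity\<close>

lemma (in wf_digraph) ap_trail_source: "\<tau> \<in> ap_trails G \<Longrightarrow> trail_source G \<tau> \<in> verts G"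
  by (erule ap_trail_cases) (simp_all add: is_sink_def trail_source_append)

section \<open>Levels, local units and decompositions in the Leavitt path algebra\<close>

context leavitt
begin

abbreviation "pt \<alpha> \<equiv> cl (path_term \<alpha>)"

lemma pt_closed [simp]: "\<alpha> \<in> gpaths G \<Longrightarrow> pt \<alpha> \<in> carrier L"
  by (simp add: path_terms)

lemma ghost_vertex:
  assumes e: "e \<in> arcs G" "v \<in> verts G"
  shows "Gh e \<otimes>\<^bsub>L\<^esub> V v = (if tail G e = v then Gh e else \<zero>\<^bsub>L\<^esub>)"
proof (cases "tail G e = v")
  case True
  thus ?thesis using e L_rels(6)[of e] by simp
next
  case False
  have "Gh e \<otimes>\<^bsub>L\<^esub> V v = (Gh e \<otimes>\<^bsub>L\<^esub> V (tail G e)) \<otimes>\<^bsub>L\<^esub> V v" using e by (simp add: L_rels(6))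
  also have "\<dots> = Gh e \<otimes>\<^bsub>L\<^esub> (V (tail G e) \<otimes>\<^bsub>L\<^esub> V v)" using e by (intro L.mult_assoc) auto
  also have "\<dots> = \<zero>\<^bsub>L\<^esub>" using e False by (simp add: L_rels(2))
  finally show ?thesis using False by simp
qed

lemma path_vertex:
  assumes "\<alpha> \<in> gpaths G" "v \<in> verts G"
  shows "pt \<alpha> \<otimes>\<^bsub>L\<^esub> V v = (if path_range G \<alpha> = v then pt \<alpha> else \<zero>\<^bsub>L\<^esub>)"
proof -
  obtain u p where \<alpha>: "\<alpha> = (u, p)" by (cases \<alpha>)
  show ?thesis using assms unfolding \<alpha>
  proof (induction p arbitrary: u)
    case Nil thus ?case by (simp add: L_rels)
  next
    case (Cons e p)
    hence e: "e \<in> arcs G" "(head G e, p) \<in> gpaths G" by auto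
    show ?case unfolding cl_path_Cons(1)[OF Cons.prems(1)]
      using Cons.IH[OF e(2) Cons.prems(2)] e Cons.prems(2) by (simp add: L.mult_assoc)
  qed
qed

lemma path_edge:
  assumes "\<alpha> \<in> gpaths G" "f \<in> arcs G"
  shows "pt \<alpha> \<otimes>\<^bsub>L\<^esub> Ed f = (if path_range G \<alpha> = tail G f then pt (path_append \<alpha> (edge_path G f)) else \<zero>\<^bsub>L\<^esub>)"
proof -
  obtain u p where \<alpha>: "\<alpha> = (u, p)" by (cases \<alpha>)
  have "pt (u, p) \<otimes>\<^bsub>L\<^esub> Ed f = (if path_range G (u, p) = tail G f then pt (u, p @ [f]) else \<zero>\<^bsub>L\<^esub>)"
    using assms(1) unfolding \<alpha>
  proof (induction p arbitrary: u)
    case Nil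
    have "V u \<otimes>\<^bsub>L\<^esub> Ed f = V u \<otimes>\<^bsub>L\<^esub> V (tail G f) \<otimes>\<^bsub>L\<^esub> Ed f"
      using Nil assms(2) by (simp add: L.mult_assoc L_rels(3))
    thus ?case using Nil assms(2) by (cases "u = tail G f") (simp_all add: L_rels)
  next
    case (Cons e p)
    hence e: "e \<in> arcs G" "(head G e, p) \<in> gpaths G" by auto
    have *: "(u, e # p @ [f]) \<in> gpaths G" if "path_range G (head G e, p) = tail G f"
      using Cons.prems that assms(2) by (simp add: gpaths_append)
    show ?case unfolding cl_path_Cons(1)[OF Cons.prems(1)]
      using Cons.IH[OF e(2)] e assms(2) cl_path_Cons(1)[OF *] by (simp add: L.mult_assoc)
  qed
  thus ?thesis by (simp add: \<alpha> path_append_def)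
qed

text \<open>
  \<open>level n\<close> is the span of the monomials \<open>\<alpha>\<beta>\<^sup>*\<close> with \<open>\<beta>\<close> of length at most \<open>n\<close>. Multiplication by
  an edge on the right lowers the level.
\<close>

inductive level :: "nat \<Rightarrow> ('r, ('v, 'e) leavitt_gen) alg_term set \<Rightarrow> bool" where
  zero: "level n \<zero>\<^bsub>L\<^esub>"
| path: "\<alpha> \<in> gpaths G \<Longrightarrow> level n (pt \<alpha>)"
| add: "level n x \<Longrightarrow> level n y \<Longrightarrow> level n (x \<oplus>\<^bsub>L\<^esub> y)"
| smult: "a \<in> carrier R \<Longrightarrow> level n x \<Longrightarrow> level n (a \<odot>\<^bsub>L\<^esub> x)"
| ghost: "level n x \<Longrightarrow> e \<in> arcs G \<Longrightarrow> level (Suc n) (x \<otimes>\<^bsub>L\<^esub> Gh e)"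

lemma level_closed: "level n x \<Longrightarrow> x \<in> carrier L"
  by (induction rule: level.induct) auto

lemma level_mono: "level n x \<Longrightarrow> n \<le> m \<Longrightarrow> level m x"
proof (induction arbitrary: m rule: level.induct)
  case (ghost n x e)
  then obtain m' where "m = Suc m'" "n \<le> m'" by (cases m) auto
  thus ?case using ghost by (auto intro: level.ghost)
qed (auto intro: level.intros)

text \<open>Serves \<open>level_edge\<close>, where cancelling a ghost against its edge leaves a
  vertex on the right.\<close>

lemma level_vertex: 
  assumes "level n x" "v \<in> verts G" shows "level n (x \<otimes>\<^bsub>L\<^esub> V v)"
  using assms
proof (induction rule: level.induct)
  case (ghost n x e)
  have "x \<otimes>\<^bsub>L\<^esub> Gh e \<otimes>\<^bsub>L\<^esub> V v = x \<otimes>\<^bsub>L\<^esub> (if tail G e = v then Gh e else \<zero>\<^bsub>L\<^esub>)"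
    using ghost level_closed by (simp add: L.mult_assoc ghost_vertex del: if_split_asm)
  thus ?case using ghost level_closed by (auto intro: level.intros)
qed (auto simp: path_vertex L.distrib_right L.smult_mult_left level_closed intro: level.intros)

lemma ghost_edge: "e \<in> arcs G \<Longrightarrow> f \<in> arcs G \<Longrightarrow> Gh e \<otimes>\<^bsub>L\<^esub> Ed f = (if e = f then V (head G e) else \<zero>\<^bsub>L\<^esub>)"
  by (simp add: L_rels(7,8))

text \<open>An edge either extends a path or meets the last ghost, which it cancels or annihilates.
  The subtraction is truncated, so level \<open>0\<close> is stable under right multiplication by
  edges.\<close>

lemma level_edge: 
  assumes "level n x" "f \<in> arcs G" shows "level (n - 1) (x \<otimes>\<^bsub>L\<^esub> Ed f)"
  using assms
proof (induction rule: level.induct)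
  case (path \<alpha> n)
  thus ?case using path_append_gpaths[of \<alpha> "edge_path G f"]
    by (auto simp: path_edge intro: level.intros)
next
  case (ghost n x e)
  have "x \<otimes>\<^bsub>L\<^esub> Gh e \<otimes>\<^bsub>L\<^esub> Ed f = x \<otimes>\<^bsub>L\<^esub> (if e = f then V (head G e) else \<zero>\<^bsub>L\<^esub>)"
    using ghost level_closed by (simp add: L.mult_assoc ghost_edge)
  thus ?case using ghost level_closed level_vertex by (auto intro: level.intros)
qed (auto simp: L.distrib_right L.smult_mult_left level_closed intro: level.intros)

lemma level_add_ex: "level n x \<Longrightarrow> level m y \<Longrightarrow> \<exists>k. level k (x \<oplus>\<^bsub>L\<^esub> y)"
  using level_mono[of n x "max n m"] level_mono[of m y "max n m"] level.add by fastforce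

lemma cl_Neg: assumes "s \<in> Q.T" shows "cl (Neg s) = \<ominus>\<^bsub>R\<^esub> \<one>\<^bsub>R\<^esub> \<odot>\<^bsub>L\<^esub> cl s"
proof -
  have "(Add (Neg s) s, Zero) \<in> Q.C" using assms by (rule alg_cong.Add_Neg)
  hence "cl (Add (Neg s) s) = cl Zero" unfolding cl_def by (rule Q.cls_eqI)
  hence "cl (Neg s) \<oplus>\<^bsub>L\<^esub> cl s = \<zero>\<^bsub>L\<^esub>" using assms by (simp add: cl_simps alg_terms.Neg)
  hence "\<ominus>\<^bsub>L\<^esub> cl s = cl (Neg s)" by (rule L.M.minus_equality) (use assms in \<open>simp_all add: alg_terms.Neg\<close>)
  thus ?thesis using assms by (simp add: L.smult_minus_one)
qed

text \<open>The monomials span, proved on terms. The second conjunct strengthens the induction: the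
  class of \<open>Mul s t\<close> is reached by multiplying on the right by \<open>s\<close> and
  then by \<open>t\<close>.\<close>

lemma term_level:
  assumes "t \<in> Q.T"
  shows "(\<exists>m. level m (cl t)) \<and> (\<forall>n x. level n x \<longrightarrow> (\<exists>m. level m (x \<otimes>\<^bsub>L\<^esub> cl t)))"
  using assms
proof (induction t rule: alg_terms.induct)
  case (Gen g)
  then consider (v) v where "v \<in> verts G" "g = Vert v" | (e) e where "e \<in> arcs G" "g = Edge e"
    | (g) e where "e \<in> arcs G" "g = Ghost e" by (auto simp: leavitt_gens_def)
  thus ?case
  proof cases
    case v
    thus ?thesis using level_vertex level.path[of "(v, [])" 0] by auto
  next
    case e
    thus ?thesis using level_edge level.path[of "edge_path G e" 0] by auto
  next
    case g
    have "level (Suc 0) (Gh e)" using level.ghost[OF level.path[of "(head G e, [])" 0] g(1)] g by (simp add: L_rels)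
    thus ?thesis using g level.ghost by (auto simp: L_rels)
  qed
next
  case Zero
  thus ?case using level.zero level_closed by (auto simp: cl_simps)
next
  case (Neg s)
  show ?case
  proof (intro conjI allI impI)
    show "\<exists>m. level m (cl (Neg s))" using Neg by (auto simp: cl_Neg intro: level.smult)
    fix n x assume x: "level n x"
    have "x \<otimes>\<^bsub>L\<^esub> cl (Neg s) = \<ominus>\<^bsub>R\<^esub> \<one>\<^bsub>R\<^esub> \<odot>\<^bsub>L\<^esub> (x \<otimes>\<^bsub>L\<^esub> cl s)"
      using Neg x level_closed by (simp add: cl_Neg L.smult_mult_right)
    moreover obtain m where "level m (x \<otimes>\<^bsub>L\<^esub> cl s)" using Neg x by blast
    ultimately show "\<exists>m. level m (x \<otimes>\<^bsub>L\<^esub> cl (Neg s))" using level.smult[of "\<ominus>\<^bsub>R\<^esub> \<one>\<^bsub>R\<^esub>"] by auto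
  qed
next
  case (Add s t)
  show ?case
  proof (intro conjI allI impI)
    show "\<exists>m. level m (cl (Add s t))" using Add by (auto simp: cl_simps intro: level_add_ex)
    fix n x assume x: "level n x"
    have "x \<otimes>\<^bsub>L\<^esub> cl (Add s t) = x \<otimes>\<^bsub>L\<^esub> cl s \<oplus>\<^bsub>L\<^esub> x \<otimes>\<^bsub>L\<^esub> cl t"
      using Add x level_closed by (simp add: cl_simps L.distrib_left)
    thus "\<exists>m. level m (x \<otimes>\<^bsub>L\<^esub> cl (Add s t))" using Add x level_add_ex by metis
  qed
next
  case (Mul s t)
  show ?case
  proof (intro conjI allI impI)
    show "\<exists>m. level m (cl (Mul s t))" using Mul by (auto simp: cl_simps)
    fix n x assume x: "level n x"
    have "x \<otimes>\<^bsub>L\<^esub> cl (Mul s t) = x \<otimes>\<^bsub>L\<^esub> cl s \<otimes>\<^bsub>L\<^esub> cl t"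
      using Mul x level_closed by (simp add: cl_simps L.mult_assoc)
    thus "\<exists>m. level m (x \<otimes>\<^bsub>L\<^esub> cl (Mul s t))" using Mul x by metis
  qed
next
  case (Scal a s)
  show ?case
  proof (intro conjI allI impI)
    show "\<exists>m. level m (cl (Scal a s))" using Scal by (auto simp: cl_simps intro: level.smult)
    fix n x assume x: "level n x"
    have "x \<otimes>\<^bsub>L\<^esub> cl (Scal a s) = a \<odot>\<^bsub>L\<^esub> (x \<otimes>\<^bsub>L\<^esub> cl s)"
      using Scal x level_closed by (simp add: cl_simps L.smult_mult_right)
    moreover obtain m where "level m (x \<otimes>\<^bsub>L\<^esub> cl s)" using Scal x by blast
    ultimately show "\<exists>m. level m (x \<otimes>\<^bsub>L\<^esub> cl (Scal a s))" using level.smult[OF Scal(1)] by auto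
  qed
qed

lemma level_exists: assumes "x \<in> carrier L" obtains n where "level n x"
proof -
  obtain t where "t \<in> Q.T" "x = cl t" using assms unfolding L_eq cl_def by (rule Q.carrierE)
  thus ?thesis using term_level that by blast
qed

lemma vertex_sum_unit:
  assumes x: "x \<in> carrier L" and w: "w \<in> F" "x \<otimes>\<^bsub>L\<^esub> V w = x" and F: "finite F" "F \<subseteq> verts G"
  shows "x \<otimes>\<^bsub>L\<^esub> (\<Oplus>\<^bsub>L\<^esub>v\<in>F. V v) = x"
proof -
  have t: "x \<otimes>\<^bsub>L\<^esub> V v = (if w = v then x else \<zero>\<^bsub>L\<^esub>)" if "v \<in> F" for v
  proof (cases "w = v")
    case False
    have "x \<otimes>\<^bsub>L\<^esub> V v = x \<otimes>\<^bsub>L\<^esub> (V w \<otimes>\<^bsub>L\<^esub> V v)"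
      using w that F x by (subst w(2)[symmetric], subst L.mult_assoc) auto
    also have "V w \<otimes>\<^bsub>L\<^esub> V v = \<zero>\<^bsub>L\<^esub>" by (rule L_rels(2)) (use False w that F in auto)
    also have "x \<otimes>\<^bsub>L\<^esub> \<zero>\<^bsub>L\<^esub> = \<zero>\<^bsub>L\<^esub>" using x by simp
    finally show ?thesis using False by simp
  qed (use w in simp)
  have "x \<otimes>\<^bsub>L\<^esub> (\<Oplus>\<^bsub>L\<^esub>v\<in>F. V v) = (\<Oplus>\<^bsub>L\<^esub>v\<in>F. x \<otimes>\<^bsub>L\<^esub> V v)"
    by (rule L.finsum_mult_right) (use F x in auto)
  also have "\<dots> = (\<Oplus>\<^bsub>L\<^esub>v\<in>F. if w = v then x else \<zero>\<^bsub>L\<^esub>)"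
    by (rule L.M.finsum_cong') (use t x in auto)
  also have "\<dots> = x" by (rule L.M.finsum_singleton) (use F w x in auto)
  finally show ?thesis .
qed

text \<open>A right unit made of finitely many vertices. Quantifying over all finite supersets makes
  the notion compatible with addition: the union of two index sets works for both summands.\<close>

definition local_unit :: "'v set \<Rightarrow> ('r, ('v, 'e) leavitt_gen) alg_term set \<Rightarrow> bool" where
  "local_unit F x \<longleftrightarrow> finite F \<and> F \<subseteq> verts G \<and>
     (\<forall>F'. finite F' \<longrightarrow> F \<subseteq> F' \<longrightarrow> F' \<subseteq> verts G \<longrightarrow> x \<otimes>\<^bsub>L\<^esub> (\<Oplus>\<^bsub>L\<^esub>v\<in>F'. V v) = x)"

lemma local_unitD:
  assumes "local_unit F x"
  shows "finite F" "F \<subseteq> verts G"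
    and "finite F' \<Longrightarrow> F \<subseteq> F' \<Longrightarrow> F' \<subseteq> verts G \<Longrightarrow> x \<otimes>\<^bsub>L\<^esub> (\<Oplus>\<^bsub>L\<^esub>v\<in>F'. V v) = x"
  using assms by (simp_all add: local_unit_def)

lemma vertex_sum_closed: "F \<subseteq> verts G \<Longrightarrow> (\<Oplus>\<^bsub>L\<^esub>v\<in>F. V v) \<in> carrier L"
  by (rule L.M.finsum_closed) auto

lemma local_unit_vertex:
  assumes "x \<in> carrier L" "w \<in> verts G" "x \<otimes>\<^bsub>L\<^esub> V w = x" shows "local_unit {w} x"
  unfolding local_unit_def using assms vertex_sum_unit[of x w] by simp

lemma level_local_unit:
  assumes "level n x" shows "\<exists>F. local_unit F x"
  using assms
proof (induction rule: level.induct)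
  case (zero n)
  have "local_unit {} \<zero>\<^bsub>L\<^esub>" by (simp add: local_unit_def vertex_sum_closed)
  thus ?case ..
next
  case (path \<alpha> n)
  have "local_unit {path_range G \<alpha>} (pt \<alpha>)"
    by (rule local_unit_vertex) (simp_all add: path path_range_verts path_vertex)
  thus ?case ..
next
  case (add n x y)
  then obtain F H where x: "local_unit F x" and y: "local_unit H y" by blast
  have "local_unit (F \<union> H) (x \<oplus>\<^bsub>L\<^esub> y)"
    unfolding local_unit_def using local_unitD[OF x] local_unitD[OF y] level_closed[OF add(1)] level_closed[OF add(2)]
    by (simp add: L.distrib_right vertex_sum_closed)
  thus ?case ..
next
  case (smult a n x)
  then obtain F where x: "local_unit F x" by blast
  have "local_unit F (a \<odot>\<^bsub>L\<^esub> x)"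
    unfolding local_unit_def using local_unitD[OF x] level_closed[OF smult(2)] smult(1)
    by (simp add: L.smult_mult_left vertex_sum_closed)
  thus ?case ..
next
  case (ghost n x e)
  have "local_unit {tail G e} (x \<otimes>\<^bsub>L\<^esub> Gh e)"
    by (rule local_unit_vertex) (use ghost(2) level_closed[OF ghost(1)] in \<open>simp_all add: L.mult_assoc L_rels\<close>)
  thus ?case ..
qed

text \<open>By its local unit \<open>x\<close> is a finite sum of products with vertices, so its
  vanishing can be tested one vertex at a time.\<close>

lemma zero_if_vertices_zero:
  assumes x: "x \<in> carrier L" and zero: "\<And>v. v \<in> verts G \<Longrightarrow> x \<otimes>\<^bsub>L\<^esub> V v = \<zero>\<^bsub>L\<^esub>"
  shows "x = \<zero>\<^bsub>L\<^esub>"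
proof -
  obtain n where "level n x" using x by (rule level_exists)
  then obtain F where F: "local_unit F x" using level_local_unit by blast
  have sub: "F \<subseteq> verts G" by (rule local_unitD(2)[OF F])
  have "x = x \<otimes>\<^bsub>L\<^esub> (\<Oplus>\<^bsub>L\<^esub>v\<in>F. V v)"
    using local_unitD(3)[OF F local_unitD(1)[OF F] _ sub] by simp
  also have "\<dots> = (\<Oplus>\<^bsub>L\<^esub>v\<in>F. x \<otimes>\<^bsub>L\<^esub> V v)"
    by (rule L.finsum_mult_right) (use sub x in auto)
  also have "\<dots> = \<zero>\<^bsub>L\<^esub>" using sub zero by (intro L.M.add.finprod_one_eqI) auto
  finally show ?thesis .
qed

text \<open>For finite \<open>F\<close> a right unit for elements that end in ghosts of edges in
  \<open>F\<close>. If \<open>F\<close> consists of all edges emitted by a regular vertex, this is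
  the vertex itself.\<close>

definition edge_proj :: "'e set \<Rightarrow> ('r, ('v, 'e) leavitt_gen) alg_term set" where
  "edge_proj F = (\<Oplus>\<^bsub>L\<^esub>e\<in>F. Ed e \<otimes>\<^bsub>L\<^esub> Gh e)"

lemma edge_proj_closed [simp]: "F \<subseteq> arcs G \<Longrightarrow> edge_proj F \<in> carrier L"
  unfolding edge_proj_def by (rule L.M.finsum_closed) auto

lemma mult_edge_proj:
  assumes "x \<in> carrier L" "F \<subseteq> arcs G"
  shows "x \<otimes>\<^bsub>L\<^esub> edge_proj F = (\<Oplus>\<^bsub>L\<^esub>e\<in>F. x \<otimes>\<^bsub>L\<^esub> Ed e \<otimes>\<^bsub>L\<^esub> Gh e)"
proof -
  have "x \<otimes>\<^bsub>L\<^esub> edge_proj F = (\<Oplus>\<^bsub>L\<^esub>e\<in>F. x \<otimes>\<^bsub>L\<^esub> (Ed e \<otimes>\<^bsub>L\<^esub> Gh e))"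
    unfolding edge_proj_def by (rule L.finsum_mult_right) (use assms in auto)
  also have "\<dots> = (\<Oplus>\<^bsub>L\<^esub>e\<in>F. x \<otimes>\<^bsub>L\<^esub> Ed e \<otimes>\<^bsub>L\<^esub> Gh e)"
    by (rule L.M.finsum_cong') (use assms in \<open>auto simp: L.mult_assoc\<close>)
  finally show ?thesis .
qed

text \<open>In the expansion of \<open>z\<close> through \<open>edge_proj F\<close>, right
  multiplication by \<open>v\<close> retains only the terms of edges that start at \<open>v\<close>,
  and these contain a factor assumed to be zero.\<close>

lemma edge_proj_vertex_zero:
  assumes z: "z \<in> carrier L" "z \<otimes>\<^bsub>L\<^esub> edge_proj F = z" and F: "F \<subseteq> arcs G" and v: "v \<in> verts G"
    and zero: "\<And>e. e \<in> F \<Longrightarrow> tail G e = v \<Longrightarrow> z \<otimes>\<^bsub>L\<^esub> Ed e = \<zero>\<^bsub>L\<^esub>"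
  shows "z \<otimes>\<^bsub>L\<^esub> V v = \<zero>\<^bsub>L\<^esub>"
proof -
  have "z \<otimes>\<^bsub>L\<^esub> V v = (\<Oplus>\<^bsub>L\<^esub>e\<in>F. z \<otimes>\<^bsub>L\<^esub> Ed e \<otimes>\<^bsub>L\<^esub> Gh e) \<otimes>\<^bsub>L\<^esub> V v"
    using mult_edge_proj[OF z(1) F] z(2) by simp
  also have "\<dots> = (\<Oplus>\<^bsub>L\<^esub>e\<in>F. z \<otimes>\<^bsub>L\<^esub> Ed e \<otimes>\<^bsub>L\<^esub> Gh e \<otimes>\<^bsub>L\<^esub> V v)"
    by (rule L.finsum_mult_left) (use F v z in auto)
  also have "\<dots> = \<zero>\<^bsub>L\<^esub>"
  proof (rule L.M.add.finprod_one_eqI)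
    fix e assume e: "e \<in> F"
    hence "z \<otimes>\<^bsub>L\<^esub> Ed e \<otimes>\<^bsub>L\<^esub> Gh e \<otimes>\<^bsub>L\<^esub> V v = z \<otimes>\<^bsub>L\<^esub> Ed e \<otimes>\<^bsub>L\<^esub> (if tail G e = v then Gh e else \<zero>\<^bsub>L\<^esub>)"
      using F v z by (subst L.mult_assoc) (auto simp: ghost_vertex)
    thus "z \<otimes>\<^bsub>L\<^esub> Ed e \<otimes>\<^bsub>L\<^esub> Gh e \<otimes>\<^bsub>L\<^esub> V v = \<zero>\<^bsub>L\<^esub>" using zero e F z by (auto split: if_splits)
  qed
  finally show ?thesis .
qed

text \<open>Every term of the expansion of \<open>z\<close> ends in the ghost of an edge other than
  \<open>f\<close>. In \<open>kernel_zero\<close>, \<open>f\<close> is the first edge of a trail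
  whose basis element \<open>z\<close> is to kill.\<close>

lemma edge_proj_edge_zero:
  assumes z: "z \<in> carrier L" "z \<otimes>\<^bsub>L\<^esub> edge_proj F = z" and F: "F \<subseteq> arcs G" and f: "f \<in> arcs G" "f \<notin> F"
  shows "z \<otimes>\<^bsub>L\<^esub> Ed f = \<zero>\<^bsub>L\<^esub>"
proof -
  have "z \<otimes>\<^bsub>L\<^esub> Ed f = (\<Oplus>\<^bsub>L\<^esub>e\<in>F. z \<otimes>\<^bsub>L\<^esub> Ed e \<otimes>\<^bsub>L\<^esub> Gh e) \<otimes>\<^bsub>L\<^esub> Ed f"
    using mult_edge_proj[OF z(1) F] z(2) by simp
  also have "\<dots> = (\<Oplus>\<^bsub>L\<^esub>e\<in>F. z \<otimes>\<^bsub>L\<^esub> Ed e \<otimes>\<^bsub>L\<^esub> Gh e \<otimes>\<^bsub>L\<^esub> Ed f)"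
    by (rule L.finsum_mult_left) (use F f z in auto)
  also have "\<dots> = \<zero>\<^bsub>L\<^esub>"
  proof (rule L.M.add.finprod_one_eqI)
    fix e assume e: "e \<in> F"
    hence "Gh e \<otimes>\<^bsub>L\<^esub> Ed f = \<zero>\<^bsub>L\<^esub>" using f F by (intro L_rels(8)) auto
    thus "z \<otimes>\<^bsub>L\<^esub> Ed e \<otimes>\<^bsub>L\<^esub> Gh e \<otimes>\<^bsub>L\<^esub> Ed f = \<zero>\<^bsub>L\<^esub>" 
      using e F z f by (subst L.mult_assoc) auto
  qed
  finally show ?thesis .
qed

lemma regular_vertex_zero:
  assumes x: "x \<in> carrier L" and v: "regular_vertex G v"
    and zero: "\<And>e. e \<in> arcs G \<Longrightarrow> x \<otimes>\<^bsub>L\<^esub> Ed e = \<zero>\<^bsub>L\<^esub>"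
  shows "x \<otimes>\<^bsub>L\<^esub> V v = \<zero>\<^bsub>L\<^esub>"
proof -
  have "out_arcs G v \<subseteq> arcs G" by auto
  hence "x \<otimes>\<^bsub>L\<^esub> V v = (\<Oplus>\<^bsub>L\<^esub>e\<in>out_arcs G v. x \<otimes>\<^bsub>L\<^esub> Ed e \<otimes>\<^bsub>L\<^esub> Gh e)"
    using mult_edge_proj[OF x] L_CK2[OF v] by (simp add: edge_proj_def)
  also have "\<dots> = \<zero>\<^bsub>L\<^esub>" using zero by (intro L.M.add.finprod_one_eqI) auto
  finally show ?thesis .
qed

lemma ghost_edge_proj:
  assumes x: "x \<in> carrier L" and F: "finite F" "e \<in> F" "F \<subseteq> arcs G"
  shows "x \<otimes>\<^bsub>L\<^esub> Gh e \<otimes>\<^bsub>L\<^esub> edge_proj F = x \<otimes>\<^bsub>L\<^esub> Gh e"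
proof -
  have e: "e \<in> arcs G" using F by auto
  have "x \<otimes>\<^bsub>L\<^esub> Gh e \<otimes>\<^bsub>L\<^esub> edge_proj F = (\<Oplus>\<^bsub>L\<^esub>f\<in>F. x \<otimes>\<^bsub>L\<^esub> Gh e \<otimes>\<^bsub>L\<^esub> Ed f \<otimes>\<^bsub>L\<^esub> Gh f)"
    by (rule mult_edge_proj) (use x e F in auto)
  also have "\<dots> = (\<Oplus>\<^bsub>L\<^esub>f\<in>F. if e = f then x \<otimes>\<^bsub>L\<^esub> Gh e else \<zero>\<^bsub>L\<^esub>)"
  proof (rule L.M.finsum_cong')
    fix f assume "f \<in> F"
    hence f: "f \<in> arcs G" using F by auto
    have "x \<otimes>\<^bsub>L\<^esub> Gh e \<otimes>\<^bsub>L\<^esub> Ed f \<otimes>\<^bsub>L\<^esub> Gh f = x \<otimes>\<^bsub>L\<^esub> ((Gh e \<otimes>\<^bsub>L\<^esub> Ed f) \<otimes>\<^bsub>L\<^esub> Gh f)"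
      using x e f by (simp add: L.mult_assoc)
    thus "x \<otimes>\<^bsub>L\<^esub> Gh e \<otimes>\<^bsub>L\<^esub> Ed f \<otimes>\<^bsub>L\<^esub> Gh f = (if e = f then x \<otimes>\<^bsub>L\<^esub> Gh e else \<zero>\<^bsub>L\<^esub>)"
      using x e f by (simp add: ghost_edge L_rels(5))
  qed (use x e in auto)
  also have "\<dots> = x \<otimes>\<^bsub>L\<^esub> Gh e" by (rule L.M.finsum_singleton) (use F x e in auto)
  finally show ?thesis .
qed

text \<open>Expresses that \<open>z\<close> ends in ghosts of edges of \<open>F\<close> without
  reference to a representation of \<open>z\<close> by monomials. The supersets serve addition, as
  in \<open>local_unit\<close>.\<close>

definition edge_unit :: "'e set \<Rightarrow> ('r, ('v, 'e) leavitt_gen) alg_term set \<Rightarrow> bool" where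
  "edge_unit F z \<longleftrightarrow> z \<in> carrier L \<and> finite F \<and> F \<subseteq> arcs G \<and>
     (\<forall>F'. finite F' \<longrightarrow> F \<subseteq> F' \<longrightarrow> F' \<subseteq> arcs G \<longrightarrow> z \<otimes>\<^bsub>L\<^esub> edge_proj F' = z)"

lemma edge_unitD:
  assumes "edge_unit F z"
  shows "z \<in> carrier L" "finite F" "F \<subseteq> arcs G" "z \<otimes>\<^bsub>L\<^esub> edge_proj F = z"
    and "finite F' \<Longrightarrow> F \<subseteq> F' \<Longrightarrow> F' \<subseteq> arcs G \<Longrightarrow> z \<otimes>\<^bsub>L\<^esub> edge_proj F' = z"
  using assms by (simp_all add: edge_unit_def)

text \<open>A path goes into \<open>p\<close> and a product ending in a ghost goes into
  \<open>z\<close>. Sums and multiples are split accordingly.\<close>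

lemma level_decomp:
  assumes "level n x"
  shows "\<exists>p z F. level 0 p \<and> edge_unit F z \<and> x = p \<oplus>\<^bsub>L\<^esub> z"
  using assms
proof (induction rule: level.induct)
  have unit0: "edge_unit {} \<zero>\<^bsub>L\<^esub>" by (simp add: edge_unit_def)
  {
    case (zero n)
    have "\<zero>\<^bsub>L\<^esub> = \<zero>\<^bsub>L\<^esub> \<oplus>\<^bsub>L\<^esub> \<zero>\<^bsub>L\<^esub>" by simp
    thus ?case using unit0 level.zero by blast
  next
    case (path \<alpha> n)
    hence "pt \<alpha> = pt \<alpha> \<oplus>\<^bsub>L\<^esub> \<zero>\<^bsub>L\<^esub>" by simp
    thus ?case using unit0 level.path[OF path] by blast
  next
    case (add n x y)
    obtain p z F where x: "level 0 p" "edge_unit F z" "x = p \<oplus>\<^bsub>L\<^esub> z" using add.IH(1) by blast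
    obtain q w H where y: "level 0 q" "edge_unit H w" "y = q \<oplus>\<^bsub>L\<^esub> w" using add.IH(2) by blast
    note c = level_closed[OF x(1)] level_closed[OF y(1)] edge_unitD[OF x(2)] edge_unitD[OF y(2)]
    have "x \<oplus>\<^bsub>L\<^esub> y = p \<oplus>\<^bsub>L\<^esub> q \<oplus>\<^bsub>L\<^esub> (z \<oplus>\<^bsub>L\<^esub> w)" using c unfolding x(3) y(3) by (simp add: L.M.a_ac)
    moreover have "edge_unit (F \<union> H) (z \<oplus>\<^bsub>L\<^esub> w)" using c by (simp add: edge_unit_def L.distrib_right)
    ultimately show ?case using level.add[OF x(1) y(1)] by blast
  next
    case (smult a n x)
    obtain p z F where x: "level 0 p" "edge_unit F z" "x = p \<oplus>\<^bsub>L\<^esub> z" using smult.IH by blast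
    note c = level_closed[OF x(1)] edge_unitD[OF x(2)] smult.hyps(1)
    have "a \<odot>\<^bsub>L\<^esub> x = a \<odot>\<^bsub>L\<^esub> p \<oplus>\<^bsub>L\<^esub> a \<odot>\<^bsub>L\<^esub> z" using c unfolding x(3) by (simp add: L.smult_r_distr)
    moreover have "edge_unit F (a \<odot>\<^bsub>L\<^esub> z)" using c by (simp add: edge_unit_def L.smult_mult_left)
    ultimately show ?case using level.smult[OF smult.hyps(1) x(1)] by blast
  next
    case (ghost n x e)
    have x: "x \<in> carrier L" using ghost level_closed by blast
    have "x \<otimes>\<^bsub>L\<^esub> Gh e = \<zero>\<^bsub>L\<^esub> \<oplus>\<^bsub>L\<^esub> (x \<otimes>\<^bsub>L\<^esub> Gh e)" using x ghost(2) by simp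
    moreover have "edge_unit {e} (x \<otimes>\<^bsub>L\<^esub> Gh e)" using x ghost(2) by (simp add: edge_unit_def ghost_edge_proj)
    ultimately show ?case using level.zero by blast
  }
qed

end

section \<open>Faithfulness of the representation on trails\<close>

context trail_rep
begin

sublocale leavitt G R ..

sublocale CK: ck_rep G R X.A X.adj S
  by unfold_locales (fact X.A_involution cuntz_krieger_S)+

context
  fixes h assumes rep: "associated_rep R G X.A X.adj S h"
begin

lemma rep_hom: "h \<in> alg_hom R L X.A"
  using rep CK.associated_rep_iff by blast

lemma rep_closed: "x \<in> carrier L \<Longrightarrow> h x \<in> X.graded_adj"
  using rep_hom by (auto simp: alg_hom_def)

lemma rep_End: "x \<in> carrier L \<Longrightarrow> h x \<in> carrier X.End"
  by (rule X.graded_adj_End[OF rep_closed])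

lemma rep_add: "x \<in> carrier L \<Longrightarrow> y \<in> carrier L \<Longrightarrow> z \<in> carrier X.M \<Longrightarrow> h (x \<oplus>\<^bsub>L\<^esub> y) z = h x z \<oplus>\<^bsub>X.M\<^esub> h y z"
  using rep_hom by (simp add: alg_hom_def X.F.End_alg_simps)

lemma rep_mult: "x \<in> carrier L \<Longrightarrow> y \<in> carrier L \<Longrightarrow> z \<in> carrier X.M \<Longrightarrow> h (x \<otimes>\<^bsub>L\<^esub> y) z = h x (h y z)"
  using rep_hom by (simp add: alg_hom_def X.F.End_alg_simps)

lemma rep_smult: "a \<in> carrier R \<Longrightarrow> x \<in> carrier L \<Longrightarrow> z \<in> carrier X.M \<Longrightarrow> h (a \<odot>\<^bsub>L\<^esub> x) z = a \<odot>\<^bsub>X.M\<^esub> h x z"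
  using rep_hom by (simp add: alg_hom_def X.F.End_alg_simps)

lemma rep_apply_closed: "x \<in> carrier L \<Longrightarrow> z \<in> carrier X.M \<Longrightarrow> h x z \<in> carrier X.M"
  using X.F.End_algE(1)[OF rep_End] by blast

lemma rep_zero: "z \<in> carrier X.M \<Longrightarrow> h \<zero>\<^bsub>L\<^esub> z = \<zero>\<^bsub>X.M\<^esub>"
  using rep_smult[of "\<zero>\<^bsub>R\<^esub>" "\<zero>\<^bsub>L\<^esub>" z] rep_apply_closed[of "\<zero>\<^bsub>L\<^esub>" z] by simp

lemma rep_path: "\<alpha> \<in> gpaths G \<Longrightarrow> h (pt \<alpha>) = S \<alpha>"
  using CK.hom_path[OF rep_hom] rep CK.associated_rep_iff by blast

lemma rep_basis:
  assumes "\<alpha> \<in> gpaths G" "\<tau> \<in> ap_trails G"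
  shows "h (pt \<alpha>) (X.b (\<tau>, n)) = (if path_range G \<alpha> = trail_source G \<tau>
     then X.b (trail_append \<alpha> \<tau>, int (path_length \<alpha>) + n) else \<zero>\<^bsub>X.M\<^esub>)"
  using assms by (simp add: rep_path S_basis)

text \<open>
  The paths with range \<open>v\<close> have linearly independent images already on one basis element: the
  second index of \<open>(\<alpha>\<tau>, l(\<alpha>))\<close> records the length of \<open>\<alpha>\<close>, so that this pair determines \<open>\<alpha>\<close>.
\<close>

lemma path_span_coeff:
  assumes "level 0 p" and \<tau>: "\<tau> \<in> ap_trails G" "trail_source G \<tau> = v"
  defines "B \<equiv> {\<alpha> \<in> gpaths G. path_range G \<alpha> = v}"
  shows "\<exists>A\<subseteq>B. p \<otimes>\<^bsub>L\<^esub> V v =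
    (\<Oplus>\<^bsub>L\<^esub>\<alpha>\<in>A. h p (X.b (\<tau>, 0)) (trail_append \<alpha> \<tau>, int (path_length \<alpha>)) \<odot>\<^bsub>L\<^esub> pt \<alpha>)"
proof -
  have v: "v \<in> verts G" using ap_trail_source[OF \<tau>(1)] \<tau>(2) by simp
  define c where "c = (\<lambda>p \<alpha>. h p (X.b (\<tau>, 0)) (trail_append \<alpha> \<tau>, int (path_length \<alpha>)))"
  define Q where "Q = (\<lambda>p A'. p \<otimes>\<^bsub>L\<^esub> V v = (\<Oplus>\<^bsub>L\<^esub>\<alpha>\<in>A'. c p \<alpha> \<odot>\<^bsub>L\<^esub> pt \<alpha>))"
  have b: "X.b (\<tau>, 0) \<in> carrier X.M" using \<tau> by simp
  have cc: "p \<in> carrier L \<Longrightarrow> c p \<alpha> \<in> carrier R" for p \<alpha>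
    unfolding c_def by (rule X.coeff_closed[OF rep_apply_closed[OF _ b]])
  have Bp: "\<alpha> \<in> gpaths G" if "\<alpha> \<in> A'" "A' \<subseteq> B" for \<alpha> A' using that by (auto simp: B_def)
  have summand_closed: "(\<lambda>\<alpha>. c p \<alpha> \<odot>\<^bsub>L\<^esub> pt \<alpha>) \<in> A' \<rightarrow> carrier L" if "p \<in> carrier L" "A' \<subseteq> B" for p A'
    using that cc Bp by (intro Pi_I L.smult_closed) auto
  \<comment> \<open>The expansion is demanded over every finite superset of \<open>A\<close> within
    \<open>B\<close>, so that the expansions of two summands can be taken over the union of their
    index sets.\<close>
  define good where "good = (\<lambda>p A. finite A \<and> A \<subseteq> B \<and> (\<forall>A'. finite A' \<longrightarrow> A \<subseteq> A' \<longrightarrow> A' \<subseteq> B \<longrightarrow> Q p A'))"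
  have goodD: "finite A" "A \<subseteq> B" "finite A' \<Longrightarrow> A \<subseteq> A' \<Longrightarrow> A' \<subseteq> B \<Longrightarrow> Q p A'" if "good p A" for p A A'
    using that by (simp_all add: good_def)
  have "\<exists>A. good p A"
    using assms(1)
  proof (induction "0::nat" p rule: level.induct)
    case zero
    have "Q \<zero>\<^bsub>L\<^esub> A'" if "A' \<subseteq> B" for A'
    proof -
      have "c \<zero>\<^bsub>L\<^esub> \<alpha> = \<zero>\<^bsub>R\<^esub>" for \<alpha> using b by (simp add: c_def rep_zero X.free_simps(2))
      hence "(\<Oplus>\<^bsub>L\<^esub>\<alpha>\<in>A'. c \<zero>\<^bsub>L\<^esub> \<alpha> \<odot>\<^bsub>L\<^esub> pt \<alpha>) = \<zero>\<^bsub>L\<^esub>"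
        using that Bp by (intro L.M.add.finprod_one_eqI) simp
      thus ?thesis using v by (simp add: Q_def)
    qed
    hence "good \<zero>\<^bsub>L\<^esub> {}" by (simp add: good_def)
    thus ?case ..
  next
    case (path \<beta>)
    show ?case
    proof (cases "path_range G \<beta> = v")
      case True
      have "Q (pt \<beta>) A'" if A': "finite A'" "{\<beta>} \<subseteq> A'" "A' \<subseteq> B" for A'
      proof -
        \<comment> \<open>The image of \<open>\<beta>\<close> is a single basis element, with index
          \<open>(trail_append \<beta> \<tau>, int (path_length \<beta>))\<close>. Agreement with
          the index for \<open>\<alpha>\<close> includes equality of lengths, so the paths can be
          cancelled.\<close>
        have c: "c (pt \<beta>) \<alpha> = (if \<beta> = \<alpha> then \<one>\<^bsub>R\<^esub> else \<zero>\<^bsub>R\<^esub>)" if "\<alpha> \<in> A'" for \<alpha>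
        proof -
          have \<alpha>: "\<alpha> \<in> gpaths G" "path_range G \<alpha> = trail_source G \<tau>" using that A' \<tau>(2) by (auto simp: B_def)
          have "h (pt \<beta>) (X.b (\<tau>, 0)) = X.b (trail_append \<beta> \<tau>, int (path_length \<beta>))"
            using path True \<tau> by (simp add: rep_basis)
          moreover have "\<beta> = \<alpha>" if "trail_append \<alpha> \<tau> = trail_append \<beta> \<tau>" "path_length \<alpha> = path_length \<beta>"
            using trail_append_inj_path[OF path \<alpha>(1) _ \<alpha>(2), of \<tau>] that True \<tau>(2) by simp
          ultimately show ?thesis by (auto simp: c_def free_basis_def)
        qed
        have "(\<Oplus>\<^bsub>L\<^esub>\<alpha>\<in>A'. c (pt \<beta>) \<alpha> \<odot>\<^bsub>L\<^esub> pt \<alpha>) = (\<Oplus>\<^bsub>L\<^esub>\<alpha>\<in>A'. if \<beta> = \<alpha> then pt \<alpha> else \<zero>\<^bsub>L\<^esub>)"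
          by (rule L.M.finsum_cong') (use c Bp A'(3) in \<open>simp_all add: Pi_iff\<close>)
        also have "\<dots> = pt \<beta>"
          by (rule L.M.finsum_singleton) (use A' Bp in \<open>simp_all add: Pi_iff\<close>)
        finally show ?thesis using path True v by (simp add: Q_def path_vertex)
      qed
      hence "good (pt \<beta>) {\<beta>}" using path True unfolding good_def by (simp add: B_def)
      thus ?thesis ..
    next
      case False
      have "Q (pt \<beta>) A'" if "A' \<subseteq> B" for A'
      proof -
        have "c (pt \<beta>) \<alpha> = \<zero>\<^bsub>R\<^esub>" for \<alpha> using path False \<tau> by (simp add: c_def rep_basis X.free_simps(2))
        hence "(\<Oplus>\<^bsub>L\<^esub>\<alpha>\<in>A'. c (pt \<beta>) \<alpha> \<odot>\<^bsub>L\<^esub> pt \<alpha>) = \<zero>\<^bsub>L\<^esub>"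
          using that Bp by (intro L.M.add.finprod_one_eqI) simp
        thus ?thesis using path False v by (simp add: Q_def path_vertex)
      qed
      hence "good (pt \<beta>) {}" by (simp add: good_def)
      thus ?thesis ..
    qed
  next
    case (add x y)
    obtain A1 A2 where "good x A1" "good y A2" using add(2,4) by blast
    note A1 = goodD[OF this(1)] and A2 = goodD[OF this(2)]
    have xy: "x \<in> carrier L" "y \<in> carrier L" using add level_closed by blast+
    have "Q (x \<oplus>\<^bsub>L\<^esub> y) A'" if A': "finite A'" "A1 \<union> A2 \<subseteq> A'" "A' \<subseteq> B" for A'
    proof -
      have "Q x A'" by (rule A1(3)) (use A' in simp_all)
      moreover have "Q y A'" by (rule A2(3)) (use A' in simp_all)
      ultimately have "(x \<oplus>\<^bsub>L\<^esub> y) \<otimes>\<^bsub>L\<^esub> V v = (\<Oplus>\<^bsub>L\<^esub>\<alpha>\<in>A'. c x \<alpha> \<odot>\<^bsub>L\<^esub> pt \<alpha>) \<oplus>\<^bsub>L\<^esub> (\<Oplus>\<^bsub>L\<^esub>\<alpha>\<in>A'. c y \<alpha> \<odot>\<^bsub>L\<^esub> pt \<alpha>)"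
        using xy v by (simp add: Q_def L.distrib_right)
      also have "\<dots> = (\<Oplus>\<^bsub>L\<^esub>\<alpha>\<in>A'. c x \<alpha> \<odot>\<^bsub>L\<^esub> pt \<alpha> \<oplus>\<^bsub>L\<^esub> c y \<alpha> \<odot>\<^bsub>L\<^esub> pt \<alpha>)"
        by (rule L.M.finsum_addf[symmetric]) (rule summand_closed[OF xy(1) A'(3)] summand_closed[OF xy(2) A'(3)])+
      also have "\<dots> = (\<Oplus>\<^bsub>L\<^esub>\<alpha>\<in>A'. c (x \<oplus>\<^bsub>L\<^esub> y) \<alpha> \<odot>\<^bsub>L\<^esub> pt \<alpha>)"
      proof (rule L.M.finsum_cong'[OF HOL.refl summand_closed[OF _ A'(3)]])
        fix \<alpha> assume "\<alpha> \<in> A'"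
        moreover have "c (x \<oplus>\<^bsub>L\<^esub> y) \<alpha> = c x \<alpha> \<oplus>\<^bsub>R\<^esub> c y \<alpha>"
          using xy b by (simp add: c_def rep_add X.free_simps(3))
        ultimately show "c x \<alpha> \<odot>\<^bsub>L\<^esub> pt \<alpha> \<oplus>\<^bsub>L\<^esub> c y \<alpha> \<odot>\<^bsub>L\<^esub> pt \<alpha> = c (x \<oplus>\<^bsub>L\<^esub> y) \<alpha> \<odot>\<^bsub>L\<^esub> pt \<alpha>"
          using xy cc Bp A' by (simp add: L.smult_l_distr)
      qed (use xy in simp)
      finally show ?thesis by (simp add: Q_def)
    qed
    hence "good (x \<oplus>\<^bsub>L\<^esub> y) (A1 \<union> A2)" using A1(1,2) A2(1,2) by (simp add: good_def)
    thus ?case ..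
  next
    case (smult a x)
    obtain A1 where "good x A1" using smult(3) by blast
    note A1 = goodD[OF this]
    have x: "x \<in> carrier L" using smult level_closed by blast
    have "Q (a \<odot>\<^bsub>L\<^esub> x) A'" if A': "finite A'" "A1 \<subseteq> A'" "A' \<subseteq> B" for A'
    proof -
      have "Q x A'" by (rule A1(3)) (use A' in simp_all)
      hence "(a \<odot>\<^bsub>L\<^esub> x) \<otimes>\<^bsub>L\<^esub> V v = a \<odot>\<^bsub>L\<^esub> (\<Oplus>\<^bsub>L\<^esub>\<alpha>\<in>A'. c x \<alpha> \<odot>\<^bsub>L\<^esub> pt \<alpha>)"
        using x v smult(1) by (simp add: Q_def L.smult_mult_left)
      also have "\<dots> = (\<Oplus>\<^bsub>L\<^esub>\<alpha>\<in>A'. a \<odot>\<^bsub>L\<^esub> (c x \<alpha> \<odot>\<^bsub>L\<^esub> pt \<alpha>))"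
        by (rule L.finsum_smult_ldistr[OF A'(1) smult(1) summand_closed[OF x A'(3)]])
      also have "\<dots> = (\<Oplus>\<^bsub>L\<^esub>\<alpha>\<in>A'. c (a \<odot>\<^bsub>L\<^esub> x) \<alpha> \<odot>\<^bsub>L\<^esub> pt \<alpha>)"
      proof (rule L.M.finsum_cong'[OF HOL.refl summand_closed[OF _ A'(3)]])
        fix \<alpha> assume "\<alpha> \<in> A'"
        moreover have "c (a \<odot>\<^bsub>L\<^esub> x) \<alpha> = a \<otimes>\<^bsub>R\<^esub> c x \<alpha>"
          using x b smult(1) by (simp add: c_def rep_smult X.free_simps(4))
        ultimately show "a \<odot>\<^bsub>L\<^esub> (c x \<alpha> \<odot>\<^bsub>L\<^esub> pt \<alpha>) = c (a \<odot>\<^bsub>L\<^esub> x) \<alpha> \<odot>\<^bsub>L\<^esub> pt \<alpha>"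
          using x cc Bp A' smult(1) by (simp add: L.smult_assoc1)
      qed (use x smult(1) in simp)
      finally show ?thesis by (simp add: Q_def)
    qed
    hence "good (a \<odot>\<^bsub>L\<^esub> x) A1" using A1(1,2) by (simp add: good_def)
    thus ?case ..
  qed
  then obtain A where "good p A" ..
  note A = goodD[OF this]
  have "Q p A" using A(3)[OF A(1) _ A(2)] by simp
  thus ?thesis using A(2) unfolding Q_def c_def by blast
qed

text \<open>All coefficients of the expansion in \<open>path_span_coeff\<close> are entries of the
  vector assumed to be zero. This carries vanishing in the representation back to
  \<open>L\<close>.\<close>

lemma path_span_vertex_zero:
  assumes p: "level 0 p" and \<tau>: "\<tau> \<in> ap_trails G" "trail_source G \<tau> = v"
    and zero: "h p (X.b (\<tau>, 0)) = \<zero>\<^bsub>X.M\<^esub>"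
  shows "p \<otimes>\<^bsub>L\<^esub> V v = \<zero>\<^bsub>L\<^esub>"
proof -
  obtain A where A: "A \<subseteq> {\<alpha> \<in> gpaths G. path_range G \<alpha> = v}"
    "p \<otimes>\<^bsub>L\<^esub> V v = (\<Oplus>\<^bsub>L\<^esub>\<alpha>\<in>A. h p (X.b (\<tau>, 0)) (trail_append \<alpha> \<tau>, int (path_length \<alpha>)) \<odot>\<^bsub>L\<^esub> pt \<alpha>)"
    using path_span_coeff[OF p \<tau>] by blast
  show ?thesis unfolding A(2) zero using A(1)
    by (intro L.M.add.finprod_one_eqI) (auto simp: X.free_simps(2) simp del: equalityI)
qed

lemma kernel_zero:
  assumes "level n x" "h x = \<zero>\<^bsub>X.End\<^esub>" shows "x = \<zero>\<^bsub>L\<^esub>"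
  using assms
proof (induction n arbitrary: x)
  case 0
  show ?case
  proof (rule zero_if_vertices_zero[OF level_closed[OF 0(1)]])
    fix v assume "v \<in> verts G"
    then obtain \<tau> where \<tau>: "\<tau> \<in> ap_trails G" "trail_source G \<tau> = v" by (rule ap_trail_from)
    show "x \<otimes>\<^bsub>L\<^esub> V v = \<zero>\<^bsub>L\<^esub>"
      by (rule path_span_vertex_zero[OF 0(1) \<tau>]) (use \<tau> 0(2) in \<open>simp add: X.F.End_alg_simps(1)\<close>)
  qed
next
  case (Suc n)
  have x: "x \<in> carrier L" by (rule level_closed[OF Suc.prems(1)])
  have hx: "h x b = \<zero>\<^bsub>X.M\<^esub>" if "b \<in> carrier X.M" for b
    using Suc.prems(2) that by (simp add: X.F.End_alg_simps(1))
  have xe: "x \<otimes>\<^bsub>L\<^esub> Ed e = \<zero>\<^bsub>L\<^esub>" if e: "e \<in> arcs G" for e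
  proof (rule Suc.IH)
    show "level n (x \<otimes>\<^bsub>L\<^esub> Ed e)" using level_edge[OF Suc.prems(1) e] by simp
    have "h (x \<otimes>\<^bsub>L\<^esub> Ed e) = h x \<otimes>\<^bsub>X.End\<^esub> h (Ed e)" using rep_hom x e by (simp add: alg_hom_def)
    thus "h (x \<otimes>\<^bsub>L\<^esub> Ed e) = \<zero>\<^bsub>X.End\<^esub>" using Suc.prems(2) rep_End e by simp
  qed
  show ?case
  proof (rule zero_if_vertices_zero[OF x])
    fix v assume v: "v \<in> verts G"
    show "x \<otimes>\<^bsub>L\<^esub> V v = \<zero>\<^bsub>L\<^esub>"
    proof (cases "regular_vertex G v")
      case True
      show ?thesis by (rule regular_vertex_zero[OF x True xe])
    next
      case False
      obtain p z F where "level 0 p" "edge_unit F z" "x = p \<oplus>\<^bsub>L\<^esub> z"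
        using level_decomp[OF Suc.prems(1)] by blast
      hence d: "level 0 p" "z \<in> carrier L" "x = p \<oplus>\<^bsub>L\<^esub> z" "finite F" "F \<subseteq> arcs G"
        "z \<otimes>\<^bsub>L\<^esub> edge_proj F = z" using edge_unitD by blast+
      have p: "p \<in> carrier L" by (rule level_closed[OF d(1)])
      \<comment> \<open>A trail from \<open>v\<close> is wanted whose basis element is killed by
        \<open>z\<close>. Since \<open>h x\<close> is zero, \<open>p\<close> then kills it as
        well.\<close>
      obtain \<tau> where \<tau>: "\<tau> \<in> ap_trails G" "trail_source G \<tau> = v" "h z (X.b (\<tau>, 0)) = \<zero>\<^bsub>X.M\<^esub>"
      proof (cases "out_arcs G v = {}")
        case True
        \<comment> \<open>At a sink no edge of \<open>F\<close> starts at \<open>v\<close>, so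
          \<open>z\<close> times \<open>v\<close> is zero. The vertex \<open>v\<close> fixes the
          basis element of this trail, which is therefore killed by \<open>z\<close>.\<close>
        let ?\<tau> = "FinTrail (v, [])"
        have ap: "?\<tau> \<in> ap_trails G" using True v by (simp add: ap_trails_FinTrail is_sink_def)
        have "z \<otimes>\<^bsub>L\<^esub> V v = \<zero>\<^bsub>L\<^esub>"
        proof (rule edge_proj_vertex_zero[OF d(2,6,5) v])
          fix e assume "e \<in> F" "tail G e = v"
          hence "e \<in> out_arcs G v" using d(5) by auto
          thus "z \<otimes>\<^bsub>L\<^esub> Ed e = \<zero>\<^bsub>L\<^esub>" using True by simp
        qed
        hence "h z (h (pt (v, [])) (X.b (?\<tau>, 0))) = \<zero>\<^bsub>X.M\<^esub>"
          using rep_mult[OF d(2) pt_closed[of "(v, [])"], of "X.b (?\<tau>, 0)"] ap v by (simp add: rep_zero)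
        hence "h z (X.b (?\<tau>, 0)) = \<zero>\<^bsub>X.M\<^esub>"
          using rep_basis[of "(v, [])" ?\<tau> 0] ap v by (simp add: path_append_def)
        thus ?thesis using that[OF ap] by simp
      next
        case out: False
        hence "infinite (out_arcs G v)" using False v by (simp add: regular_vertex_def)
        \<comment> \<open>A vertex that is neither regular nor a sink emits infinitely many edges,
          so one of them avoids the finite set \<open>F\<close>.\<close>
        then obtain e where "e \<in> out_arcs G v - F"
          using d(4) by (metis Diff_eq_empty_iff equals0I finite_subset)
        hence e: "e \<in> arcs G" "tail G e = v" "e \<notin> F" by auto
        obtain \<tau>' where \<tau>': "\<tau>' \<in> ap_trails G" "trail_source G \<tau>' = head G e"
          using ap_trail_from[OF head_in_verts[OF e(1)]] by blast
        let ?\<tau> = "trail_append (edge_path G e) \<tau>'"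
        have ep: "edge_path G e \<in> gpaths G" using e by simp
        have ap: "?\<tau> \<in> ap_trails G" by (rule trail_append_ap_trails[OF ep]) (use \<tau>' in simp_all)
        have src: "trail_source G ?\<tau> = v" using trail_source_append[OF ep, of \<tau>'] \<tau>' e by simp
        \<comment> \<open>The superscript \<open>-1\<close> compensates the length of
          \<open>e\<close>: the operator of \<open>e\<close> maps this vector to the basis element
          of the new trail with superscript \<open>0\<close>.\<close>
        have "h z (h (pt (edge_path G e)) (X.b (\<tau>', -1))) = h (z \<otimes>\<^bsub>L\<^esub> Ed e) (X.b (\<tau>', -1))"
          using rep_mult[OF d(2) pt_closed[OF ep], of "X.b (\<tau>', -1)"] \<tau>' by simp
        also have "\<dots> = \<zero>\<^bsub>X.M\<^esub>" using edge_proj_edge_zero[OF d(2,6,5) e(1,3)] \<tau>' by (simp add: rep_zero)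
        finally have "h z (X.b (?\<tau>, 0)) = \<zero>\<^bsub>X.M\<^esub>"
          using rep_basis[OF ep \<tau>'(1), of "-1"] \<tau>' by simp
        thus ?thesis using that[OF ap src] by simp
      qed
      have b: "X.b (\<tau>, 0) \<in> carrier X.M" using \<tau> by simp
      have "h p (X.b (\<tau>, 0)) \<oplus>\<^bsub>X.M\<^esub> h z (X.b (\<tau>, 0)) = \<zero>\<^bsub>X.M\<^esub>"
        using hx[OF b] rep_add[OF p d(2) b] d(3) by simp
      hence "h p (X.b (\<tau>, 0)) = \<zero>\<^bsub>X.M\<^esub>" using \<tau>(3) rep_apply_closed[OF p b] by simp
      hence pv: "p \<otimes>\<^bsub>L\<^esub> V v = \<zero>\<^bsub>L\<^esub>" by (rule path_span_vertex_zero[OF d(1) \<tau>(1,2)])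
      have "z \<otimes>\<^bsub>L\<^esub> V v = \<zero>\<^bsub>L\<^esub>"
      proof (rule edge_proj_vertex_zero[OF d(2,6,5) v])
        \<comment> \<open>Since \<open>e\<close> starts at \<open>v\<close>, multiplying
          \<open>p\<close> by \<open>e\<close> factors through \<open>p\<close> times
          \<open>v\<close> and gives zero. As \<open>x\<close> times \<open>e\<close> is zero by
          induction, so is \<open>z\<close> times \<open>e\<close>.\<close>
        fix e assume "e \<in> F" and t: "tail G e = v"
        hence e: "e \<in> arcs G" using d(5) by auto
        have "p \<otimes>\<^bsub>L\<^esub> Ed e = p \<otimes>\<^bsub>L\<^esub> V v \<otimes>\<^bsub>L\<^esub> Ed e"
          using L_rels(3)[OF e] p v e t by (simp add: L.mult_assoc)
        hence pe: "p \<otimes>\<^bsub>L\<^esub> Ed e = \<zero>\<^bsub>L\<^esub>" using pv e by simp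
        have "x \<otimes>\<^bsub>L\<^esub> Ed e = p \<otimes>\<^bsub>L\<^esub> Ed e \<oplus>\<^bsub>L\<^esub> z \<otimes>\<^bsub>L\<^esub> Ed e"
          unfolding d(3) using p d(2) e by (simp add: L.distrib_right)
        thus "z \<otimes>\<^bsub>L\<^esub> Ed e = \<zero>\<^bsub>L\<^esub>" using pe xe[OF e] d(2) e by simp
      qed
      thus ?thesis unfolding d(3) using p d(2) v pv by (simp add: L.distrib_right)
    qed
  qed
qed

theorem associated_rep_inj: "inj_on h (carrier L)"
proof (rule inj_onI)
  fix x y assume x: "x \<in> carrier L" and y: "y \<in> carrier L" and eq: "h x = h y"
  let ?d = "x \<ominus>\<^bsub>L\<^esub> y"
  have d: "?d \<in> carrier L" using x y by simp
  have y_eq: "x = ?d \<oplus>\<^bsub>L\<^esub> y" using x y by (simp add: a_minus_def L.M.a_assoc L.M.l_neg)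
  have "h x = h (?d \<oplus>\<^bsub>L\<^esub> y)" by (rule arg_cong[OF y_eq])
  also have "\<dots> = h ?d \<oplus>\<^bsub>X.End\<^esub> h y" using rep_hom d y by (simp add: alg_hom_def)
  finally have "h x = h ?d \<oplus>\<^bsub>X.End\<^esub> h y" .
  hence "h ?d = \<zero>\<^bsub>X.End\<^esub>" using eq rep_End[OF d] rep_End[OF y] by (simp add: X.E.M.add.l_cancel_one')
  moreover obtain n where "level n ?d" using d by (rule level_exists)
  ultimately have "?d = \<zero>\<^bsub>L\<^esub>" using kernel_zero by blast
  thus "x = y" using y by (subst y_eq) simp
qed

end

end

theorem proposition3p8:
  fixes R :: "('r, 'm) ring_scheme" and G :: "('v, 'e) pre_digraph"
  assumes "cring R" and "wf_digraph G"
  shows "\<exists>\<E> star gr.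
    subalgebra R \<E> (End_alg R (trail_module R G)) \<and>
    involution_on R \<E> star \<and>
    int_grading R \<E> gr \<and> (\<forall>k. gr k \<subseteq> degree_part R G k) \<and>
    (\<exists>!S. S \<in> extensional (gpaths G) \<and> cuntz_krieger_system G \<E> star S \<and> trail_system R G S) \<and>
    (\<forall>S. S \<in> extensional (gpaths G) \<and> cuntz_krieger_system G \<E> star S \<and> trail_system R G S \<longrightarrow>
      (\<exists>!\<Phi>. \<Phi> \<in> extensional (carrier (leavitt_algebra R G)) \<and> associated_rep R G \<E> star S \<Phi>) \<and>
      (\<forall>\<Phi>. associated_rep R G \<E> star S \<Phi> \<longrightarrow> inj_on \<Phi> (carrier (leavitt_algebra R G))))"
proof -
  interpret cring R by fact
  interpret wf_digraph G by fact
  interpret trail_rep G R ..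
  have unique: "T = S"
    if "T \<in> extensional (gpaths G) \<and> cuntz_krieger_system G X.A X.adj T \<and> trail_system R G T" for T
    by (rule S_unique) (use that X.graded_adj_End in \<open>auto simp: cuntz_krieger_system_def\<close>)
  have S: "S \<in> extensional (gpaths G) \<and> cuntz_krieger_system G X.A X.adj S \<and> trail_system R G S"
    using cuntz_krieger_S trail_system_S by (simp add: S_def)
  show ?thesis
  proof (intro exI conjI allI impI)
    show "subalgebra R X.A (End_alg R (trail_module R G))"
      unfolding trail_module_eq by (rule X.A_subalgebra)
    show "involution_on R X.A X.adj" by (rule X.A_involution)
    show "int_grading R X.A X.adj_part" by (rule X.A_grading)
    show "X.adj_part k \<subseteq> degree_part R G k" for k
      unfolding degree_part_eq by (rule X.adj_part_dpart)
    show "\<exists>!S. S \<in> extensional (gpaths G) \<and> cuntz_krieger_system G X.A X.adj S \<and> trail_system R G S"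
      using S unique by blast
    \<comment> \<open>By uniqueness \<open>T\<close> is the constructed system \<open>S\<close>, for
      which the representation has been studied.\<close>
    fix T assume "T \<in> extensional (gpaths G) \<and> cuntz_krieger_system G X.A X.adj T \<and> trail_system R G T"
    hence T: "T = S" by (rule unique)
    show "\<exists>!\<Phi>. \<Phi> \<in> extensional (carrier L) \<and> associated_rep R G X.A X.adj T \<Phi>"
      unfolding T by (rule CK.associated_rep_unique)
    show "inj_on \<Phi> (carrier L)" if "associated_rep R G X.A X.adj T \<Phi>" for \<Phi>
      using associated_rep_inj that unfolding T .
  qed
qed

end
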